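(* For each $r>0$, there exists a sequence of open discs $\{D_k\}_{k=1}^\infty$ in $\mathbb{C}$ such that $\sum_{k=1}^\infty r(D_k)<r$ and, setting $K=\overline{D}\setminus\bigcup_{k=1}^\infty D_k$, the following conditions hold: (i) $R(K)$ is normal. (ii) $R(K)$ is strongly regular at every point of $K\setminus\partial D$. (iii) There is a set $\Lambda\subset\partial D$ whose complement in $\partial D$ has one-dimensional Lebesgue measure less than $r$ such that $\Lambda$ is contained in $K$ and at each point of $\Lambda$ the uniform algebra $R(K)$ fails to be strongly regular. Furthermore, the discs $\{D_k\}_{k=1}^\infty$ can be chosen in such a way that, in addition to $\sum_{k=1}^\infty r(D_k)<r$ and conditions (i), (ii) and (iii) (with $\Lambda$ the set in (iii)), one has $I_{\rho_1}^\lambda\supsetneq I_{\rho_2}^\lambda$ for every $\lambda\in\Lambda$ and all real numbers $0\le\rho_1<\rho_2$.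
   Context: $D$ is the open unit disc in $\mathbb{C}$, $\overline{D}$ the closed unit disc, $\partial D$ the unit circle, and $r(\Delta)$ denotes the radius of a disc $\Delta$. For $K\subset\mathbb{C}$ compact, $R(K)$ is the uniform closure in $C(K)$ (continuous complex-valued functions with supremum norm) of the rational functions with poles off $K$; it is a uniform algebra on $K$, i.e. a closed subalgebra of $C(K)$ containing the constants and separating points. A uniform algebra $A$ on a compact Hausdorff space $X$ is natural if its maximal ideal space is $X$ (identifying points with evaluation functionals); it is normal if it is natural and for each pair of disjoint closed sets $K_0,K_1\subset X$ there is $f\in A$ with $f=1$ on $K_1$ and $f=0$ on $K_0$. For $x\in X$, $M_x=\{f\in A: f(x)=0\}$ and $J_x=\{f\in A: f^{-1}(0)\text{ contains a neighborhood of }x\text{ in }X\}$; $A$ is strongly regular at $x$ if $\overline{J_x}=M_x$. For a compact set $K\subset\overline{D}$, a point $\lambda\in K\cap\partial D$ and a real $\rho\ge0$, $I_\rho^\lambda$ denotes the closed ideal in $R(K)$ generated by the function $z\mapsto (z-\lambda)\exp\left[\rho\,\frac{z+\lambda}{z-\lambda}\right]$ (given the value $0$ at $z=\lambda$; this function is continuous on $\overline D$ and holomorphic on $D$, so its restriction to $K$ belongs to $R(K)$). *)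

theory Defs
  imports "HOL-Analysis.Analysis" "HOL-Computational_Algebra.Polynomial"
begin

section \<open>Uniform algebras\<close>

text \<open>A function on \<open>X\<close> is represented by an element of \<open>extensional (topspace X)\<close>, so that
  equality in \<open>C(X)\<close> is equality in HOL; consequently the algebra operations are restricted to
  \<open>topspace X\<close>.\<close>

definition cont_funs :: "'a topology \<Rightarrow> ('a \<Rightarrow> complex) set" where
  "cont_funs X = {f \<in> extensional (topspace X). continuous_map X euclidean f}"

definition fadd :: "'a topology \<Rightarrow> ('a \<Rightarrow> complex) \<Rightarrow> ('a \<Rightarrow> complex) \<Rightarrow> 'a \<Rightarrow> complex" where
  "fadd X f g = (\<lambda>x\<in>topspace X. f x + g x)"

definition fmult :: "'a topology \<Rightarrow> ('a \<Rightarrow> complex) \<Rightarrow> ('a \<Rightarrow> complex) \<Rightarrow> 'a \<Rightarrow> complex" where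
  "fmult X f g = (\<lambda>x\<in>topspace X. f x * g x)"

definition fconst :: "'a topology \<Rightarrow> complex \<Rightarrow> 'a \<Rightarrow> complex" where
  "fconst X c = (\<lambda>x\<in>topspace X. c)"

definition uniform_closure :: "'a topology \<Rightarrow> ('a \<Rightarrow> complex) set \<Rightarrow> ('a \<Rightarrow> complex) set" where
  "uniform_closure X S =
     {f \<in> cont_funs X. \<forall>e>0. \<exists>g\<in>S. \<forall>x\<in>topspace X. norm (f x - g x) < e}"

text \<open>Closure under scalar multiplication follows from containing the constants.\<close>

definition uniform_algebra :: "'a topology \<Rightarrow> ('a \<Rightarrow> complex) set \<Rightarrow> bool" where
  "uniform_algebra X A \<longleftrightarrow>
     compact_space X \<and> Hausdorff_space X \<and>
     A \<subseteq> cont_funs X \<and>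
     uniform_closure X A = A \<and>
     (\<forall>c. fconst X c \<in> A) \<and>
     (\<forall>f\<in>A. \<forall>g\<in>A. fadd X f g \<in> A \<and> fmult X f g \<in> A) \<and>
     (\<forall>x\<in>topspace X. \<forall>y\<in>topspace X. x \<noteq> y \<longrightarrow> (\<exists>f\<in>A. f x \<noteq> f y))"

definition character :: "'a topology \<Rightarrow> ('a \<Rightarrow> complex) set \<Rightarrow> (('a \<Rightarrow> complex) \<Rightarrow> complex) \<Rightarrow> bool" where
  "character X A \<phi> \<longleftrightarrow>
     \<phi> \<in> extensional A \<and>
     (\<forall>f\<in>A. \<forall>g\<in>A. \<phi> (fadd X f g) = \<phi> f + \<phi> g) \<and>
     (\<forall>c. \<forall>f\<in>A. \<phi> (fmult X (fconst X c) f) = c * \<phi> f) \<and>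
     (\<forall>f\<in>A. \<forall>g\<in>A. \<phi> (fmult X f g) = \<phi> f * \<phi> g) \<and>
     (\<exists>f\<in>A. \<phi> f \<noteq> 0)"

text \<open>The Gelfand (weak-star) topology is the topology of pointwise convergence on \<open>A\<close>.\<close>

definition maximal_ideal_space ::
    "'a topology \<Rightarrow> ('a \<Rightarrow> complex) set \<Rightarrow> (('a \<Rightarrow> complex) \<Rightarrow> complex) topology" where
  "maximal_ideal_space X A =
     subtopology (product_topology (\<lambda>_. euclidean) A) {\<phi>. character X A \<phi>}"

definition natural_algebra :: "'a topology \<Rightarrow> ('a \<Rightarrow> complex) set \<Rightarrow> bool" where
  "natural_algebra X A \<longleftrightarrow>
     uniform_algebra X A \<and>
     homeomorphic_map X (maximal_ideal_space X A) (\<lambda>x. \<lambda>f\<in>A. f x)"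

definition normal_algebra :: "'a topology \<Rightarrow> ('a \<Rightarrow> complex) set \<Rightarrow> bool" where
  "normal_algebra X A \<longleftrightarrow>
     natural_algebra X A \<and>
     (\<forall>K0 K1. closedin X K0 \<and> closedin X K1 \<and> K0 \<inter> K1 = {} \<longrightarrow>
        (\<exists>f\<in>A. (\<forall>x\<in>K1. f x = 1) \<and> (\<forall>x\<in>K0. f x = 0)))"

definition M_ideal :: "('a \<Rightarrow> complex) set \<Rightarrow> 'a \<Rightarrow> ('a \<Rightarrow> complex) set" where
  "M_ideal A x = {f \<in> A. f x = 0}"

definition J_ideal :: "'a topology \<Rightarrow> ('a \<Rightarrow> complex) set \<Rightarrow> 'a \<Rightarrow> ('a \<Rightarrow> complex) set" where
  "J_ideal X A x = {f \<in> A. \<exists>U. openin X U \<and> x \<in> U \<and> (\<forall>y\<in>U. f y = 0)}"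

definition strongly_regular_at :: "'a topology \<Rightarrow> ('a \<Rightarrow> complex) set \<Rightarrow> 'a \<Rightarrow> bool" where
  "strongly_regular_at X A x \<longleftrightarrow> uniform_closure X (J_ideal X A x) = M_ideal A x"

definition closed_ideal :: "'a topology \<Rightarrow> ('a \<Rightarrow> complex) set \<Rightarrow> ('a \<Rightarrow> complex) set \<Rightarrow> bool" where
  "closed_ideal X A I \<longleftrightarrow>
     I \<subseteq> A \<and> fconst X 0 \<in> I \<and>
     (\<forall>f\<in>I. \<forall>g\<in>I. fadd X f g \<in> I) \<and>
     (\<forall>f\<in>A. \<forall>g\<in>I. fmult X f g \<in> I) \<and>
     uniform_closure X I = I"

definition closed_ideal_generated ::
    "'a topology \<Rightarrow> ('a \<Rightarrow> complex) set \<Rightarrow> ('a \<Rightarrow> complex) \<Rightarrow> ('a \<Rightarrow> complex) set" where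
  "closed_ideal_generated X A g = {f \<in> A. \<forall>I. closed_ideal X A I \<and> g \<in> I \<longrightarrow> f \<in> I}"


section \<open>The algebra \<open>R(K)\<close> and the ideals \<open>I\<^sub>\<rho>\<close>\<close>

text \<open>A rational function has no pole on \<open>K\<close> iff its denominator in lowest terms has no zero
  on \<open>K\<close>.\<close>

definition rational_funs :: "complex set \<Rightarrow> (complex \<Rightarrow> complex) set" where
  "rational_funs K = {\<lambda>z\<in>K. poly p z / poly q z | p q. \<forall>z\<in>K. poly q z \<noteq> 0}"

definition R_alg :: "complex set \<Rightarrow> (complex \<Rightarrow> complex) set" where
  "R_alg K = uniform_closure (top_of_set K) (rational_funs K)"

definition I_gen :: "complex set \<Rightarrow> real \<Rightarrow> complex \<Rightarrow> complex \<Rightarrow> complex" where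
  "I_gen K \<rho> \<zeta> = (\<lambda>z\<in>K. if z = \<zeta> then 0
     else (z - \<zeta>) * exp (of_real \<rho> * ((z + \<zeta>) / (z - \<zeta>))))"

definition I_ideal :: "complex set \<Rightarrow> real \<Rightarrow> complex \<Rightarrow> (complex \<Rightarrow> complex) set" where
  "I_ideal K \<rho> \<zeta> = closed_ideal_generated (top_of_set K) (R_alg K) (I_gen K \<rho> \<zeta>)"


section \<open>Arc length\<close>

text \<open>One-dimensional Lebesgue measure on the unit circle, with total mass \<open>2 * pi\<close>.\<close>

definition circle_measure :: "complex measure" where
  "circle_measure =
     completion (distr (restrict_space lborel {0..<2 * pi}) (restrict_space borel (sphere 0 1)) cis)"

end

theory Submission
  imports Defs "HOL-Complex_Analysis.Complex_Analysis"
begin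

text \<open>The set \<open>K\<close> arises by deleting two kinds of discs. Near the circles of a countable dense family, discs around
  the poles of the functions \<open>1 / (1 - ((z - a) / t) ^ N)\<close> allow infinite products, and from them elements of \<open>R(K)\<close> that are
  \<open>1\<close> inside the circle and \<open>0\<close> outside (the construction of McKissick and Koerner); these make \<open>R(K)\<close> normal.
  Further, for every \<open>m\<close> a fine grid of tiny discs in a smaller concentric disc lets one approximate
  \<open>z - x\<close>, for all \<open>x\<close> in that disc at once, by elements of \<open>R(K)\<close> that are almost \<open>0\<close> near \<open>x\<close>. A cutoff of the first kind
  makes them exactly \<open>0\<close> near \<open>x\<close>, so \<open>z - x\<close> lies in the closure of \<open>J\<^sub>x\<close>, which is strong regularity at \<open>x\<close>.

  All radii are so small that for \<open>\<lambda>\<close> in \<open>\<Lambda>\<close> the sum of \<open>radius * exp (N / distance to \<lambda>)\<close> is finite for every \<open>N\<close>. So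
  \<open>exp (- \<rho> (z + \<lambda>) / (z - \<lambda>)) dz\<close> acts like a finite measure on the boundary of \<open>K\<close>: it annihilates the ideal \<open>I\<^sub>\<rho>\<close> but,
  having an essential singularity at \<open>\<lambda>\<close> with nonzero residue, not \<open>I\<^sub>\<sigma>\<close> for \<open>\<sigma> < \<rho>\<close>. Since \<open>J\<^sub>\<lambda>\<close> is contained in every
  \<open>I\<^sub>\<rho>\<close>, strong regularity fails at \<open>\<lambda>\<close>.\<close>

section \<open>Rational approximation\<close>

text \<open>The two aims compete: strong regularity at an interior point \<open>x\<close> wants
  discs near \<open>x\<close>, but there are uncountably many \<open>x\<close> and the radii must be
  summable. So the grid discs are placed independently of \<open>x\<close> and only the rational
  function depends on it. The logarithmic profile makes the pole strengths smaller by a factor 1 /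
  T, which pays for a prescribed tiny total radius. The inner scale is fixed before the accuracy,
  because the accuracy has to beat the bound of cutoffs that are chosen according to that scale. At
  the boundary, all discs of the j-th circle lie in an annulus of half-width \<open>w j\<close>, and
  \<Lambda> omits the points of the unit circle within \<open>2 * w j\<close> of that circle. What
  remains is at distance at least \<open>w j\<close> from these discs, and the factor
  \<open>exp (- j / w j)\<close> in the radii beats \<open>exp (N / w j)\<close> once
  \<open>j\<close> exceeds \<open>N\<close>. The grids stop short of the unit circle for the same
  reason. The residue that separates the ideals is \<open>c^2 / 2\<close>, the coefficient of
  \<open>1 / w\<close> in \<open>w * exp (- c / w)\<close>, with
  \<open>w = z - \<lambda>\<close>.\<close>

definition rational_limit :: "complex set \<Rightarrow> (complex \<Rightarrow> complex) \<Rightarrow> bool" where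
  "rational_limit K f \<longleftrightarrow>
     (\<forall>e>0. \<exists>p q. (\<forall>z\<in>K. poly q z \<noteq> 0) \<and> (\<forall>z\<in>K. norm (f z - poly p z / poly q z) < e))"

lemma rational_limitI:
  assumes "\<And>e. e > 0 \<Longrightarrow> \<exists>p q. (\<forall>z\<in>K. poly q z \<noteq> 0) \<and> (\<forall>z\<in>K. norm (f z - poly p z / poly q z) < e)"
  shows "rational_limit K f"
  using assms by (auto simp: rational_limit_def)

lemma rational_limitE:
  assumes "rational_limit K f" "e > 0"
  obtains q p where "\<forall>z\<in>K. poly q z \<noteq> 0" "\<forall>z\<in>K. norm (f z - poly p z / poly q z) < e"
  using assms unfolding rational_limit_def by blast

lemma rational_limit_rational:
  assumes "\<And>z. z \<in> K \<Longrightarrow> poly q z \<noteq> 0" "\<And>z. z \<in> K \<Longrightarrow> f z = poly p z / poly q z"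
  shows "rational_limit K f"
  by (rule rational_limitI, rule exI[of _ p], rule exI[of _ q]) (use assms in auto)

lemma rational_limit_poly: "rational_limit K (poly p)"
  by (rule rational_limit_rational[of _ 1 _ p]) auto

lemma rational_limit_const: "rational_limit K (\<lambda>_. c)"
  using rational_limit_poly[of K "[:c:]"] by (simp add: rational_limit_def)

lemma rational_limit_diff_const: "rational_limit K (\<lambda>z. z - c)"
  by (rule rational_limit_rational[of _ 1 _ "[:-c, 1:]"]) auto

lemma rational_limit_ident: "rational_limit K (\<lambda>z. z)"
  using rational_limit_diff_const[of K 0] by simp

lemma rational_limit_cong:
  assumes "rational_limit K f" "\<And>z. z \<in> K \<Longrightarrow> f z = g z"
  shows "rational_limit K g"
  using assms unfolding rational_limit_def by metis

lemma rational_limit_subset: "rational_limit K f \<Longrightarrow> L \<subseteq> K \<Longrightarrow> rational_limit L f"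
  unfolding rational_limit_def by (meson subsetD)

lemma rational_limit_closed:
  assumes "\<And>e. e > 0 \<Longrightarrow> \<exists>g. rational_limit K g \<and> (\<forall>z\<in>K. norm (f z - g z) < e)"
  shows "rational_limit K f"
proof (rule rational_limitI)
  fix e :: real assume "e > 0"
  then obtain g where g: "rational_limit K g" "\<forall>z\<in>K. norm (f z - g z) < e/2"
    using assms[of "e/2"] by auto
  have "e/2 > 0" using \<open>e > 0\<close> by simp
  obtain q p where "\<forall>z\<in>K. poly q z \<noteq> 0" "\<forall>z\<in>K. norm (g z - poly p z / poly q z) < e/2"
      by (rule rational_limitE[OF g(1) \<open>e/2 > 0\<close>])
    then have pq: "\<And>z. z \<in> K \<Longrightarrow> poly q z \<noteq> 0" "\<And>z. z \<in> K \<Longrightarrow> norm (g z - poly p z / poly q z) < e/2" by auto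
  have "norm (f z - poly p z / poly q z) < e" if "z \<in> K" for z
    using pq(2)[OF that] g(2) that norm_triangle_lt[of "f z - g z" "g z - poly p z / poly q z" e]
    by force
  with pq(1) show "\<exists>p q. (\<forall>z\<in>K. poly q z \<noteq> 0) \<and> (\<forall>z\<in>K. norm (f z - poly p z / poly q z) < e)"
    by blast
qed

lemma rational_limit_uniform_limit:
  assumes "uniform_limit K f g sequentially" "\<And>n. rational_limit K (f n)"
  shows "rational_limit K g"
proof (rule rational_limit_closed)
  fix e :: real assume "e > 0"
  with uniform_limitD[OF assms(1) this] obtain n where "\<forall>z\<in>K. dist (f n z) (g z) < e"
    by (auto simp: eventually_sequentially)
  then show "\<exists>h. rational_limit K h \<and> (\<forall>z\<in>K. norm (g z - h z) < e)"
    using assms(2)[of n] by (intro exI[of _ "f n"]) (auto simp: dist_norm norm_minus_commute)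
qed

lemma rational_limit_continuous_on:
  assumes "rational_limit K f"
  shows "continuous_on K f"
proof -
  have "\<exists>p q. (\<forall>z\<in>K. poly q z \<noteq> 0) \<and> (\<forall>z\<in>K. norm (f z - poly p z / poly q z) < inverse (Suc n))" for n
    using assms by (simp add: rational_limit_def)
  then obtain p q where pq: "\<And>n z. z \<in> K \<Longrightarrow> poly (q n) z \<noteq> 0"
    "\<And>n z. z \<in> K \<Longrightarrow> norm (f z - poly (p n) z / poly (q n) z) < inverse (Suc n)" by metis
  show ?thesis
  proof (rule uniform_limit_theorem)
    show "uniform_limit K (\<lambda>n z. poly (p n) z / poly (q n) z) f sequentially"
      unfolding uniform_limit_iff
    proof safe
      fix e :: real assume "e > 0"
      then obtain N where N: "inverse (Suc N) < e" using reals_Archimedean by blast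
      have "\<forall>z\<in>K. dist (poly (p n) z / poly (q n) z) (f z) < e" if "n \<ge> N" for n
      proof
        fix z assume "z \<in> K"
        have "inverse (real (Suc n)) \<le> inverse (Suc N)" using that by (simp add: field_simps)
        with pq(2)[OF \<open>z \<in> K\<close>, of n] N
        show "dist (poly (p n) z / poly (q n) z) (f z) < e" unfolding dist_norm by (subst norm_minus_commute) linarith
      qed
      then show "\<forall>\<^sub>F n in sequentially. \<forall>z\<in>K. dist (poly (p n) z / poly (q n) z) (f z) < e"
        by (auto simp: eventually_sequentially)
    qed
    show "\<forall>\<^sub>F n in sequentially. continuous_on K (\<lambda>z. poly (p n) z / poly (q n) z)"
      using pq(1) by (intro always_eventually allI continuous_intros) auto
  qed simp
qed

lemma rational_limit_bounded:
  assumes "rational_limit K f" "compact K"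
  obtains B where "B > 0" "\<And>z. z \<in> K \<Longrightarrow> norm (f z) \<le> B"
proof -
  have "bounded (f ` K)"
    using assms by (intro compact_imp_bounded compact_continuous_image rational_limit_continuous_on)
  then show ?thesis using that by (auto simp: bounded_pos)
qed

lemma rational_limit_add:
  assumes "rational_limit K f" "rational_limit K g"
  shows "rational_limit K (\<lambda>z. f z + g z)"
proof (rule rational_limitI)
  fix e :: real assume "e > 0"
  then have e: "e/2 > 0" by simp
  obtain q p where "\<forall>z\<in>K. poly q z \<noteq> 0" "\<forall>z\<in>K. norm (f z - poly p z / poly q z) < e/2"
      by (rule rational_limitE[OF assms(1) e])
    then have pq: "\<And>z. z \<in> K \<Longrightarrow> poly q z \<noteq> 0" "\<And>z. z \<in> K \<Longrightarrow> norm (f z - poly p z / poly q z) < e/2" by auto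
  obtain q' p' where "\<forall>z\<in>K. poly q' z \<noteq> 0" "\<forall>z\<in>K. norm (g z - poly p' z / poly q' z) < e/2"
      by (rule rational_limitE[OF assms(2) e])
    then have pq': "\<And>z. z \<in> K \<Longrightarrow> poly q' z \<noteq> 0" "\<And>z. z \<in> K \<Longrightarrow> norm (g z - poly p' z / poly q' z) < e/2" by auto
  have "poly (q * q') z \<noteq> 0 \<and> norm (f z + g z - poly (p * q' + p' * q) z / poly (q * q') z) < e"
    if "z \<in> K" for z
  proof -
    have "poly (p * q' + p' * q) z / poly (q * q') z = poly p z / poly q z + poly p' z / poly q' z"
      using pq(1)[OF that] pq'(1)[OF that] by (simp add: field_simps)
    then have "f z + g z - poly (p * q' + p' * q) z / poly (q * q') z
        = (f z - poly p z / poly q z) + (g z - poly p' z / poly q' z)" by simp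
    moreover have "norm ((f z - poly p z / poly q z) + (g z - poly p' z / poly q' z)) < e"
      using pq(2)[OF that] pq'(2)[OF that] by (intro norm_triangle_lt) simp
    ultimately have "norm (f z + g z - poly (p * q' + p' * q) z / poly (q * q') z) < e" by (simp only:)
    then show ?thesis using pq(1)[OF that] pq'(1)[OF that] by simp
  qed
  then show "\<exists>p q. (\<forall>z\<in>K. poly q z \<noteq> 0) \<and> (\<forall>z\<in>K. norm (f z + g z - poly p z / poly q z) < e)" by blast
qed

lemma rational_limit_mult:
  assumes "rational_limit K f" "rational_limit K g" "compact K"
  shows "rational_limit K (\<lambda>z. f z * g z)"
proof (rule rational_limitI)
  fix e :: real assume "e > 0"
  obtain A where A: "A > 0" "\<And>z. z \<in> K \<Longrightarrow> norm (f z) \<le> A" using rational_limit_bounded assms by blast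
  obtain B where B: "B > 0" "\<And>z. z \<in> K \<Longrightarrow> norm (g z) \<le> B" using rational_limit_bounded assms by blast
  \<comment> \<open>The cap 1 bounds the second approximant by \<open>B + 1\<close>; the total error
    is then at most \<open>A * d + d * (B + 1)\<close>.\<close>
  define d where "d = min 1 (e / (A + B + 1))"
  have d: "d > 0" "d \<le> 1" "d \<le> e / (A + B + 1)" using \<open>e > 0\<close> A(1) B(1)
    by (auto simp: d_def)
  then have d3: "d * (A + B + 1) \<le> e" using A(1) B(1) by (simp add: pos_le_divide_eq)
  obtain q p where "\<forall>z\<in>K. poly q z \<noteq> 0" "\<forall>z\<in>K. norm (f z - poly p z / poly q z) < d"
      by (rule rational_limitE[OF assms(1) d(1)])
    then have pq: "\<And>z. z \<in> K \<Longrightarrow> poly q z \<noteq> 0" "\<And>z. z \<in> K \<Longrightarrow> norm (f z - poly p z / poly q z) < d" by auto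
  obtain q' p' where "\<forall>z\<in>K. poly q' z \<noteq> 0" "\<forall>z\<in>K. norm (g z - poly p' z / poly q' z) < d"
      by (rule rational_limitE[OF assms(2) d(1)])
    then have pq': "\<And>z. z \<in> K \<Longrightarrow> poly q' z \<noteq> 0" "\<And>z. z \<in> K \<Longrightarrow> norm (g z - poly p' z / poly q' z) < d" by auto
  have "poly (q * q') z \<noteq> 0 \<and> norm (f z * g z - poly (p * p') z / poly (q * q') z) < e"
    if "z \<in> K" for z
  proof -
    define u v where "u = poly p z / poly q z" and "v = poly p' z / poly q' z"
    have u: "norm (f z - u) < d" and v: "norm (g z - v) < d" using pq pq' that by (auto simp: u_def v_def)
    have "norm v \<le> B + d" using v B(2)[OF that] norm_triangle_sub[of v "g z"] by (simp add: norm_minus_commute)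
    have "norm (f z * g z - u * v) = norm (f z * (g z - v) + (f z - u) * v)" by (simp add: algebra_simps)
    also have "\<dots> \<le> norm (f z) * norm (g z - v) + norm (f z - u) * norm v"
      by (metis norm_mult norm_triangle_ineq)
    also have "\<dots> \<le> A * norm (g z - v) + norm (f z - u) * (B + 1)"
      using A(2)[OF that] \<open>norm v \<le> B + d\<close> d(1,2) A(1) B(1) by (intro add_mono mult_mono) auto
    also have "\<dots> < A * d + d * (B + 1)" using A(1) B(1) u v
      by (intro add_strict_mono mult_strict_left_mono mult_strict_right_mono) auto
    also have "\<dots> \<le> e" using d3 by (simp add: algebra_simps)
    finally show ?thesis using pq(1)[OF that] pq'(1)[OF that] by (simp add: u_def v_def)
  qed
  then show "\<exists>p q. (\<forall>z\<in>K. poly q z \<noteq> 0) \<and> (\<forall>z\<in>K. norm (f z * g z - poly p z / poly q z) < e)" by blast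
qed

lemma rational_limit_uminus: "rational_limit K f \<Longrightarrow> rational_limit K (\<lambda>z. - f z)"
  unfolding rational_limit_def
proof (intro allI impI)
  fix e :: real assume *: "\<forall>e>0. \<exists>p q. (\<forall>z\<in>K. poly q z \<noteq> 0) \<and> (\<forall>z\<in>K. norm (f z - poly p z / poly q z) < e)" and "e > 0"
  then obtain p q where "\<forall>z\<in>K. poly q z \<noteq> 0" "\<forall>z\<in>K. norm (f z - poly p z / poly q z) < e" by blast
  then have "(\<forall>z\<in>K. poly q z \<noteq> 0) \<and> (\<forall>z\<in>K. norm (- f z - poly (- p) z / poly q z) < e)"
    by (auto simp: norm_minus_commute)
  then show "\<exists>p q. (\<forall>z\<in>K. poly q z \<noteq> 0) \<and> (\<forall>z\<in>K. norm (- f z - poly p z / poly q z) < e)" by blast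
qed

lemma rational_limit_diff:
  "rational_limit K f \<Longrightarrow> rational_limit K g \<Longrightarrow> rational_limit K (\<lambda>z. f z - g z)"
  using rational_limit_add[OF _ rational_limit_uminus] by simp

lemma rational_limit_sum:
  assumes "\<And>i. i \<in> I \<Longrightarrow> rational_limit K (f i)"
  shows "rational_limit K (\<lambda>z. \<Sum>i\<in>I. f i z)"
  using assms by (induction I rule: infinite_finite_induct) (auto intro: rational_limit_const rational_limit_add)

lemma rational_limit_prod:
  assumes "\<And>i. i \<in> I \<Longrightarrow> rational_limit K (f i)" "compact K"
  shows "rational_limit K (\<lambda>z. \<Prod>i\<in>I. f i z)"
  using assms by (induction I rule: infinite_finite_induct) (auto intro: rational_limit_const rational_limit_mult)

lemma rational_limit_power:
  "rational_limit K f \<Longrightarrow> compact K \<Longrightarrow> rational_limit K (\<lambda>z. f z ^ n)"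
  using rational_limit_prod[of "{..<n}" K "\<lambda>_. f"] by simp

text \<open>By compactness \<open>norm (f z)\<close> has a positive minimum \<open>m\<close> on
  \<open>K\<close>. An approximant \<open>p / q\<close> within \<open>m / 2\<close> of
  \<open>f\<close> has no zero on \<open>K\<close>, so \<open>q / p\<close> is again
  admissible.\<close>

lemma rational_limit_inverse:
  assumes "rational_limit K f" "compact K" and nz: "\<And>z. z \<in> K \<Longrightarrow> f z \<noteq> 0"
  shows "rational_limit K (\<lambda>z. inverse (f z))"
proof (cases "K = {}")
  case True
  then show ?thesis by (simp add: rational_limit_def)
next
  case False
  have "continuous_on K (\<lambda>z. norm (f z))" using assms(1) by (intro continuous_intros rational_limit_continuous_on)
  then obtain z0 where z0: "z0 \<in> K" "\<And>z. z \<in> K \<Longrightarrow> norm (f z0) \<le> norm (f z)"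
    using continuous_attains_inf[OF assms(2) False] by blast
  define m where "m = norm (f z0)"
  have m: "m > 0" "\<And>z. z \<in> K \<Longrightarrow> m \<le> norm (f z)" using z0 nz by (auto simp: m_def)
  show ?thesis
  proof (rule rational_limitI)
    fix e :: real assume "e > 0"
    \<comment> \<open>The first bound keeps the approximant above \<open>m / 2\<close>, the second
      turns \<open>d / (m * (m / 2))\<close> into at most \<open>e\<close>.\<close>
    define d where "d = min (m/2) (e * m\<^sup>2 / 2)"
    have d: "d > 0" "d \<le> m/2" "d \<le> e * m\<^sup>2 / 2" using m(1) \<open>e > 0\<close> by (auto simp: d_def)
    obtain q p where "\<forall>z\<in>K. poly q z \<noteq> 0" "\<forall>z\<in>K. norm (f z - poly p z / poly q z) < d"
      by (rule rational_limitE[OF assms(1) d(1)])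
    then have pq: "\<And>z. z \<in> K \<Longrightarrow> poly q z \<noteq> 0" "\<And>z. z \<in> K \<Longrightarrow> norm (f z - poly p z / poly q z) < d" by auto
    have "poly p z \<noteq> 0 \<and> norm (inverse (f z) - poly q z / poly p z) < e" if "z \<in> K" for z
    proof -
      define u where "u = poly p z / poly q z"
      have u: "norm (f z - u) < d" using pq that by (auto simp: u_def)
      have "norm (f z) \<le> norm (f z - u) + norm u" by (metis norm_triangle_sub add.commute)
      then have um: "norm u > m/2" using m(2)[OF that] u d(2) by linarith
      then have "u \<noteq> 0" using m(1) by auto
      then have pz: "poly p z \<noteq> 0" by (auto simp: u_def)
      have "inverse (f z) - inverse u = (u - f z) / (f z * u)" using \<open>u \<noteq> 0\<close> nz[OF that] by (simp add: field_simps)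
      then have "norm (inverse (f z) - inverse u) = norm (f z - u) / (norm (f z) * norm u)"
        by (simp add: norm_divide norm_mult norm_minus_commute)
      also have "\<dots> < d / (norm (f z) * norm u)" using u nz[OF that] \<open>u \<noteq> 0\<close> by (simp add: divide_strict_right_mono)
      also have "\<dots> \<le> d / (m * (m/2))" using m um that d(1) nz[OF that] \<open>u \<noteq> 0\<close> by (intro divide_left_mono mult_mono) auto
      also have "\<dots> \<le> e" using d(3) m(1) by (simp add: field_simps power2_eq_square)
      finally show ?thesis using pz by (simp add: u_def)
    qed
    then show "\<exists>p q. (\<forall>z\<in>K. poly q z \<noteq> 0) \<and> (\<forall>z\<in>K. norm (inverse (f z) - poly p z / poly q z) < e)" by blast
  qed
qed

lemma rational_limit_divide:
  assumes "rational_limit K f" "rational_limit K g" "compact K" "\<And>z. z \<in> K \<Longrightarrow> g z \<noteq> 0"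
  shows "rational_limit K (\<lambda>z. f z / g z)"
  unfolding divide_inverse by (intro rational_limit_mult rational_limit_inverse assms)

lemma rational_limit_exp:
  assumes "rational_limit K f" "compact K"
  shows "rational_limit K (\<lambda>z. exp (f z))"
proof -
  obtain B where B: "B > 0" "\<And>z. z \<in> K \<Longrightarrow> norm (f z) \<le> B" using rational_limit_bounded assms by blast
  have "uniform_limit K (\<lambda>n z. \<Sum>i<n. f z ^ i /\<^sub>R fact i) (\<lambda>z. \<Sum>i. f z ^ i /\<^sub>R fact i) sequentially"
  proof (rule Weierstrass_m_test)
    show "norm (f z ^ i /\<^sub>R fact i) \<le> B ^ i /\<^sub>R fact i" if "z \<in> K" for i z
      using B that by (simp add: norm_power power_mono divide_right_mono mult_left_mono)
    show "summable (\<lambda>i. B ^ i /\<^sub>R fact i)" by (rule summable_exp_generic)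
  qed
  then have "uniform_limit K (\<lambda>n z. \<Sum>i<n. f z ^ i /\<^sub>R fact i) (\<lambda>z. exp (f z)) sequentially"
    by (simp add: exp_def)
  moreover have "rational_limit K (\<lambda>z. \<Sum>i<n. f z ^ i /\<^sub>R fact i)" for n
    unfolding scaleR_conv_of_real
    by (intro rational_limit_sum rational_limit_mult rational_limit_power rational_limit_const assms)
  ultimately show ?thesis by (rule rational_limit_uniform_limit)
qed

text \<open>The bridge to total functions: \<open>rational_limit\<close> only sees values on
  \<open>K\<close>, so sums, products and quotients can be handled without \<open>restrict\<close>,
  which is applied once at the end.\<close>

lemma R_alg_iff: "f \<in> R_alg K \<longleftrightarrow> f \<in> extensional K \<and> rational_limit K f"
proof
  assume f: "f \<in> R_alg K"
  then have "f \<in> extensional K" by (simp add: R_alg_def uniform_closure_def cont_funs_def)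
  moreover have "rational_limit K f"
  proof (rule rational_limitI)
    fix e :: real assume "e > 0"
    then obtain g where g: "g \<in> rational_funs K" "\<forall>x\<in>K. norm (f x - g x) < e"
      using f by (auto simp: R_alg_def uniform_closure_def)
    then obtain p q where "g = (\<lambda>z\<in>K. poly p z / poly q z)" "\<forall>z\<in>K. poly q z \<noteq> 0"
      by (auto simp: rational_funs_def)
    with g(2) show "\<exists>p q. (\<forall>z\<in>K. poly q z \<noteq> 0) \<and> (\<forall>z\<in>K. norm (f z - poly p z / poly q z) < e)"
      by (intro exI[of _ p] exI[of _ q]) auto
  qed
  ultimately show "f \<in> extensional K \<and> rational_limit K f" by blast
next
  assume f: "f \<in> extensional K \<and> rational_limit K f"
  have "\<exists>g\<in>rational_funs K. \<forall>x\<in>K. norm (f x - g x) < e" if e: "e > 0" for e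
  proof -
    obtain q p where "\<forall>z\<in>K. poly q z \<noteq> 0" "\<forall>z\<in>K. norm (f z - poly p z / poly q z) < e"
      by (rule rational_limitE[OF conjunct2[OF f] e])
    then have pq: "\<And>z. z \<in> K \<Longrightarrow> poly q z \<noteq> 0" "\<And>z. z \<in> K \<Longrightarrow> norm (f z - poly p z / poly q z) < e" by auto
    show ?thesis
    proof (rule bexI[of _ "\<lambda>z\<in>K. poly p z / poly q z"])
      show "(\<lambda>z\<in>K. poly p z / poly q z) \<in> rational_funs K"
        using pq(1) by (auto simp: rational_funs_def)
    qed (use pq(2) in auto)
  qed
  then show "f \<in> R_alg K"
    using f rational_limit_continuous_on[of K f] by (auto simp: R_alg_def uniform_closure_def cont_funs_def)
qed

lemma restrict_in_R_alg_iff: "restrict f K \<in> R_alg K \<longleftrightarrow> rational_limit K f"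
  by (auto simp: R_alg_iff intro: rational_limit_cong)

lemma R_alg_rational_limit: "f \<in> R_alg K \<Longrightarrow> rational_limit K f"
  by (simp add: R_alg_iff)

section \<open>The uniform algebra \<open>R(K)\<close>\<close>

lemma fadd_restrict: "fadd (top_of_set K) f g = (\<lambda>z\<in>K. f z + g z)"
  by (simp add: fadd_def)

lemma fmult_restrict: "fmult (top_of_set K) f g = (\<lambda>z\<in>K. f z * g z)"
  by (simp add: fmult_def)

lemma fconst_restrict: "fconst (top_of_set K) c = (\<lambda>z\<in>K. c)"
  by (simp add: fconst_def)

lemma R_alg_fconst: "fconst (top_of_set K) c \<in> R_alg K"
  by (simp add: fconst_restrict restrict_in_R_alg_iff rational_limit_const)

lemma R_alg_fadd: "f \<in> R_alg K \<Longrightarrow> g \<in> R_alg K \<Longrightarrow> fadd (top_of_set K) f g \<in> R_alg K"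
  by (simp add: fadd_restrict restrict_in_R_alg_iff R_alg_rational_limit rational_limit_add)

lemma R_alg_fmult: "compact K \<Longrightarrow> f \<in> R_alg K \<Longrightarrow> g \<in> R_alg K \<Longrightarrow> fmult (top_of_set K) f g \<in> R_alg K"
  by (simp add: fmult_restrict restrict_in_R_alg_iff R_alg_rational_limit rational_limit_mult)

lemma R_alg_subset_cont_funs: "R_alg K \<subseteq> cont_funs (top_of_set K)"
  by (auto simp: R_alg_def uniform_closure_def)

lemma uniform_closure_superset: "S \<subseteq> cont_funs X \<Longrightarrow> S \<subseteq> uniform_closure X S"
proof
  fix f assume "S \<subseteq> cont_funs X" "f \<in> S"
  moreover have "\<exists>g\<in>S. \<forall>x\<in>topspace X. norm (f x - g x) < e" if "e > 0" for e
    using \<open>f \<in> S\<close> that by (intro bexI[of _ f]) auto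
  ultimately show "f \<in> uniform_closure X S" by (auto simp: uniform_closure_def)
qed

lemma uniform_closure_idem: "uniform_closure X (uniform_closure X S) = uniform_closure X S"
proof
  show "uniform_closure X (uniform_closure X S) \<subseteq> uniform_closure X S"
  proof
    fix f assume f: "f \<in> uniform_closure X (uniform_closure X S)"
    have "\<exists>h\<in>S. \<forall>x\<in>topspace X. norm (f x - h x) < e" if "e > 0" for e
    proof -
      have "e/2 > 0" using that by simp
      obtain g where g: "g \<in> uniform_closure X S" "\<forall>x\<in>topspace X. norm (f x - g x) < e/2"
        using f \<open>e/2 > 0\<close> unfolding uniform_closure_def[of X "uniform_closure X S"] by blast
      obtain h where h: "h \<in> S" "\<forall>x\<in>topspace X. norm (g x - h x) < e/2"
        using g(1) \<open>e/2 > 0\<close> unfolding uniform_closure_def by blast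
      have "norm (f x - h x) < e" if "x \<in> topspace X" for x
        using norm_diff_triangle_less[of "f x" "g x" "e/2" "h x" "e/2"] g h that by simp
      with h(1) show ?thesis by blast
    qed
    then show "f \<in> uniform_closure X S" using f by (simp add: uniform_closure_def)
  qed
qed (rule uniform_closure_superset, auto simp: uniform_closure_def)

lemma uniform_closure_R_alg: "uniform_closure (top_of_set K) (R_alg K) = R_alg K"
  by (simp add: R_alg_def uniform_closure_idem)

lemma uniform_algebra_R_alg:
  assumes "compact K"
  shows "uniform_algebra (top_of_set K) (R_alg K)"
  unfolding uniform_algebra_def
proof (intro conjI allI ballI impI)
  show "compact_space (top_of_set K)" using assms by (simp add: compact_space_subtopology)
  show "Hausdorff_space (top_of_set K)" by (simp add: Hausdorff_space_subtopology)
next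
  fix x y assume "x \<in> topspace (top_of_set K)" "y \<in> topspace (top_of_set K)" "x \<noteq> y"
  then show "\<exists>f\<in>R_alg K. f x \<noteq> f y"
    by (intro bexI[of _ "\<lambda>z\<in>K. z"]) (auto simp: restrict_in_R_alg_iff rational_limit_ident)
qed (use assms in \<open>auto simp: R_alg_subset_cont_funs uniform_closure_R_alg R_alg_fconst R_alg_fadd R_alg_fmult\<close>)

lemma character_eval:
  assumes "x \<in> K" and that: "compact K"
  shows "character (top_of_set K) (R_alg K) (\<lambda>f\<in>R_alg K. f x)"
  unfolding character_def
proof (intro conjI ballI allI)
  show "\<exists>f\<in>R_alg K. (\<lambda>f\<in>R_alg K. f x) f \<noteq> 0"
    by (rule bexI[OF _ R_alg_fconst[of K 1]]) (use assms R_alg_fconst[of K 1] in \<open>simp add: fconst_restrict\<close>)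
qed (use assms that in \<open>auto simp: R_alg_fadd R_alg_fmult R_alg_fconst\<close>,
     auto simp: fadd_restrict fmult_restrict fconst_restrict)

text \<open>A function without zeros on \<open>K\<close> is invertible in R(K), so a character maps
  \<open>f\<close> to one of its values. For the coordinate function this value is the point
  \<open>a\<close>; multiplicativity settles rational functions, and density the rest.\<close>

lemma character_R_alg_is_eval:
  assumes K: "compact K" and \<phi>: "character (top_of_set K) (R_alg K) \<phi>"
  shows "\<exists>x\<in>K. \<phi> = (\<lambda>f\<in>R_alg K. f x)"
proof -
  let ?A = "R_alg K"
  define \<psi> where "\<psi> f = \<phi> (restrict f K)" for f
  have add: "\<psi> (\<lambda>z. f z + g z) = \<psi> f + \<psi> g" if "rational_limit K f" "rational_limit K g" for f g
  proof -
    have "\<phi> (fadd (top_of_set K) (restrict f K) (restrict g K)) = \<phi> (restrict f K) + \<phi> (restrict g K)"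
      using \<phi> that by (simp add: character_def restrict_in_R_alg_iff)
    moreover have "fadd (top_of_set K) (restrict f K) (restrict g K) = restrict (\<lambda>z. f z + g z) K"
      by (auto simp: fadd_restrict restrict_def)
    ultimately show ?thesis by (simp add: \<psi>_def)
  qed
  have mult: "\<psi> (\<lambda>z. f z * g z) = \<psi> f * \<psi> g" if "rational_limit K f" "rational_limit K g" for f g
  proof -
    have "\<phi> (fmult (top_of_set K) (restrict f K) (restrict g K)) = \<phi> (restrict f K) * \<phi> (restrict g K)"
      using \<phi> that by (simp add: character_def restrict_in_R_alg_iff)
    moreover have "fmult (top_of_set K) (restrict f K) (restrict g K) = restrict (\<lambda>z. f z * g z) K"
      by (auto simp: fmult_restrict restrict_def)
    ultimately show ?thesis by (simp add: \<psi>_def)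
  qed
  have scale: "\<psi> (\<lambda>z. c * f z) = c * \<psi> f" if "rational_limit K f" for c f
  proof -
    have "\<phi> (fmult (top_of_set K) (fconst (top_of_set K) c) (restrict f K)) = c * \<phi> (restrict f K)"
      using \<phi> that by (simp add: character_def restrict_in_R_alg_iff)
    moreover have "fmult (top_of_set K) (fconst (top_of_set K) c) (restrict f K) = restrict (\<lambda>z. c * f z) K"
      by (auto simp: fmult_restrict fconst_restrict restrict_def)
    ultimately show ?thesis by (simp add: \<psi>_def)
  qed
  have cong: "\<psi> f = \<psi> g" if "\<And>z. z \<in> K \<Longrightarrow> f z = g z" for f g
    unfolding \<psi>_def using that by (auto intro!: arg_cong[of _ _ \<phi>] simp: restrict_def)
  obtain f0 where f0: "f0 \<in> ?A" "\<phi> f0 \<noteq> 0" using \<phi> by (auto simp: character_def)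
  then have f0': "rational_limit K f0" "\<psi> f0 \<noteq> 0"
    by (auto simp: \<psi>_def R_alg_iff extensional_restrict)
  have one: "\<psi> (\<lambda>_. 1) = 1"
    using mult[OF rational_limit_const f0'(1), of 1] f0'(2) by simp
  have const: "\<psi> (\<lambda>_. c) = c" for c using scale[OF rational_limit_const, of c 1] one by simp
  \<comment> \<open>\<open>f - \<psi> f\<close> is annihilated by \<open>\<psi>\<close>, hence is
    not invertible.\<close>
  have vanish: "\<exists>z\<in>K. f z = \<psi> f" if f: "rational_limit K f" for f
  proof (rule ccontr)
    assume "\<not> (\<exists>z\<in>K. f z = \<psi> f)"
    then have nz: "\<And>z. z \<in> K \<Longrightarrow> f z + - \<psi> f \<noteq> 0" by (auto simp: add_eq_0_iff)
    have r: "rational_limit K (\<lambda>z. f z + - \<psi> f)" by (intro rational_limit_add f rational_limit_const)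
    have "\<psi> (\<lambda>z. (f z + - \<psi> f) * inverse (f z + - \<psi> f)) = 0"
      using mult[OF r rational_limit_inverse[OF r K nz]] add[OF f rational_limit_const, of "- \<psi> f"] const
      by simp
    moreover have "\<psi> (\<lambda>z. (f z + - \<psi> f) * inverse (f z + - \<psi> f)) = \<psi> (\<lambda>_. 1)"
      using nz by (intro cong) (metis right_inverse)
    ultimately show False using one by simp
  qed
  define a where "a = \<psi> (\<lambda>z. z)"
  have aK: "a \<in> K" using vanish[OF rational_limit_ident] by (auto simp: a_def)
  have poly: "\<psi> (poly p) = poly p a" for p
  proof (induction p)
    case (pCons c p)
    have m: "\<psi> (\<lambda>z. z * poly p z) = a * poly p a"
      using mult[OF rational_limit_ident rational_limit_poly, of p] pCons.IH by (simp only: a_def)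
    have "\<psi> (\<lambda>z. c + z * poly p z) = c + a * poly p a"
      using add[OF rational_limit_const[of K c] rational_limit_mult[OF rational_limit_ident rational_limit_poly[of K p] K]]
      by (simp only: m const)
    moreover have "\<psi> (poly (pCons c p)) = \<psi> (\<lambda>z. c + z * poly p z)" by (rule cong) simp
    ultimately show ?case by simp
  qed (use const[of 0] in \<open>simp add: \<psi>_def\<close>)
  have eval: "\<psi> f = f a" if f: "rational_limit K f" for f
  proof -
    have "norm (\<psi> f - f a) \<le> e" if "e > 0" for e
    proof -
      have "e/2 > 0" using that by simp
      then obtain q p where q: "\<forall>z\<in>K. poly q z \<noteq> 0" and p: "\<forall>z\<in>K. norm (f z - poly p z / poly q z) < e/2"
        by (rule rational_limitE[OF f])
      have r: "rational_limit K (\<lambda>z. poly p z / poly q z)"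
        using q by (intro rational_limit_rational[of K q]) auto
      have "\<psi> (poly p) = \<psi> (\<lambda>z. (poly p z / poly q z) * poly q z)" using q by (intro cong) auto
      also have "\<dots> = \<psi> (\<lambda>z. poly p z / poly q z) * \<psi> (poly q)" by (intro mult r rational_limit_poly)
      finally have ev: "\<psi> (\<lambda>z. poly p z / poly q z) = poly p a / poly q a" using q aK by (simp add: poly)
      have d: "rational_limit K (\<lambda>z. - (poly p z / poly q z))" by (rule rational_limit_uminus[OF r])
      have "\<psi> (\<lambda>z. - 1 * (poly p z / poly q z)) = - 1 * \<psi> (\<lambda>z. poly p z / poly q z)" by (rule scale[OF r])
      then have m: "\<psi> (\<lambda>z. - (poly p z / poly q z)) = - (poly p a / poly q a)" by (simp add: ev)
      \<comment> \<open>Continuity of \<open>\<psi>\<close> comes for free: applied to a small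
        difference it gives one of the values of that difference.\<close>
      obtain z where z: "z \<in> K" "f z + - (poly p z / poly q z) = \<psi> (\<lambda>z. f z + - (poly p z / poly q z))"
        using vanish[OF rational_limit_add[OF f d]] by blast
      then have "\<psi> f - poly p a / poly q a = f z - poly p z / poly q z"
        using add[OF f d] m by simp
      then have "norm (\<psi> f - poly p a / poly q a) < e/2" using p z(1) by metis
      moreover have "norm (poly p a / poly q a - f a) < e/2" using p aK by (metis norm_minus_commute)
      ultimately show ?thesis
        using norm_diff_triangle_less[of "\<psi> f" "poly p a / poly q a" "e/2" "f a" "e/2"] by simp
    qed
    then have "norm (\<psi> f - f a) \<le> 0" by (rule field_le_epsilon) simp
    then show ?thesis by simp
  qed
  have "\<phi> f = (\<lambda>f\<in>?A. f a) f" for f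
  proof (cases "f \<in> ?A")
    case True
    then show ?thesis using eval[OF R_alg_rational_limit[OF True]] by (simp add: \<psi>_def R_alg_iff extensional_restrict)
  next
    case False
    then show ?thesis using \<phi> by (auto simp: character_def extensional_def)
  qed
  with aK show ?thesis by blast
qed

text \<open>Point evaluation is a continuous bijection from a compact space onto a Hausdorff
  space.\<close>

lemma natural_algebra_R_alg:
  assumes K: "compact K"
  shows "natural_algebra (top_of_set K) (R_alg K)"
proof -
  let ?A = "R_alg K" and ?e = "\<lambda>x. \<lambda>f\<in>R_alg K. f x"
  let ?P = "product_topology (\<lambda>_. euclidean) ?A :: ((complex \<Rightarrow> complex) \<Rightarrow> complex) topology"
  have top: "topspace (maximal_ideal_space (top_of_set K) ?A) = {\<phi>. character (top_of_set K) ?A \<phi>}"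
    by (auto simp: maximal_ideal_space_def character_def PiE_def)
  have "homeomorphic_map (top_of_set K) (maximal_ideal_space (top_of_set K) ?A) ?e"
  proof (rule continuous_imp_homeomorphic_map)
    show "compact_space (top_of_set K)" using K by (simp add: compact_space_subtopology)
    show "Hausdorff_space (maximal_ideal_space (top_of_set K) ?A)"
      unfolding maximal_ideal_space_def
      by (intro Hausdorff_space_subtopology) (simp add: Hausdorff_space_product_topology)
    show "continuous_map (top_of_set K) (maximal_ideal_space (top_of_set K) ?A) ?e"
      unfolding maximal_ideal_space_def
    proof (rule continuous_map_into_subtopology)
      show "continuous_map (top_of_set K) ?P ?e"
        unfolding continuous_map_componentwise
        by (auto simp: R_alg_rational_limit rational_limit_continuous_on)
      show "?e \<in> topspace (top_of_set K) \<rightarrow> {\<phi>. character (top_of_set K) ?A \<phi>}"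
        using character_eval[OF _ K] by auto
    qed
    show "?e ` topspace (top_of_set K) = topspace (maximal_ideal_space (top_of_set K) ?A)"
      unfolding top using character_eval[OF _ K] character_R_alg_is_eval[OF K] by auto
    show "inj_on ?e (topspace (top_of_set K))"
    proof (rule inj_onI)
      fix x y assume xy: "x \<in> topspace (top_of_set K)" "y \<in> topspace (top_of_set K)" "?e x = ?e y"
      have "restrict (\<lambda>z. z) K \<in> ?A" by (simp add: restrict_in_R_alg_iff rational_limit_ident)
      then show "x = y" using fun_cong[OF xy(3), of "restrict (\<lambda>z. z) K"] xy(1,2) by simp
    qed
  qed
  then show ?thesis by (simp add: natural_algebra_def uniform_algebra_R_alg[OF K])
qed

text \<open>Local cutoffs suffice: finitely many cover \<open>K1\<close>, and
  \<open>1 - \<Prod> (1 - h)\<close> is 1 where some \<open>h\<close> is 1 and 0 where all of them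
  vanish.\<close>

lemma normal_algebra_R_alg:
  assumes K: "compact K"
    and cutoff: "\<And>x e. x \<in> K \<Longrightarrow> e > 0 \<Longrightarrow> \<exists>h d. rational_limit K h \<and> d > 0 \<and>
      (\<forall>z\<in>K. dist z x < d \<longrightarrow> h z = 1) \<and> (\<forall>z\<in>K. dist z x \<ge> e \<longrightarrow> h z = 0)"
  shows "normal_algebra (top_of_set K) (R_alg K)"
  unfolding normal_algebra_def
proof (intro conjI allI impI natural_algebra_R_alg K)
  fix K0 K1 assume *: "closedin (top_of_set K) K0 \<and> closedin (top_of_set K) K1 \<and> K0 \<inter> K1 = {}"
  then have comp: "compact K0" "compact K1" "K0 \<subseteq> K" "K1 \<subseteq> K"
    using K closedin_compact closedin_imp_subset by blast+
  define Q where "Q x h d \<longleftrightarrow> rational_limit K h \<and> d > 0 \<and>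
      (\<forall>z\<in>K. dist z x < d \<longrightarrow> h z = 1) \<and> (\<forall>z\<in>K0. h z = 0)" for x h and d :: real
  have "\<exists>h d. Q x h d" if "x \<in> K1" for x
  proof -
    have "x \<notin> K0" "x \<in> K" using * that comp by auto
    then obtain e where e: "e > 0" "\<And>z. z \<in> K0 \<Longrightarrow> e \<le> dist z x"
      using separate_point_closed[OF compact_imp_closed[OF comp(1)], of x] by (auto simp: dist_commute)
    with cutoff[OF \<open>x \<in> K\<close> e(1)] comp(3) show ?thesis unfolding Q_def by (meson subsetD)
  qed
  then obtain h d where "\<And>x. x \<in> K1 \<Longrightarrow> Q x (h x) (d x)" by metis
  then have hd: "\<And>x. x \<in> K1 \<Longrightarrow> rational_limit K (h x)" "\<And>x. x \<in> K1 \<Longrightarrow> d x > 0"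
    "\<And>x z. x \<in> K1 \<Longrightarrow> z \<in> K \<Longrightarrow> dist z x < d x \<Longrightarrow> h x z = 1"
    "\<And>x z. x \<in> K1 \<Longrightarrow> z \<in> K0 \<Longrightarrow> h x z = 0" by (auto simp: Q_def)
  have "K1 \<subseteq> (\<Union>x\<in>K1. ball x (d x))" using hd(2) by force
  then obtain F where F: "F \<subseteq> K1" "finite F" "K1 \<subseteq> (\<Union>x\<in>F. ball x (d x))"
    using compactE_image[OF comp(2), of K1 "\<lambda>x. ball x (d x)"] by (metis open_ball)
  define f where "f z = 1 - (\<Prod>x\<in>F. 1 - h x z)" for z
  have "rational_limit K f" unfolding f_def
    using F hd(1) by (intro rational_limit_diff rational_limit_prod rational_limit_const K) auto
  moreover have "f z = 1" if z: "z \<in> K1" for z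
  proof -
    obtain x where x: "x \<in> F" "dist z x < d x" using F(3) z by (auto simp: dist_commute)
    then have "h x z = 1" using hd(3) F(1) comp(4) z by blast
    with x F(2) show ?thesis by (auto simp: f_def)
  qed
  moreover have "f z = 0" if "z \<in> K0" for z
    using hd(4) F(1) that by (auto simp: f_def subset_iff)
  ultimately show "\<exists>f\<in>R_alg K. (\<forall>x\<in>K1. f x = 1) \<and> (\<forall>x\<in>K0. f x = 0)"
    using comp(3,4) by (intro bexI[of _ "restrict f K"]) (auto simp: restrict_in_R_alg_iff)
qed

text \<open>Every rational function vanishing at \<open>x\<close> is a multiple of \<open>z - x\<close>, so it is enough to
  approximate \<open>z - x\<close>.\<close>

lemma strongly_regular_atI:
  assumes K: "compact K" and x: "x \<in> K"
    and approx: "\<And>e. e > 0 \<Longrightarrow> \<exists>g d. rational_limit K g \<and> d > 0 \<and>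
      (\<forall>z\<in>K. dist z x < d \<longrightarrow> g z = 0) \<and> (\<forall>z\<in>K. norm (g z - (z - x)) \<le> e)"
  shows "strongly_regular_at (top_of_set K) (R_alg K) x"
  unfolding strongly_regular_at_def
proof
  let ?A = "R_alg K" and ?J = "J_ideal (top_of_set K) (R_alg K) x"
  show "uniform_closure (top_of_set K) ?J \<subseteq> M_ideal ?A x"
  proof
    fix f assume f: "f \<in> uniform_closure (top_of_set K) ?J"
    have "uniform_closure (top_of_set K) ?J \<subseteq> uniform_closure (top_of_set K) ?A"
      unfolding uniform_closure_def J_ideal_def by blast
    then have "f \<in> ?A" using f by (auto simp: uniform_closure_R_alg)
    moreover have "norm (f x) \<le> 0"
    proof (rule field_le_epsilon)
      fix e :: real assume "e > 0"
      then obtain g where "g \<in> ?J" "norm (f x - g x) < e" using f x unfolding uniform_closure_def by auto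
      moreover from this(1) have "g x = 0" by (auto simp: J_ideal_def)
      ultimately show "norm (f x) \<le> 0 + e" by simp
    qed
    ultimately show "f \<in> M_ideal ?A x" by (simp add: M_ideal_def)
  qed
  show "M_ideal ?A x \<subseteq> uniform_closure (top_of_set K) ?J"
  proof
    fix f assume "f \<in> M_ideal ?A x"
    then have f: "f \<in> ?A" "f x = 0" by (auto simp: M_ideal_def)
    have "\<exists>j\<in>?J. \<forall>z\<in>K. norm (f z - j z) < e" if e: "e > 0" for e
    proof -
      have "e/4 > 0" using e by simp
      then obtain q p where q: "\<forall>z\<in>K. poly q z \<noteq> 0" and p: "\<forall>z\<in>K. norm (f z - poly p z / poly q z) < e/4"
        by (rule rational_limitE[OF R_alg_rational_limit[OF f(1)]])
      \<comment> \<open>The value of the approximant at \<open>x\<close> is small since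
        \<open>f x = 0\<close>. Subtracting it makes the numerator divisible by
        \<open>z - x\<close>.\<close>
      define c where "c = poly p x / poly q x"
      have c: "norm c < e/4" using p[rule_format, OF x] f(2) by (simp add: c_def)
      have "poly (p - smult c q) x = 0" using q x by (simp add: c_def)
      then have "[:-x, 1:] dvd p - smult c q" by (simp only: poly_eq_0_iff_dvd)
      then obtain p' where p': "p - smult c q = [:-x, 1:] * p'" by (rule dvdE)
      define r where "r z = poly p' z / poly q z" for z
      have r: "rational_limit K r" using q by (intro rational_limit_rational[of K q]) (auto simp: r_def)
      obtain B where B: "B > 0" "\<And>z. z \<in> K \<Longrightarrow> norm (r z) \<le> B" using rational_limit_bounded[OF r K] by blast
      have pr: "poly p z / poly q z = c + (z - x) * r z" if "z \<in> K" for z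
      proof -
        have "poly p z = c * poly q z + (z - x) * poly p' z"
          using arg_cong[OF p', of "\<lambda>p. poly p z"] by (simp add: algebra_simps)
        then show ?thesis using q that by (simp add: r_def field_simps)
      qed
      \<comment> \<open>Replacing \<open>z - x\<close> by \<open>g\<close> changes the product with
        \<open>r\<close> by at most \<open>e / 4\<close>, because \<open>B\<close> bounds
        \<open>r\<close>.\<close>
      obtain g d where g: "rational_limit K g" "d > 0" "\<forall>z\<in>K. dist z x < d \<longrightarrow> g z = 0"
        "\<forall>z\<in>K. norm (g z - (z - x)) \<le> e / (4 * B)"
        using approx[of "e / (4 * B)"] e B(1) by auto
      define j where "j = (\<lambda>z\<in>K. g z * r z)"
      have "j \<in> ?A" unfolding j_def by (simp add: restrict_in_R_alg_iff rational_limit_mult g(1) r K)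
      moreover have "openin (top_of_set K) (K \<inter> ball x d)" "x \<in> K \<inter> ball x d" "\<forall>y\<in>K \<inter> ball x d. j y = 0"
        using g(2,3) x by (auto simp: j_def dist_commute)
      ultimately have "j \<in> ?J" unfolding J_ideal_def by blast
      moreover have "norm (f z - j z) < e" if z: "z \<in> K" for z
      proof -
        have "f z - j z = (f z - poly p z / poly q z) + c + ((z - x) - g z) * r z"
          using pr[OF z] z by (simp add: j_def algebra_simps)
        also have "norm \<dots> \<le> norm (f z - poly p z / poly q z) + norm c + norm (((z - x) - g z) * r z)"
          by (meson norm_triangle_ineq norm_triangle_mono order_refl)
        also have "norm (((z - x) - g z) * r z) \<le> e / (4 * B) * B"
          unfolding norm_mult using g(4) B z e by (intro mult_mono) (auto simp: norm_minus_commute)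
        also have "\<dots> = e/4" using B(1) by simp
        finally show ?thesis using p[rule_format, OF z] c e by simp
      qed
      ultimately show ?thesis by blast
    qed
    then show "f \<in> uniform_closure (top_of_set K) ?J"
      using f(1) R_alg_subset_cont_funs by (auto simp: uniform_closure_def)
  qed
qed

section \<open>Contour integrals over square grids\<close>

definition square :: "complex \<Rightarrow> real \<Rightarrow> complex set" where
  "square a l = cbox a (a + Complex l l)"

text \<open>The boundary integral with opposite edges both traversed in the positive coordinate
  direction and the signs put in front. Adjacent squares then share literally the same
  \<open>linepath\<close>, and their contributions telescope.\<close>

definition square_integral :: "complex \<Rightarrow> real \<Rightarrow> (complex \<Rightarrow> complex) \<Rightarrow> complex" where
  "square_integral a l f =
     contour_integral (linepath a (a + Complex l 0)) f
     + contour_integral (linepath (a + Complex l 0) (a + Complex l l)) f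
     - contour_integral (linepath (a + Complex 0 l) (a + Complex l l)) f
     - contour_integral (linepath a (a + Complex 0 l)) f"

definition square_edges :: "complex \<Rightarrow> real \<Rightarrow> complex set" where
  "square_edges a l = closed_segment a (a + Complex l 0)
     \<union> closed_segment (a + Complex l 0) (a + Complex l l)
     \<union> closed_segment (a + Complex 0 l) (a + Complex l l)
     \<union> closed_segment a (a + Complex 0 l)"

lemma mem_square: "z \<in> square a l \<longleftrightarrow> Re a \<le> Re z \<and> Re z \<le> Re a + l \<and> Im a \<le> Im z \<and> Im z \<le> Im a + l"
  by (auto simp: square_def in_cbox_complex_iff)

lemma convex_square: "convex (square a l)"
  by (simp add: square_def)

lemma square_edges_subset: "l \<ge> 0 \<Longrightarrow> square_edges a l \<subseteq> square a l"
  unfolding square_edges_def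
  by (intro Un_least closed_segment_subset convex_square) (auto simp: mem_square)

lemma square_integral_eq_rectpath:
  assumes "continuous_on (square_edges a l) f"
  shows "contour_integral (rectpath a (a + Complex l l)) f = square_integral a l f"
proof -
  have i: "f contour_integrable_on linepath a (a + Complex l 0)"
    "f contour_integrable_on linepath (a + Complex l 0) (a + Complex l l)"
    "f contour_integrable_on linepath (a + Complex 0 l) (a + Complex l l)"
    "f contour_integrable_on linepath a (a + Complex 0 l)"
    using assms by (auto simp: square_edges_def intro!: contour_integrable_continuous_linepath
        elim!: continuous_on_subset)
  have i': "f contour_integrable_on linepath (a + Complex l l) (a + Complex 0 l)"
    "f contour_integrable_on linepath (a + Complex 0 l) a"
    using i(3,4) contour_integrable_reversepath[OF valid_path_linepath i(3)]
      contour_integrable_reversepath[OF valid_path_linepath i(4)] by (simp_all add: reversepath_linepath)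
  have c: "Complex (Re (a + Complex l l)) (Im a) = a + Complex l 0"
    "Complex (Re a) (Im (a + Complex l l)) = a + Complex 0 l"
    by (simp_all add: complex_eq_iff)
  have r: "contour_integral (linepath (a + Complex l l) (a + Complex 0 l)) f
      = - contour_integral (linepath (a + Complex 0 l) (a + Complex l l)) f"
    "contour_integral (linepath (a + Complex 0 l) a) f = - contour_integral (linepath a (a + Complex 0 l)) f"
    using contour_integral_reversepath[of "linepath (a + Complex 0 l) (a + Complex l l)" f]
      contour_integral_reversepath[of "linepath a (a + Complex 0 l)" f] by simp_all
  show ?thesis
    unfolding rectpath_def Let_def c square_integral_def
    by (simp add: i i' r contour_integrable_join)
qed

lemma square_integral_holomorphic:
  assumes "f holomorphic_on square a l" "l \<ge> 0"
  shows "square_integral a l f = 0"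
proof -
  have "(f has_contour_integral 0) (rectpath a (a + Complex l l))"
    using assms by (intro Cauchy_theorem_convex_simple[where S="square a l"] convex_square)
      (use path_image_rectpath_subset_cbox[of a "a + Complex l l"] in \<open>auto simp: square_def\<close>)
  moreover have "continuous_on (square_edges a l) f"
    using assms square_edges_subset by (meson continuous_on_subset holomorphic_on_imp_continuous_on)
  ultimately show ?thesis using square_integral_eq_rectpath contour_integral_unique by metis
qed

lemma square_integral_bound:
  assumes "continuous_on (square_edges a l) f" "l \<ge> 0" "\<And>z. z \<in> square_edges a l \<Longrightarrow> norm (f z) \<le> B"
  shows "norm (square_integral a l f) \<le> 4 * l * B"
proof -
  have "a \<in> square_edges a l" by (simp add: square_edges_def)
  then have B: "B \<ge> 0" using assms(3) norm_ge_zero order_trans by blast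
  have b: "norm (contour_integral (linepath u v) f) \<le> B * norm (v - u)"
    if "closed_segment u v \<subseteq> square_edges a l" for u v
    using that assms B by (intro contour_integral_bound_linepath contour_integrable_continuous_linepath)
      (auto elim: continuous_on_subset)
  have n: "norm (Complex l 0) = l" "norm (Complex 0 l) = l" using assms(2) by (simp_all add: cmod_def)
  have d: "Complex l l - Complex 0 l = Complex l 0" "Complex l l - Complex l 0 = Complex 0 l" by (simp_all add: complex_eq_iff)
  have "norm (contour_integral (linepath a (a + Complex l 0)) f) \<le> B * l"
    "norm (contour_integral (linepath (a + Complex l 0) (a + Complex l l)) f) \<le> B * l"
    "norm (contour_integral (linepath (a + Complex 0 l) (a + Complex l l)) f) \<le> B * l"
    "norm (contour_integral (linepath a (a + Complex 0 l)) f) \<le> B * l"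
    using b[of a "a + Complex l 0"] b[of "a + Complex l 0" "a + Complex l l"]
      b[of "a + Complex 0 l" "a + Complex l l"] b[of a "a + Complex 0 l"]
    by (auto simp: square_edges_def n d)
  moreover have tri: "norm (x + y - z - w) \<le> norm x + norm y + norm z + norm w" for x y z w :: complex
    using norm_triangle_ineq4[of "x + y - z" w] norm_triangle_ineq4[of "x + y" z] norm_triangle_ineq[of x y]
    by linarith
  ultimately show ?thesis unfolding square_integral_def
    by (intro order_trans[OF tri]) (simp add: algebra_simps)
qed

lemma square_integral_cong:
  assumes "\<And>z. z \<in> square_edges a l \<Longrightarrow> f z = g z"
  shows "square_integral a l f = square_integral a l g"
proof -
  have "contour_integral (linepath u v) f = contour_integral (linepath u v) g"
    if "closed_segment u v \<subseteq> square_edges a l" for u v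
    using that assms by (intro contour_integral_eq) auto
  then show ?thesis unfolding square_integral_def by (simp add: square_edges_def Un_assoc subset_iff)
qed

lemma square_integral_add:
  assumes "continuous_on (square_edges a l) f" "continuous_on (square_edges a l) g"
  shows "square_integral a l (\<lambda>z. f z + g z) = square_integral a l f + square_integral a l g"
proof -
  have "contour_integral (linepath u v) (\<lambda>z. f z + g z)
      = contour_integral (linepath u v) f + contour_integral (linepath u v) g"
    if "closed_segment u v \<subseteq> square_edges a l" for u v
    using that assms by (intro contour_integral_add contour_integrable_continuous_linepath)
      (auto elim: continuous_on_subset)
  then show ?thesis unfolding square_integral_def by (simp add: square_edges_def Un_assoc subset_iff)
qed

lemma square_integral_cmult:
  assumes "continuous_on (square_edges a l) f"
  shows "square_integral a l (\<lambda>z. c * f z) = c * square_integral a l f"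
proof -
  have "contour_integral (linepath u v) (\<lambda>z. c * f z) = c * contour_integral (linepath u v) f"
    if "closed_segment u v \<subseteq> square_edges a l" for u v
    using that assms by (intro contour_integral_lmul contour_integrable_continuous_linepath)
      (auto elim: continuous_on_subset)
  then show ?thesis unfolding square_integral_def
    by (simp add: square_edges_def Un_assoc subset_iff algebra_simps)
qed

lemma square_integral_diff:
  assumes "continuous_on (square_edges a l) f" "continuous_on (square_edges a l) g"
  shows "square_integral a l (\<lambda>z. f z - g z) = square_integral a l f - square_integral a l g"
  using square_integral_add[OF assms(1), of "\<lambda>z. -1 * g z"] square_integral_cmult[OF assms(2), of "-1"] assms
  by (simp add: continuous_on_minus)

text \<open>The set where an integrand has to be continuous for the telescoping; inside the cells it
  may be singular.\<close>

definition grid_lines :: "complex \<Rightarrow> real \<Rightarrow> nat \<Rightarrow> complex set" where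
  "grid_lines a l n = {z \<in> square a (n * l).
     (\<exists>i\<le>n. Re z = Re a + real i * l) \<or> (\<exists>i\<le>n. Im z = Im a + real i * l)}"

definition grid_point :: "complex \<Rightarrow> real \<Rightarrow> nat \<Rightarrow> nat \<Rightarrow> complex" where
  "grid_point a l i j = a + Complex (i * l) (j * l)"

lemma contour_integral_horizontal_sum:
  fixes l :: real
  assumes "l > 0" "continuous_on (closed_segment b (b + Complex (n * l) 0)) f"
  shows "(\<Sum>i<n. contour_integral (linepath (b + Complex (i * l) 0) (b + Complex (Suc i * l) 0)) f)
    = contour_integral (linepath b (b + Complex (n * l) 0)) f"
  using assms(2)
proof (induction n)
  case (Suc n)
  have mem: "b + Complex (n * l) 0 \<in> closed_segment b (b + Complex (Suc n * l) 0)"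
    using assms(1) by (subst closed_segment_same_Im) (auto simp: closed_segment_eq_real_ivl algebra_simps)
  then have "closed_segment b (b + Complex (n * l) 0) \<subseteq> closed_segment b (b + Complex (Suc n * l) 0)"
    by (simp add: subset_closed_segment)
  from Suc.IH[OF continuous_on_subset[OF Suc.prems this]] have "(\<Sum>i<n. contour_integral (linepath (b + Complex (i * l) 0) (b + Complex (Suc i * l) 0)) f)
    = contour_integral (linepath b (b + Complex (n * l) 0)) f" .
  then show ?case
    using contour_integral_split_linepath[OF Suc.prems mem] by simp
qed (simp add: zero_complex.code[symmetric])

lemma contour_integral_vertical_sum:
  fixes l :: real
  assumes "l > 0" "continuous_on (closed_segment b (b + Complex 0 (n * l))) f"
  shows "(\<Sum>i<n. contour_integral (linepath (b + Complex 0 (i * l)) (b + Complex 0 (Suc i * l))) f)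
    = contour_integral (linepath b (b + Complex 0 (n * l))) f"
  using assms(2)
proof (induction n)
  case (Suc n)
  have mem: "b + Complex 0 (n * l) \<in> closed_segment b (b + Complex 0 (Suc n * l))"
    using assms(1) by (subst closed_segment_same_Re) (auto simp: closed_segment_eq_real_ivl algebra_simps)
  then have "closed_segment b (b + Complex 0 (n * l)) \<subseteq> closed_segment b (b + Complex 0 (Suc n * l))"
    by (simp add: subset_closed_segment)
  from Suc.IH[OF continuous_on_subset[OF Suc.prems this]] have "(\<Sum>i<n. contour_integral (linepath (b + Complex 0 (i * l)) (b + Complex 0 (Suc i * l))) f)
    = contour_integral (linepath b (b + Complex 0 (n * l))) f" .
  then show ?case
    using contour_integral_split_linepath[OF Suc.prems mem] by simp
qed (simp add: zero_complex.code[symmetric])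

lemma square_edges_grid_point:
  assumes "l > 0" "i < n" "j < n"
  shows "square_edges (grid_point a l i j) l \<subseteq> grid_lines a l n"
proof
  fix z assume z: "z \<in> square_edges (grid_point a l i j) l"
  then have s: "z \<in> square (grid_point a l i j) l" using square_edges_subset[of l] assms(1) by fastforce
  have m: "real i * l \<ge> 0" "real j * l \<ge> 0" "real i * l + l \<le> real n * l" "real j * l + l \<le> real n * l"
    using assms mult_right_mono[of "real (Suc i)" "real n" l] mult_right_mono[of "real (Suc j)" "real n" l]
    by (auto simp: algebra_simps)
  have "Re a + real i * l \<le> Re z" "Re z \<le> Re a + real i * l + l"
    "Im a + real j * l \<le> Im z" "Im z \<le> Im a + real j * l + l"
    using s by (simp_all add: mem_square grid_point_def)
  then have sq: "z \<in> square a (n * l)" using m unfolding mem_square by linarith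
  have "Im z = Im a + real j * l \<or> Re z = Re a + real (Suc i) * l \<or> Im z = Im a + real (Suc j) * l \<or> Re z = Re a + real i * l"
    using z by (auto simp: square_edges_def grid_point_def closed_segment_same_Im closed_segment_same_Re algebra_simps)
  moreover have "i \<le> n" "Suc i \<le> n" "j \<le> n" "Suc j \<le> n" using assms by auto
  ultimately show "z \<in> grid_lines a l n" using sq unfolding grid_lines_def by blast
qed

text \<open>Every inner edge occurs twice with opposite signs. Horizontal edges telescope in
  \<open>j\<close>, vertical ones in \<open>i\<close>.\<close>

lemma square_integral_grid_sum:
  assumes l: "l > 0" and f: "continuous_on (grid_lines a l n) f"
  shows "(\<Sum>i<n. \<Sum>j<n. square_integral (grid_point a l i j) l f) = square_integral a (n * l) f"
proof -
  define H where "H i j = contour_integral (linepath (grid_point a l i j) (grid_point a l (Suc i) j)) f" for i j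
  define V where "V i j = contour_integral (linepath (grid_point a l i j) (grid_point a l i (Suc j))) f" for i j
  have "square_integral (grid_point a l i j) l f = (H i j - H i (Suc j)) + (V (Suc i) j - V i j)" for i j
    by (simp add: square_integral_def H_def V_def grid_point_def add.assoc plus_complex.code algebra_simps)
  then have "(\<Sum>i<n. \<Sum>j<n. square_integral (grid_point a l i j) l f)
      = (\<Sum>i<n. \<Sum>j<n. H i j - H i (Suc j)) + (\<Sum>i<n. \<Sum>j<n. V (Suc i) j - V i j)"
    by (simp add: sum.distrib)
  also have "(\<Sum>i<n. \<Sum>j<n. V (Suc i) j - V i j) = (\<Sum>j<n. \<Sum>i<n. V (Suc i) j - V i j)" by (rule sum.swap)
  finally have *: "(\<Sum>i<n. \<Sum>j<n. square_integral (grid_point a l i j) l f)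
      = (\<Sum>i<n. H i 0) - (\<Sum>i<n. H i n) + (\<Sum>j<n. V n j) - (\<Sum>j<n. V 0 j)"
    by (simp only: sum_lessThan_telescope[of "\<lambda>i. V i j" for j] sum_lessThan_telescope') (simp add: sum_subtractf)
  have nl: "0 \<le> real n * l" using l by simp
  have sub: "closed_segment (grid_point a l 0 j) (grid_point a l n j) \<subseteq> grid_lines a l n"
    "closed_segment (grid_point a l j 0) (grid_point a l j n) \<subseteq> grid_lines a l n" if "j \<le> n" for j
    using that nl l mult_right_mono[of "real j" "real n" l]
    by (auto simp: grid_lines_def grid_point_def mem_square closed_segment_same_Im closed_segment_same_Re
        closed_segment_eq_real_ivl)
  have Hs: "(\<Sum>i<n. H i j) = contour_integral (linepath (grid_point a l 0 j) (grid_point a l n j)) f" if "j \<le> n" for j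
    using contour_integral_horizontal_sum[OF l, of "grid_point a l 0 j" n f] continuous_on_subset[OF f sub(1)[OF that]]
    by (simp add: H_def grid_point_def add.assoc plus_complex.code)
  have Vs: "(\<Sum>j<n. V i j) = contour_integral (linepath (grid_point a l i 0) (grid_point a l i n)) f" if "i \<le> n" for i
    using contour_integral_vertical_sum[OF l, of "grid_point a l i 0" n f] continuous_on_subset[OF f sub(2)[OF that]]
    by (simp add: V_def grid_point_def add.assoc plus_complex.code)
  have z: "a + Complex 0 0 = a" by (simp add: complex_eq_iff)
  show ?thesis unfolding * Hs[OF le0] Hs[OF order_refl] Vs[OF order_refl] Vs[OF le0]
    by (simp add: square_integral_def grid_point_def z)
qed

section \<open>Estimating a residue by the values on \<open>K\<close>\<close>

lemma card_nat_interval_le: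
  assumes "x \<le> y"
  shows "real (card {i. x \<le> real i \<and> real i \<le> y}) \<le> y - x + 1"
proof (cases "{i. x \<le> real i \<and> real i \<le> y} = {}")
  case False
  let ?S = "{i. x \<le> real i \<and> real i \<le> y}"
  have fin: "finite ?S"
    by (rule finite_subset[of _ "{..nat \<lfloor>y\<rfloor>}"]) (auto simp: le_nat_floor)
  define u v where "u = Min ?S" and "v = Max ?S"
  have uv: "u \<in> ?S" "v \<in> ?S" using Min_in[OF fin False] Max_in[OF fin False] by (auto simp: u_def v_def)
  have "?S \<subseteq> {u..v}" using fin by (auto simp: u_def v_def)
  then have "card ?S \<le> Suc v - u" using card_mono[of "{u..v}" ?S] by simp
  moreover have "u \<le> v" using uv fin by (simp add: u_def)
  ultimately have "real (card ?S) \<le> real v - real u + 1" by linarith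
  then show ?thesis using uv by simp
next
  case True
  show ?thesis unfolding True using assms by simp
qed

text \<open>Each coordinate of a corner within \<open>R\<close> of \<open>c\<close> lies in an
  interval of length \<open>2 * R\<close>, which holds at most \<open>2 * R / l + 1\<close> grid
  values.\<close>

lemma grid_count:
  assumes l: "l > 0" and R: "R > 0"
  shows "l\<^sup>2 * real (card {p \<in> {..<n} \<times> {..<n}. dist c (grid_point a l (fst p) (snd p)) < R}) \<le> (2 * R + l)\<^sup>2"
proof -
  define S where "S x = {i. x - R / l \<le> real i \<and> real i \<le> x + R / l}" for x
  define x y where "x = (Re c - Re a) / l" and "y = (Im c - Im a) / l"
  have cS: "l * real (card (S x)) \<le> 2 * R + l" for x
  proof -
    have "real (card (S x)) \<le> (x + R / l) - (x - R / l) + 1"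
      unfolding S_def using l R by (intro card_nat_interval_le) simp
    then show ?thesis using l mult_left_mono[of "real (card (S x))" "2 * R / l + 1" l]
      by (simp add: algebra_simps)
  qed
  have fin: "finite (S x)" for x
    unfolding S_def by (rule finite_subset[of _ "{..nat \<lfloor>x + R / l\<rfloor>}"]) (auto simp: le_nat_floor)
  have "{p \<in> {..<n} \<times> {..<n}. dist c (grid_point a l (fst p) (snd p)) < R} \<subseteq> S x \<times> S y"
  proof clarsimp
    fix i j assume d: "dist c (grid_point a l i j) < R"
    have "\<bar>Re (c - grid_point a l i j)\<bar> < R" "\<bar>Im (c - grid_point a l i j)\<bar> < R"
      using d abs_Re_le_cmod[of "c - grid_point a l i j"] abs_Im_le_cmod[of "c - grid_point a l i j"]
      by (auto simp: dist_norm)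
    then show "i \<in> S x \<and> j \<in> S y"
      using l unfolding S_def x_def y_def
      by (auto simp: grid_point_def diff_divide_distrib[symmetric] add_divide_distrib[symmetric]
          pos_divide_le_eq pos_le_divide_eq abs_less_iff algebra_simps)
  qed
  then have "card {p \<in> {..<n} \<times> {..<n}. dist c (grid_point a l (fst p) (snd p)) < R} \<le> card (S x) * card (S y)"
    using card_mono[OF finite_cartesian_product[OF fin fin]] by (simp only: card_cartesian_product)
  then have "l\<^sup>2 * real (card {p \<in> {..<n} \<times> {..<n}. dist c (grid_point a l (fst p) (snd p)) < R})
      \<le> l\<^sup>2 * real (card (S x) * card (S y))" using l by (intro mult_left_mono) (simp_all only: of_nat_le_iff zero_le_power2)
  also have "\<dots> = (l * real (card (S x))) * (l * real (card (S y)))" by (simp add: power2_eq_square)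
  also have "\<dots> \<le> (2 * R + l) * (2 * R + l)" using cS l R by (intro mult_mono) auto
  finally show ?thesis by (simp add: power2_eq_square)
qed

lemma norm_cis_diff_le: "norm (cis a - cis b) \<le> \<bar>a - b\<bar>"
proof -
  have "cis a - cis b = cis b * (exp (\<i> * complex_of_real (a - b)) - 1)"
    by (simp add: cis_conv_exp exp_add[symmetric] algebra_simps)
  then have "norm (cis a - cis b) = 2 * \<bar>sin ((a - b) / 2)\<bar>"
    by (simp only: norm_mult norm_cis dist_exp_i_1)
  also have "\<dots> \<le> \<bar>a - b\<bar>" using abs_sin_x_le_abs_x[of "(a - b) / 2"] by simp
  finally show ?thesis .
qed

text \<open>Equally spaced points of the unit circle: moving radially onto the circle costs at most
  \<open>3 * b\<close>, and then to the nearest point below in angle at most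
  \<open>b\<close>.\<close>

lemma annulus_cover:
  assumes b: "0 < b" "b \<le> 1/2"
  shows "\<exists>P :: complex set. finite P \<and> real (card P) \<le> 8 / b \<and>
    (\<forall>z. 1 \<le> norm z \<and> norm z \<le> 1 + 3 * b \<longrightarrow> (\<exists>c\<in>P. dist c z < 5 * b))"
proof -
  \<comment> \<open>\<open>2 * pi \<le> 7\<close> gives angular gaps of at most \<open>b\<close>;
    rounding up adds at most \<open>1 \<le> 1 / b\<close>, whence \<open>8 / b\<close>.\<close>
  define M where "M = nat \<lceil>7 / b\<rceil>"
  define P where "P = (\<lambda>j. cis (2 * pi * real j / real M)) ` {..<M}"
  have M: "real M \<ge> 7 / b" "real M \<le> 8 / b"
  proof -
    have "7 / b > 0" "1 \<le> 1 / b" using b by simp_all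
    moreover have "8 / b = 7 / b + 1 / b" by (simp add: add_divide_distrib[symmetric])
    ultimately show "real M \<ge> 7 / b" "real M \<le> 8 / b" unfolding M_def by linarith+
  qed
  have M0: "real M > 0" using M(1) b by (smt (verit) divide_pos_pos)
  show ?thesis
  proof (intro exI[of _ P] conjI allI impI)
    show "finite P" by (simp add: P_def)
    show "real (card P) \<le> 8 / b"
      using card_image_le[of "{..<M}" "\<lambda>j. cis (2 * pi * real j / real M)"] M(2) by (simp add: P_def)
    fix z :: complex assume z: "1 \<le> norm z \<and> norm z \<le> 1 + 3 * b"
    define t where "t = Arg2pi z"
    have t: "0 \<le> t" "t < 2 * pi" "z = of_real (norm z) * cis t"
      using Arg2pi[of z] by (auto simp: t_def cis_conv_exp is_Arg_def)
    define j where "j = nat \<lfloor>t * M / (2 * pi)\<rfloor>"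
    have tj: "0 \<le> t * M / (2 * pi)" "t * M / (2 * pi) < M" using t M0 by (auto simp: field_simps)
    have j: "real j \<le> t * M / (2 * pi)" "t * M / (2 * pi) < real j + 1"
      using tj(1) unfolding j_def by linarith+
    have jM: "j < M" using j(1) tj(2) by linarith
    have "\<bar>2 * pi * real j / real M - t\<bar> \<le> 2 * pi / M"
    proof -
      have "2 * pi * real j / M \<le> t" using j(1) M0 by (simp add: field_simps)
      moreover have "t \<le> 2 * pi * real j / M + 2 * pi / M" using j(2) M0 by (simp add: field_simps)
      ultimately show ?thesis by linarith
    qed
    also have "2 * pi / M \<le> b"
    proof -
      have "2 * pi \<le> 7" using pi_less_4 pi_approx by simp
      also have "7 \<le> b * M" using M(1) b by (simp add: field_simps)
      finally show ?thesis using M0 by (simp add: field_simps)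
    qed
    finally have "norm (cis (2 * pi * real j / real M) - cis t) \<le> b"
      using norm_cis_diff_le order_trans by blast
    moreover have "norm (cis t - z) \<le> 3 * b"
    proof -
      have "cis t - z = (1 - of_real (norm z)) * cis t" using t(3) by (metis left_diff_distrib mult_1)
      then have "norm (cis t - z) = \<bar>1 - norm z\<bar>"
        by (metis norm_mult norm_cis mult.right_neutral norm_of_real of_real_1 of_real_diff)
      then show ?thesis using z by simp
    qed
    ultimately have "dist (cis (2 * pi * real j / real M)) z < 5 * b"
      using norm_triangle_ineq[of "cis (2 * pi * real j / real M) - cis t" "cis t - z"] b by (simp add: dist_norm)
    then show "\<exists>c\<in>P. dist c z < 5 * b" using jM by (auto simp: P_def)
  qed
qed

lemma dist_square_corner:
  assumes "z \<in> square q l" "w \<in> square q l"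
  shows "dist z w \<le> 2 * l"
proof -
  have "norm (z - w) \<le> \<bar>Re (z - w)\<bar> + \<bar>Im (z - w)\<bar>" by (rule cmod_le)
  also have "\<dots> \<le> 2 * l" using assms unfolding mem_square minus_complex.sel by linarith
  finally show ?thesis by (simp add: dist_norm)
qed

definition clamp01 :: "real \<Rightarrow> real" where "clamp01 t = max 0 (min 1 t)"

lemma clamp01_bounds: "0 \<le> clamp01 t" "clamp01 t \<le> 1"
  by (auto simp: clamp01_def)

lemma clamp01_lipschitz: "\<bar>clamp01 s - clamp01 t\<bar> \<le> \<bar>s - t\<bar>"
  by (auto simp: clamp01_def)

lemma clamp01_differ: "clamp01 s \<noteq> clamp01 t \<Longrightarrow> (s < 1 \<or> t < 1) \<and> (0 < s \<or> 0 < t)"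
  by (auto simp: clamp01_def)

text \<open>Compactness is used twice: finitely many discs suffice on the closed unit disc, and the
  points of norm at most 2 not yet covered form a compact set of norms above 1, hence of norms at
  least some \<open>m > 1\<close>. So \<open>W\<close> reaches beyond the unit circle, where a
  cutoff has room to decay.\<close>

lemma open_superset_of_cheese:
  assumes W: "open W" and sub: "cball 0 1 - (\<Union>(c,r)\<in>D. ball c r) \<subseteq> (W :: complex set)"
  shows "\<exists>F b. finite F \<and> F \<subseteq> D \<and> 0 < b \<and> b \<le> 1/2 \<and> cball 0 (1 + 2 * b) - (\<Union>(c,r)\<in>F. ball c r) \<subseteq> W"
proof -
  have "compact (cball 0 1 - W)" using W by (intro compact_diff) auto
  moreover have "cball 0 1 - W \<subseteq> (\<Union>d\<in>D. ball (fst d) (snd d))" using sub by force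
  ultimately obtain F where F: "F \<subseteq> D" "finite F" "cball 0 1 - W \<subseteq> (\<Union>d\<in>F. ball (fst d) (snd d))"
    using compactE_image[of "cball 0 1 - W" D "\<lambda>d. ball (fst d) (snd d)"] by (metis open_ball)
  define S where "S = cball 0 2 - W - (\<Union>d\<in>F. ball (fst d) (snd d))"
  have S: "compact S" unfolding S_def using W by (intro compact_diff open_UN) auto
  have S1: "norm z > 1" if "z \<in> S" for z using that F(3) by (force simp: S_def)
  have "\<exists>m>1. \<forall>z\<in>S. m \<le> norm z"
  proof (cases "S = {}")
    case False
    obtain z0 where "z0 \<in> S" "\<forall>z\<in>S. norm z0 \<le> norm z"
      using continuous_attains_inf[OF S False continuous_on_norm[OF continuous_on_id]] by blast
    then show ?thesis using S1 by blast
  qed (auto intro: exI[of _ 2])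
  then obtain m where m: "m > 1" "\<And>z. z \<in> S \<Longrightarrow> m \<le> norm z" by blast
  define b where "b = min (1/2) ((m - 1) / 4)"
  have "b \<le> (m - 1) / 4" unfolding b_def by (rule min.cobounded2)
  then have b: "b > 0" "b \<le> 1/2" "1 + 2 * b < m" using m(1) by (auto simp: b_def)
  have "z \<in> W" if "norm z \<le> 1 + 2 * b" "\<forall>d\<in>F. z \<notin> ball (fst d) (snd d)" for z
  proof (rule ccontr)
    assume "z \<notin> W"
    then have "z \<in> S" using that b(2) by (auto simp: S_def)
    then show False using m(2) that(1) b(3) by fastforce
  qed
  then show ?thesis using F b by (intro exI[of _ F] exI[of _ b]) (auto simp: case_prod_unfold)
qed

text \<open>The cutoff \<open>\<psi>\<close> vanishes on the discs of \<open>F\<close> and off \<open>cball 0 (1 + 2 * b)\<close>. The sum over all squares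
  of the integrals of \<open>H * \<psi>\<close> telescopes to \<open>0\<close>, and on every square but the one around \<open>\<lambda>\<close> Cauchy's theorem
  lets one replace \<open>\<psi>\<close> by its oscillation. No regularity of the union of the (overlapping) discs is needed.\<close>

lemma residue_bound_by_cheese:
  fixes lam :: complex and D :: "(complex \<times> real) set"
  assumes lam: "norm lam = 1"
    and pos: "\<And>d. d \<in> D \<Longrightarrow> snd d > 0"
    and away: "\<And>d. d \<in> D \<Longrightarrow> 3 * snd d < dist (fst d) lam"
    and sums: "\<And>F. finite F \<Longrightarrow> F \<subseteq> D \<Longrightarrow> (\<Sum>d\<in>F. snd d * exp (N / (dist (fst d) lam - 3 * snd d))) \<le> C"
    and N: "N \<ge> 0"
    and W: "open W" "cball 0 1 - (\<Union>(c,r)\<in>D. ball c r) \<subseteq> W" and H: "H holomorphic_on W - {lam}"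
    and b1: "\<And>z. z \<in> W - {lam} \<Longrightarrow> norm (H z) \<le> \<eta> * exp (N / dist z lam)"
    and b2: "\<And>z. z \<in> W - {lam} \<Longrightarrow> norm z \<ge> 1 \<Longrightarrow> norm (H z) \<le> \<eta>"
    and \<eta>: "\<eta> \<ge> 0"
  shows "\<exists>l0>0. \<forall>l. 0 < l \<and> l < l0 \<longrightarrow>
    norm (square_integral (lam - Complex (l/2) (l/2)) l H) \<le> \<eta> * (392 * C + 7744)"
proof -

  \<comment> \<open>The cutoff for finitely many discs\<close>
  obtain F b where F: "finite F" "F \<subseteq> D" and b: "0 < b" "b \<le> 1/2"
    and sub: "cball 0 (1 + 2 * b) - (\<Union>(c,r)\<in>F. ball c r) \<subseteq> W"
    using open_superset_of_cheese[OF W] by blast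
  define B where "B = cball 0 (1 + 2 * b) - (\<Union>(c,r)\<in>F. ball c r)"
  have B: "compact B" "B \<subseteq> W" using sub unfolding B_def by (auto intro!: compact_diff)
  \<comment> \<open>This factor rises from 0 at distance \<open>snd d\<close> to 1 at distance
    \<open>2 * snd d\<close> from the centre, with slope \<open>1 / snd d\<close>;
    \<open>\<psi>0\<close> falls from 1 at norm \<open>1 + b\<close> to 0 at norm
    \<open>1 + 2 * b\<close>.\<close>
  define \<psi>d where "\<psi>d d z = clamp01 ((dist (fst d) z - snd d) / snd d)" for d :: "complex \<times> real" and z
  define \<psi>0 where "\<psi>0 z = clamp01 ((1 + 2 * b - norm z) / b)" for z :: complex
  define \<psi> where "\<psi> z = \<psi>0 z * (\<Prod>d\<in>F. \<psi>d d z)" for z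
  have bd: "0 \<le> \<psi>d d z" "\<psi>d d z \<le> 1" "0 \<le> \<psi>0 z" "\<psi>0 z \<le> 1" for d z
    by (auto simp: \<psi>d_def \<psi>0_def clamp01_bounds)
  have cont: "continuous_on UNIV \<psi>" unfolding \<psi>_def \<psi>0_def \<psi>d_def clamp01_def
    by (intro continuous_intros) (use pos F b in force)+
  have \<psi>_zero: "\<psi> z = 0" if out: "z \<notin> B" for z
  proof (cases "norm z \<le> 1 + 2 * b")
    case False
    then have "\<psi>0 z = 0" using b by (simp add: \<psi>0_def clamp01_def divide_nonpos_pos)
    then show ?thesis by (simp add: \<psi>_def)
  next
    case True
    then obtain c r where "(c, r) \<in> F" "dist c z < r" using out by (auto simp: B_def)
    then obtain d where d: "d \<in> F" "dist (fst d) z < snd d" by force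
    have "snd d > 0" using pos F d(1) by blast
    then have "(dist (fst d) z - snd d) / snd d \<le> 0" using d(2) by (intro divide_nonpos_pos) auto
    then have "\<psi>d d z = 0" by (simp add: \<psi>d_def clamp01_def)
    then show ?thesis using d F by (auto simp: \<psi>_def)
  qed
  obtain e0 where e0: "e0 > 0" "(\<Union>x\<in>B. ball x e0) \<subseteq> W"
    using compact_subset_open_imp_ball_epsilon_subset[OF B(1) W(1) B(2)] by blast
  \<comment> \<open>The smallest length involved. With \<open>l < m / 4\<close> the diameter of a
    cell is below half of it.\<close>
  define m where "m = Min (insert b (insert e0 (snd ` F)))"
  have m: "m > 0" "m \<le> b" "m \<le> e0" "\<And>d. d \<in> F \<Longrightarrow> m \<le> snd d"
  proof -
    have fin: "finite (insert b (insert e0 (snd ` F)))" using F by simp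
    show "m > 0" unfolding m_def using fin F b e0 pos by (subst Min_gr_iff) auto
    show "m \<le> b" "m \<le> e0" "\<And>d. d \<in> F \<Longrightarrow> m \<le> snd d"
      unfolding m_def using fin by (auto intro: Min_le simp del: Min_insert)
  qed
  have "norm (square_integral (lam - Complex (l/2) (l/2)) l H) \<le> \<eta> * (392 * C + 7744)"
    if l: "0 < l" "l < m / 4" for l
  proof -
    obtain k :: nat where k: "real k * l > 3" using reals_Archimedean3[OF l(1)] by blast
    \<comment> \<open>An odd number of cells per side puts \<open>lam\<close> at the centre of the
      cell \<open>(k, k)\<close>, hence off the grid lines. As \<open>k * l > 3\<close>, the outer
      boundary lies where the norm exceeds 2 and the cutoff vanishes.\<close>
    define n where "n = 2 * k + 1"
    define a where "a = lam - Complex ((real k + 1/2) * l) ((real k + 1/2) * l)"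
    define G where "G z = H z * of_real (\<psi> z)" for z
    have nl: "real n * l = 2 * ((real k + 1/2) * l)" by (simp add: n_def algebra_simps)
    \<comment> \<open>\<open>H\<close> is only controlled on \<open>W\<close>, but \<open>G\<close>
      vanishes off the compact set \<open>B\<close>; the two open sets \<open>W - {lam}\<close> and
      \<open>- B\<close> cover everything except \<open>lam\<close>.\<close>
    have contG: "continuous_on (- {lam}) G"
    proof -
      have "continuous_on (W - {lam}) G" unfolding G_def using H
        by (intro continuous_intros holomorphic_on_imp_continuous_on continuous_on_subset[OF cont]) auto
      moreover have "continuous_on (- B) G"
        by (rule continuous_on_eq[of _ "\<lambda>_. 0"]) (auto simp: G_def \<psi>_zero)
      ultimately have "continuous_on ((W - {lam}) \<union> (- B)) G" using W(1) B(1)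
        by (intro continuous_on_open_Un) (auto simp: compact_imp_closed open_Compl)
      then show ?thesis by (rule continuous_on_subset) (use B(2) in auto)
    qed
    have lam_grid: "lam \<notin> grid_lines a l n"
    proof
      assume "lam \<in> grid_lines a l n"
      then obtain i :: nat where "real i * l = (real k + 1/2) * l" by (auto simp: grid_lines_def a_def)
      then have "real i = real k + 1/2" using l(1) by simp
      then have "2 * i = 2 * k + 1" by linarith
      then show False by presburger
    qed
    have edgeG: "continuous_on (square_edges (grid_point a l i j) l) G" if "i < n" "j < n" for i j
      using square_edges_grid_point[OF l(1) that] lam_grid by (intro continuous_on_subset[OF contG]) auto
    have "(\<Sum>i<n. \<Sum>j<n. square_integral (grid_point a l i j) l G) = square_integral a (n * l) G"
      using lam_grid by (intro square_integral_grid_sum l continuous_on_subset[OF contG]) auto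
    also have "\<dots> = square_integral a (n * l) (\<lambda>_. 0)"
    proof (rule square_integral_cong)
      fix z assume z: "z \<in> square_edges a (real n * l)"
      have "Re z = Re a \<or> Re z = Re a + real n * l \<or> Im z = Im a \<or> Im z = Im a + real n * l"
        using z by (auto simp: square_edges_def closed_segment_same_Im closed_segment_same_Re)
      then have "\<bar>Re (z - lam)\<bar> = (real k + 1/2) * l \<or> \<bar>Im (z - lam)\<bar> = (real k + 1/2) * l"
        unfolding nl using l(1) by (auto simp: a_def)
      moreover have "(real k + 1/2) * l > 3" using k l(1) by (simp add: algebra_simps)
      ultimately have "norm (z - lam) > 3"
        using abs_Re_le_cmod[of "z - lam"] abs_Im_le_cmod[of "z - lam"] by auto
      then have "norm z > 2" using norm_triangle_ineq4[of z lam] lam by simp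
      then have "z \<notin> B" using b by (auto simp: B_def)
      then show "G z = 0" by (simp add: G_def \<psi>_zero)
    qed
    also have "\<dots> = 0" by (simp add: square_integral_def)
    finally have total: "(\<Sum>p\<in>{..<n} \<times> {..<n}. square_integral (grid_point a l (fst p) (snd p)) l G) = 0"
      by (simp add: sum.cartesian_product case_prod_unfold)
    have kn: "(k, k) \<in> {..<n} \<times> {..<n}" by (simp add: n_def)
    have gk: "grid_point a l k k = lam - Complex (l/2) (l/2)"
      by (simp add: grid_point_def a_def complex_eq_iff algebra_simps)
    \<comment> \<open>On the central cell the cutoff is 1: all discs are more than three radii away
      from \<open>lam\<close>, and the cell is small.\<close>
    have centre: "square_integral (grid_point a l k k) l G = square_integral (grid_point a l k k) l H"
    proof (rule square_integral_cong)
      fix z assume "z \<in> square_edges (grid_point a l k k) l"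
      then have "z \<in> square (grid_point a l k k) l" using square_edges_subset[of l] l(1) by fastforce
      moreover have "lam \<in> square (grid_point a l k k) l" using l(1) by (simp add: gk mem_square)
      ultimately have zl: "dist z lam \<le> 2 * l" by (rule dist_square_corner)
      have "norm z \<le> 1 + b" using zl lam norm_triangle_sub[of z lam] l m(2) by (simp add: dist_norm)
      then have "\<psi>0 z = 1" using b by (simp add: \<psi>0_def clamp01_def field_simps)
      moreover have "\<psi>d d z = 1" if "d \<in> F" for d
      proof -
        have "dist (fst d) lam \<le> dist (fst d) z + dist z lam" by (rule dist_triangle)
        then have "dist (fst d) z \<ge> 2 * snd d"
          using away[of d] F that zl l m(4)[OF that] by fastforce
        then show ?thesis using pos[of d] F that by (auto simp: \<psi>d_def clamp01_def field_simps)
      qed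
      ultimately show "G z = H z" by (simp add: G_def \<psi>_def)
    qed

    \<comment> \<open>The integral over a single cell away from the singularity\<close>
    define q where "q p = grid_point a l (fst p) (snd p)" for p
    define w where "w d = exp (N / (dist (fst d) lam - 3 * snd d))" for d
    have wr: "0 \<le> w d * (2 * l / snd d)" if "d \<in> F" for d
      using pos[of d] F that l by (auto simp: w_def)
    \<comment> \<open>Only the oscillation of the cutoff counts. A factor \<open>\<psi>d d\<close>
      oscillates only if the corner is within three radii of its centre, and there
      \<open>w d\<close> dominates the exponential bound of \<open>H\<close>.\<close>
    have cell: "norm (square_integral (q p) l G) \<le>
        4 * l * (\<eta> * ((\<Sum>d\<in>F. w d * (2 * l / snd d) * of_bool (dist (fst d) (q p) < 3 * snd d))
          + 2 * l / b * of_bool (1 \<le> norm (q p) \<and> norm (q p) \<le> 1 + 3 * b)))" (is "_ \<le> 4 * l * ?R")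
      if p: "p \<in> {..<n} \<times> {..<n} - {(k,k)}" for p
    proof -
      have R0: "?R \<ge> 0" using \<eta> l b wr
        by (intro mult_nonneg_nonneg[OF \<eta>] add_nonneg_nonneg sum_nonneg mult_nonneg_nonneg[OF wr]) auto
      have ij: "fst p < n" "snd p < n" "p \<noteq> (k,k)" using p by auto
      have qs: "q p \<in> square (q p) l" using l(1) by (simp add: mem_square)
      have lamQ: "lam \<notin> square (q p) l"
      proof
        assume "lam \<in> square (q p) l"
        then have "real (fst p) * l \<le> (real k + 1/2) * l" "(real k + 1/2) * l \<le> (real (fst p) + 1) * l"
          "real (snd p) * l \<le> (real k + 1/2) * l" "(real k + 1/2) * l \<le> (real (snd p) + 1) * l"
          by (auto simp: q_def grid_point_def a_def mem_square algebra_simps)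
        then have "real (fst p) \<le> real k + 1/2" "real k + 1/2 \<le> real (fst p) + 1"
          "real (snd p) \<le> real k + 1/2" "real k + 1/2 \<le> real (snd p) + 1"
          using l(1) by (simp_all only: mult_le_cancel_right_pos)
        then have "fst p = k" "snd p = k" by linarith+
        then show False using ij(3) by (simp add: prod_eq_iff)
      qed
      show ?thesis
      proof (cases "square (q p) l \<inter> B = {}")
        case True
        then have "square_integral (q p) l G = square_integral (q p) l (\<lambda>_. 0)"
          using square_edges_subset[of l "q p"] l(1)
          by (intro square_integral_cong, unfold G_def, subst \<psi>_zero) auto
        then show ?thesis using R0 l(1) by (simp add: square_integral_def)
      next
        case False
        then obtain z0 where z0: "z0 \<in> square (q p) l" "z0 \<in> B" by blast
        \<comment> \<open>A cell that meets \<open>B\<close> has diameter below \<open>e0\<close>,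
          so \<open>H\<close> is holomorphic on all of it.\<close>
        have QW: "square (q p) l \<subseteq> W - {lam}"
        proof
          fix z assume "z \<in> square (q p) l"
          then have "dist z0 z < e0" using dist_square_corner[OF z0(1)] l m(3) by fastforce
          then have "z \<in> (\<Union>x\<in>B. ball x e0)" using z0(2) by auto
          then show "z \<in> W - {lam}" using subsetD[OF e0(2)] lamQ \<open>z \<in> square (q p) l\<close> by auto
        qed
        have holQ: "H holomorphic_on square (q p) l" using H QW by (rule holomorphic_on_subset)
        have es: "square_edges (q p) l \<subseteq> square (q p) l" using square_edges_subset l(1) by simp
        have cH: "continuous_on (square_edges (q p) l) H"
          using holomorphic_on_imp_continuous_on[OF holQ] es by (rule continuous_on_subset)
        have cG: "continuous_on (square_edges (q p) l) G" using edgeG ij by (simp add: q_def)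
        have c2: "continuous_on (square_edges (q p) l) (\<lambda>z. of_real (\<psi> (q p)) * H z)"
          using cH by (intro continuous_intros)
        have "square_integral (q p) l (\<lambda>z. G z - of_real (\<psi> (q p)) * H z) = square_integral (q p) l G"
          using square_integral_diff[OF cG c2] square_integral_cmult[OF cH]
            square_integral_holomorphic[OF holQ] l(1) by simp
        moreover have "norm (square_integral (q p) l (\<lambda>z. G z - of_real (\<psi> (q p)) * H z)) \<le> 4 * l * ?R"
        proof (rule square_integral_bound)
          show "continuous_on (square_edges (q p) l) (\<lambda>z. G z - of_real (\<psi> (q p)) * H z)"
            using cG c2 by (rule continuous_on_diff)
          fix z assume "z \<in> square_edges (q p) l"
          then have zQ: "z \<in> square (q p) l" using es by blast
          have zq: "dist z (q p) \<le> 2 * l" using dist_square_corner[OF zQ qs] .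
          have zW: "z \<in> W - {lam}" using QW zQ by blast
          have d1: "norm (H z) * \<bar>\<psi>d d z - \<psi>d d (q p)\<bar>
              \<le> \<eta> * (w d * (2 * l / snd d) * of_bool (dist (fst d) (q p) < 3 * snd d))" if d: "d \<in> F" for d
          proof (cases "\<psi>d d z = \<psi>d d (q p)")
            case True
            have "0 \<le> \<eta> * (w d * (2 * l / snd d) * of_bool (dist (fst d) (q p) < 3 * snd d))"
              by (intro mult_nonneg_nonneg \<eta> wr d) auto
            with True show ?thesis by simp
          next
            case False
            have r: "snd d > 0" by (rule pos[OF subsetD[OF F(2) d]])
            have "dist (fst d) z < 2 * snd d \<or> dist (fst d) (q p) < 2 * snd d"
              using clamp01_differ[OF False[unfolded \<psi>d_def]] r by (auto simp: field_simps)
            then have near: "dist (fst d) z < 3 * snd d" "dist (fst d) (q p) < 3 * snd d"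
              using zq l m(4)[OF d] dist_triangle[of "fst d" z "q p"] dist_triangle[of "fst d" "q p" z]
              by (auto simp: dist_commute)
            \<comment> \<open>This is where the weight
              \<open>exp (N / (dist (fst d) lam - 3 * snd d))\<close> in the hypothesis on the sums
              comes from.\<close>
            have "dist (fst d) lam - 3 * snd d \<le> dist z lam"
              using dist_triangle[of "fst d" lam z] near(1) by linarith
            moreover have "dist (fst d) lam - 3 * snd d > 0" using away[OF subsetD[OF F(2) d]] by simp
            ultimately have "exp (N / dist z lam) \<le> w d"
              unfolding w_def exp_le_cancel_iff using N by (intro divide_left_mono mult_pos_pos) auto
            then have h: "norm (H z) \<le> \<eta> * w d"
              using b1[OF zW] \<eta> by (meson mult_left_mono order_trans)
            have "\<bar>\<psi>d d z - \<psi>d d (q p)\<bar> \<le> \<bar>(dist (fst d) z - snd d) / snd d - (dist (fst d) (q p) - snd d) / snd d\<bar>"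
              unfolding \<psi>d_def by (rule clamp01_lipschitz)
            also have "\<dots> = \<bar>dist (fst d) z - dist (fst d) (q p)\<bar> / snd d"
              using r by (simp add: diff_divide_distrib[symmetric])
            also have "\<dots> \<le> 2 * l / snd d"
              using r zq dist_triangle[of "fst d" z "q p"] dist_triangle[of "fst d" "q p" z]
              by (intro divide_right_mono) (auto simp: dist_commute abs_le_iff)
            finally have "norm (H z) * \<bar>\<psi>d d z - \<psi>d d (q p)\<bar> \<le> (\<eta> * w d) * (2 * l / snd d)"
              using h \<eta> by (intro mult_mono) (auto simp: w_def)
            then show ?thesis using near by (simp add: algebra_simps)
          qed
          have d2: "norm (H z) * \<bar>\<psi>0 z - \<psi>0 (q p)\<bar>
              \<le> \<eta> * (2 * l / b * of_bool (1 \<le> norm (q p) \<and> norm (q p) \<le> 1 + 3 * b))"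
          proof (cases "\<psi>0 z = \<psi>0 (q p)")
            case True
            then show ?thesis using \<eta> l b by simp
          next
            case False
            have "\<bar>norm z - norm (q p)\<bar> \<le> norm (z - q p)" by (rule norm_triangle_ineq3)
            then have nd: "\<bar>norm z - norm (q p)\<bar> \<le> 2 * l" using zq by (simp add: dist_norm)
            have "(norm z > 1 + b \<or> norm (q p) > 1 + b) \<and> (norm z < 1 + 2 * b \<or> norm (q p) < 1 + 2 * b)"
              using clamp01_differ[OF False[unfolded \<psi>0_def]] b by (auto simp: field_simps)
            \<comment> \<open>The outer factor varies only outside the unit disc, where
              \<open>H\<close> is bounded by \<open>\<eta>\<close> without exponential
              growth.\<close>
            then have near: "1 \<le> norm z" "1 \<le> norm (q p)" "norm (q p) \<le> 1 + 3 * b"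
              using nd l m(2) by linarith+
            have "\<bar>\<psi>0 z - \<psi>0 (q p)\<bar> \<le> \<bar>(1 + 2 * b - norm z) / b - (1 + 2 * b - norm (q p)) / b\<bar>"
              unfolding \<psi>0_def by (rule clamp01_lipschitz)
            also have "\<dots> = \<bar>norm z - norm (q p)\<bar> / b"
              using b by (simp add: diff_divide_distrib[symmetric] abs_minus_commute)
            also have "\<dots> \<le> 2 * l / b" using b nd by (intro divide_right_mono) auto
            finally have "norm (H z) * \<bar>\<psi>0 z - \<psi>0 (q p)\<bar> \<le> \<eta> * (2 * l / b)"
              using b2[OF zW near(1)] \<eta> by (intro mult_mono) auto
            then show ?thesis using near by simp
          qed
          \<comment> \<open>The discs may overlap: a product of factors in [0, 1] changes by at most
            the sum of the changes of its factors.\<close>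
          have pd: "\<bar>(\<Prod>d\<in>F. \<psi>d d z) - (\<Prod>d\<in>F. \<psi>d d (q p))\<bar> \<le> (\<Sum>d\<in>F. \<bar>\<psi>d d z - \<psi>d d (q p)\<bar>)"
            using norm_prod_diff[of F "\<lambda>d. \<psi>d d z" "\<lambda>d. \<psi>d d (q p)"] bd by simp
          have P1: "0 \<le> (\<Prod>d\<in>F. \<psi>d d x)" "(\<Prod>d\<in>F. \<psi>d d x) \<le> 1" for x
            using bd by (auto intro: prod_nonneg prod_le_1)
          have "\<psi> z - \<psi> (q p) = \<psi>0 z * ((\<Prod>d\<in>F. \<psi>d d z) - (\<Prod>d\<in>F. \<psi>d d (q p)))
              + (\<psi>0 z - \<psi>0 (q p)) * (\<Prod>d\<in>F. \<psi>d d (q p))" by (simp add: \<psi>_def algebra_simps)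
          then have "\<bar>\<psi> z - \<psi> (q p)\<bar> \<le> \<bar>\<psi>0 z\<bar> * \<bar>(\<Prod>d\<in>F. \<psi>d d z) - (\<Prod>d\<in>F. \<psi>d d (q p))\<bar>
              + \<bar>\<psi>0 z - \<psi>0 (q p)\<bar> * \<bar>\<Prod>d\<in>F. \<psi>d d (q p)\<bar>"
            by (metis abs_triangle_ineq abs_mult)
          also have "\<dots> \<le> 1 * (\<Sum>d\<in>F. \<bar>\<psi>d d z - \<psi>d d (q p)\<bar>) + \<bar>\<psi>0 z - \<psi>0 (q p)\<bar> * 1"
            using bd P1 pd by (intro add_mono mult_mono) auto
          finally have osc: "\<bar>\<psi> z - \<psi> (q p)\<bar> \<le> (\<Sum>d\<in>F. \<bar>\<psi>d d z - \<psi>d d (q p)\<bar>) + \<bar>\<psi>0 z - \<psi>0 (q p)\<bar>"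
            by simp
          have "G z - of_real (\<psi> (q p)) * H z = H z * of_real (\<psi> z - \<psi> (q p))"
            by (simp add: G_def algebra_simps)
          then have "norm (G z - of_real (\<psi> (q p)) * H z) = norm (H z) * \<bar>\<psi> z - \<psi> (q p)\<bar>"
            by (simp only: norm_mult norm_of_real)
          also have "\<dots> \<le> norm (H z) * ((\<Sum>d\<in>F. \<bar>\<psi>d d z - \<psi>d d (q p)\<bar>) + \<bar>\<psi>0 z - \<psi>0 (q p)\<bar>)"
            using osc by (intro mult_left_mono) auto
          also have "\<dots> = (\<Sum>d\<in>F. norm (H z) * \<bar>\<psi>d d z - \<psi>d d (q p)\<bar>) + norm (H z) * \<bar>\<psi>0 z - \<psi>0 (q p)\<bar>"
            by (simp add: distrib_left sum_distrib_left)
          also have "\<dots> \<le> (\<Sum>d\<in>F. \<eta> * (w d * (2 * l / snd d) * of_bool (dist (fst d) (q p) < 3 * snd d)))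
              + \<eta> * (2 * l / b * of_bool (1 \<le> norm (q p) \<and> norm (q p) \<le> 1 + 3 * b))"
            by (intro add_mono sum_mono d1 d2)
          also have "\<dots> = ?R" by (simp add: distrib_left sum_distrib_left)
          finally show "norm (G z - of_real (\<psi> (q p)) * H z) \<le> ?R" .
        qed (use l in simp)
        ultimately show ?thesis by simp
      qed
    qed

    \<comment> \<open>Counting the cells on which the cutoff oscillates\<close>
    let ?P = "{..<n} \<times> {..<n}"
    have count: "l\<^sup>2 * (\<Sum>p\<in>?P. of_bool (dist c (q p) < R)) \<le> (2 * R + l)\<^sup>2" if "R > 0" for c R
      using grid_count[OF l(1) that, of n c a] by (simp add: q_def of_bool_def sum.If_cases Int_def)
    \<comment> \<open>The number of cells is of order \<open>(snd d / l)^2\<close>; against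
      \<open>4 * l\<close> from the perimeter and \<open>2 * l / snd d\<close> from the slope this
      leaves a multiple of \<open>snd d\<close>, independent of \<open>l\<close>.\<close>
    have cd: "l\<^sup>2 * (\<Sum>p\<in>?P. of_bool (dist (fst d) (q p) < 3 * snd d)) \<le> 49 * (snd d)\<^sup>2" if d: "d \<in> F" for d
    proof -
      have r: "snd d > 0" by (rule pos[OF subsetD[OF F(2) d]])
      have "(2 * (3 * snd d) + l)\<^sup>2 \<le> (7 * snd d)\<^sup>2" using r l m(4)[OF d] by (intro power_mono) auto
      then show ?thesis using count[of "3 * snd d" "fst d"] r by (simp add: power_mult_distrib)
    qed
    have ca: "l\<^sup>2 * (\<Sum>p\<in>?P. of_bool (1 \<le> norm (q p) \<and> norm (q p) \<le> 1 + 3 * b)) \<le> 968 * b"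
    proof -
      obtain S :: "complex set" where S: "finite S" "real (card S) \<le> 8 / b"
        and S3: "\<forall>z. 1 \<le> norm z \<and> norm z \<le> 1 + 3 * b \<longrightarrow> (\<exists>c\<in>S. dist c z < 5 * b)"
        using annulus_cover[OF b] by (elim exE conjE)
      have "of_bool (1 \<le> norm z \<and> norm z \<le> 1 + 3 * b) \<le> (\<Sum>c\<in>S. of_bool (dist c z < 5 * b) :: real)" for z
      proof (cases "1 \<le> norm z \<and> norm z \<le> 1 + 3 * b")
        case True
        then obtain c where "c \<in> S" "dist c z < 5 * b" using S3 by blast
        then show ?thesis using S(1) member_le_sum[of c S "\<lambda>c. of_bool (dist c z < 5 * b) :: real"] by simp
      next
        case False
        then show ?thesis by (subst of_bool_eq_0_iff[THEN iffD2]) (auto intro: sum_nonneg)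
      qed
      then have "l\<^sup>2 * (\<Sum>p\<in>?P. of_bool (1 \<le> norm (q p) \<and> norm (q p) \<le> 1 + 3 * b))
          \<le> l\<^sup>2 * (\<Sum>p\<in>?P. \<Sum>c\<in>S. of_bool (dist c (q p) < 5 * b))" by (intro mult_left_mono sum_mono) auto
      also have "\<dots> = (\<Sum>c\<in>S. l\<^sup>2 * (\<Sum>p\<in>?P. of_bool (dist c (q p) < 5 * b)))"
        by (subst sum.swap) (simp add: sum_distrib_left)
      also have "\<dots> \<le> (\<Sum>c\<in>S. (11 * b)\<^sup>2)"
      proof (rule sum_mono)
        fix c
        have "(2 * (5 * b) + l)\<^sup>2 \<le> (11 * b)\<^sup>2" using b l m(2) by (intro power_mono) auto
        then show "l\<^sup>2 * (\<Sum>p\<in>?P. of_bool (dist c (q p) < 5 * b)) \<le> (11 * b)\<^sup>2"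
          using count[of "5 * b" c] b(1) by linarith
      qed
      also have "\<dots> = real (card S) * (11 * b)\<^sup>2" by simp
      also have "\<dots> \<le> 8 / b * (11 * b)\<^sup>2" using S(2) by (intro mult_right_mono) auto
      also have "\<dots> = 968 * b" using b by (simp add: power2_eq_square)
      finally show ?thesis .
    qed
    have "square_integral (q (k,k)) l G = - (\<Sum>p\<in>?P - {(k,k)}. square_integral (q p) l G)"
      using total sum.remove[OF _ kn, of "\<lambda>p. square_integral (q p) l G"]
      by (simp add: q_def add_eq_0_iff)
    then have "norm (square_integral (q (k,k)) l G) \<le> (\<Sum>p\<in>?P - {(k,k)}. norm (square_integral (q p) l G))"
      by (simp add: norm_sum)
    also have "\<dots> \<le> (\<Sum>p\<in>?P - {(k,k)}. 4 * l * (\<eta> * ((\<Sum>d\<in>F. w d * (2 * l / snd d) * of_bool (dist (fst d) (q p) < 3 * snd d))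
          + 2 * l / b * of_bool (1 \<le> norm (q p) \<and> norm (q p) \<le> 1 + 3 * b))))" by (intro sum_mono cell)
    also have "\<dots> \<le> (\<Sum>p\<in>?P. 4 * l * (\<eta> * ((\<Sum>d\<in>F. w d * (2 * l / snd d) * of_bool (dist (fst d) (q p) < 3 * snd d))
          + 2 * l / b * of_bool (1 \<le> norm (q p) \<and> norm (q p) \<le> 1 + 3 * b))))"
      using l b by (intro sum_mono2 mult_nonneg_nonneg[OF _ mult_nonneg_nonneg[OF \<eta>
          add_nonneg_nonneg[OF sum_nonneg[OF mult_nonneg_nonneg[OF wr]]]]]) auto
    also have "\<dots> = \<eta> * (\<Sum>p\<in>?P. (\<Sum>d\<in>F. 8 * (w d / snd d) * (l\<^sup>2 * of_bool (dist (fst d) (q p) < 3 * snd d)))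
          + 8 / b * (l\<^sup>2 * of_bool (1 \<le> norm (q p) \<and> norm (q p) \<le> 1 + 3 * b)))"
      by (simp add: sum_distrib_left distrib_left power2_eq_square mult_ac)
    also have "\<dots> = \<eta> * ((\<Sum>d\<in>F. 8 * (w d / snd d) * (l\<^sup>2 * (\<Sum>p\<in>?P. of_bool (dist (fst d) (q p) < 3 * snd d))))
          + 8 / b * (l\<^sup>2 * (\<Sum>p\<in>?P. of_bool (1 \<le> norm (q p) \<and> norm (q p) \<le> 1 + 3 * b))))"
      by (simp only: sum.distrib sum_distrib_left sum.swap[of _ F ?P])
    \<comment> \<open>The constants: 8 is perimeter 4 times cell diameter 2, so
      \<open>392 = 8 * 49\<close> for the discs and \<open>7744 = 8 * 968\<close> for the annulus,
      with \<open>968 = 8 * 11^2\<close>.\<close>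
    also have "\<dots> \<le> \<eta> * ((\<Sum>d\<in>F. 8 * (w d / snd d) * (49 * (snd d)\<^sup>2)) + 8 / b * (968 * b))"
    proof -
      have "0 \<le> 8 * (w d / snd d)" if "d \<in> F" for d
        using pos[OF subsetD[OF F(2) that]] by (simp add: w_def)
      then show ?thesis using b
        by (intro mult_left_mono[OF _ \<eta>] add_mono sum_mono mult_left_mono[OF cd] mult_left_mono[OF ca]) auto
    qed
    also have "(\<Sum>d\<in>F. 8 * (w d / snd d) * (49 * (snd d)\<^sup>2)) = 392 * (\<Sum>d\<in>F. snd d * w d)"
      unfolding sum_distrib_left using pos F by (intro sum.cong) (auto simp: power2_eq_square)
    also have "(\<Sum>d\<in>F. snd d * w d) \<le> C" unfolding w_def using sums F by blast
    also have "8 / b * (968 * b) = 7744" using b by simp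
    finally have "norm (square_integral (q (k,k)) l G) \<le> \<eta> * (392 * C + 7744)"
      using \<eta> by (simp add: mult_left_mono)
    then show ?thesis using centre gk by (simp add: q_def)
  qed
  then show ?thesis using m(1) by (intro exI[of _ "m/4"]) auto
qed

section \<open>Families of discs with bounded sums\<close>

text \<open>Total radii are expressed by finite subsums, so that families of discs can be handled as
  sets and united freely; they are enumerated only when the final sequence is produced.\<close>

definition sums_bounded :: "('a \<Rightarrow> real) \<Rightarrow> 'a set \<Rightarrow> real \<Rightarrow> bool" where
  "sums_bounded f D B \<longleftrightarrow> (\<forall>F. finite F \<and> F \<subseteq> D \<longrightarrow> sum f F \<le> B)"

lemma sums_boundedD: "sums_bounded f D B \<Longrightarrow> finite F \<Longrightarrow> F \<subseteq> D \<Longrightarrow> sum f F \<le> B"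
  by (simp add: sums_bounded_def)

lemma sums_bounded_finite:
  assumes "finite D" "\<And>d. d \<in> D \<Longrightarrow> f d \<ge> 0" "sum f D \<le> B"
  shows "sums_bounded f D B"
  unfolding sums_bounded_def
proof clarify
  fix F assume "F \<subseteq> D"
  then have "sum f F \<le> sum f D" using assms by (intro sum_mono2) auto
  then show "sum f F \<le> B" using assms(3) by simp
qed

lemma sums_bounded_mono:
  "sums_bounded f D B \<Longrightarrow> D' \<subseteq> D \<Longrightarrow> B \<le> B' \<Longrightarrow> sums_bounded f D' B'"
  unfolding sums_bounded_def by (meson order_trans)

lemma sums_bounded_nonneg: "sums_bounded f D B \<Longrightarrow> B \<ge> 0"
  using sums_boundedD[of f D B "{}"] by simp

lemma sums_bounded_Un:
  assumes "sums_bounded f D B" "sums_bounded f D' B'" and f: "\<And>d. d \<in> D \<union> D' \<Longrightarrow> f d \<ge> 0"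
  shows "sums_bounded f (D \<union> D') (B + B')"
  unfolding sums_bounded_def
proof clarify
  fix F assume F: "finite F" "F \<subseteq> D \<union> D'"
  have "sum f F = sum f (F \<inter> D \<union> (F - D))" by (rule arg_cong[of _ _ "sum f"]) blast
  also have "\<dots> = sum f (F \<inter> D) + sum f (F - D)" using F by (intro sum.union_disjoint) auto
  also have "\<dots> \<le> B + B'" using F by (intro add_mono sums_boundedD[OF assms(1)] sums_boundedD[OF assms(2)]) auto
  finally show "sum f F \<le> B + B'" .
qed

text \<open>An element is counted once for each \<open>D i\<close> that contains it, which can only
  enlarge the right-hand side.\<close>

lemma sums_bounded_UN:
  fixes D :: "nat \<Rightarrow> 'a set"
  assumes D: "\<And>i. sums_bounded f (D i) (B i)" and f: "\<And>i d. d \<in> D i \<Longrightarrow> f d \<ge> 0"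
    and B: "summable B" "suminf B \<le> C"
  shows "sums_bounded f (\<Union>i. D i) C"
  unfolding sums_bounded_def
proof clarify
  fix F assume F: "finite F" "F \<subseteq> (\<Union>i. D i)"
  have "\<exists>i. d \<in> D i" if "d \<in> F" for d using F that by blast
  then obtain ix where ix: "\<And>d. d \<in> F \<Longrightarrow> d \<in> D (ix d)" by metis
  obtain n where n: "\<And>d. d \<in> F \<Longrightarrow> ix d < n"
    using finite_nat_bounded[OF finite_imageI[OF F(1), of ix]] by blast
  have "sum f F \<le> (\<Sum>d\<in>F. \<Sum>i<n. if d \<in> D i then f d else 0)"
  proof (rule sum_mono)
    fix d assume d: "d \<in> F"
    have "(if d \<in> D (ix d) then f d else 0) \<le> (\<Sum>i<n. if d \<in> D i then f d else 0)"
      using n[OF d] f by (intro member_le_sum) auto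
    then show "f d \<le> (\<Sum>i<n. if d \<in> D i then f d else 0)" using ix[OF d] by simp
  qed
  also have "\<dots> = (\<Sum>i<n. sum f (F \<inter> D i))"
    by (subst sum.swap) (simp add: sum.inter_restrict F(1))
  also have "\<dots> \<le> (\<Sum>i<n. B i)" using F by (intro sum_mono sums_boundedD[OF D]) auto
  also have "\<dots> \<le> suminf B" using sums_bounded_nonneg[OF D] by (intro sum_le_suminf B) auto
  finally show "sum f F \<le> C" using B(2) by simp
qed

section \<open>Cutoff functions of annuli\<close>

text \<open>If \<open>w ^ N\<close> is close to 1, its logarithm \<open>b\<close> is small, and
  \<open>w * exp (- b / N)\<close> is an N-th root of unity at distance at most
  \<open>3 * norm (1 - w ^ N) / N\<close> from \<open>w\<close>.\<close>

lemma norm_one_minus_power_ge: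
  fixes w :: complex
  assumes N: "N \<ge> 1" and d: "\<And>u. u ^ N = 1 \<Longrightarrow> d \<le> norm (w - u)" and d0: "d > 0"
  shows "min (1/4) (real N * d / 4) \<le> norm (1 - w ^ N)"
proof (rule ccontr)
  assume "\<not> ?thesis"
  then have *: "norm (1 - w ^ N) < 1/4" "norm (1 - w ^ N) < real N * d / 4" by auto
  define b where "b = Ln (w ^ N)"
  have w: "w \<noteq> 0" using *(1) N by (auto simp: power_0_left)
  have eb: "exp b = w ^ N" using w by (simp add: b_def)
  have b: "norm b \<le> 2 * norm (1 - w ^ N)"
    using norm_Ln_le[of "w ^ N - 1"] *(1) by (simp add: b_def norm_minus_commute)
  have nb: "norm (b / of_nat N) = norm b / N" by (simp add: norm_divide)
  define u where "u = w * exp (- b / N)"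
  have "exp (- b / N) ^ N = exp (- b)" using N exp_of_nat_mult[of N "- b / N"] by simp
  then have uN: "u ^ N = 1" using eb w by (simp add: u_def power_mult_distrib exp_minus)
  then have nu: "norm u = 1" using N by (metis norm_one norm_power norm_ge_zero power_eq_1_iff zero_neq_one less_one not_less_iff_gr_or_eq le_eq_less_or_eq)
  have "w = u * exp (b / N)" by (simp add: u_def exp_minus)
  then have "w - u = u * (exp (b / N) - 1)" by (simp add: algebra_simps)
  then have "norm (w - u) = norm (exp (b / N) - 1)" using nu by (simp add: norm_mult)
  also have "\<dots> \<le> 3/2 * norm (b / N)"
  proof (rule norm_exp_bounds)
    have "norm b / N \<le> norm b" using N frac_le[of "norm b" "norm b" 1 "real N"] by simp
    then show "norm (b / N) \<le> 1/2" unfolding nb using b *(1) by linarith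
  qed
  also have "\<dots> \<le> 3 * norm (1 - w ^ N) / N"
    unfolding nb using divide_right_mono[of "3/2 * norm b" "3 * norm (1 - w ^ N)" "real N"] b by simp
  also have "\<dots> < 3 * (real N * d / 4) / N" using *(2) N by (intro divide_strict_right_mono mult_strict_left_mono) auto
  also have "\<dots> < d" using N d0 by simp
  finally show False using d[OF uN] by simp
qed

definition root_discs :: "complex \<Rightarrow> real \<Rightarrow> nat \<Rightarrow> real \<Rightarrow> (complex \<times> real) set" where
  "root_discs a t N e = (\<lambda>u. (a + of_real t * u, e / real N)) ` {u. u ^ N = 1}"

text \<open>For large \<open>N\<close> this is close to 1 inside the circle of radius
  \<open>t\<close> about \<open>a\<close> and close to 0 outside. Its poles are the centres of
  \<open>root_discs\<close>.\<close>

definition root_factor :: "complex \<Rightarrow> real \<Rightarrow> nat \<Rightarrow> complex \<Rightarrow> complex" where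
  "root_factor a t N z = 1 / (1 - ((z - a) / of_real t) ^ N)"

lemma root_discs_props:
  assumes N: "N \<ge> 1" and t: "t > 0" and e: "e > 0"
  shows "finite (root_discs a t N e)"
    and "d \<in> root_discs a t N e \<Longrightarrow> snd d = e / N \<and> dist (fst d) a = t"
    and "sums_bounded snd (root_discs a t N e) e"
proof -
  have fin: "finite {u::complex. u ^ N = 1}" using finite_roots_unity[of N] N by simp
  then show f: "finite (root_discs a t N e)" by (simp add: root_discs_def)
  have "norm u = 1" if "u ^ N = 1" for u :: complex
    using that N by (metis norm_one norm_power norm_ge_zero power_eq_1_iff zero_neq_one less_one not_less_iff_gr_or_eq le_eq_less_or_eq)
  then show *: "d \<in> root_discs a t N e \<Longrightarrow> snd d = e / N \<and> dist (fst d) a = t" for d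
    using t by (auto simp: root_discs_def dist_norm norm_mult)
  have "card (root_discs a t N e) \<le> N"
    unfolding root_discs_def using card_image_le[OF fin] card_complex_roots_unity[OF N] by metis
  have "sum snd (root_discs a t N e) = real (card (root_discs a t N e)) * (e / N)"
    using * by (simp add: sum.cong[of _ _ snd "\<lambda>_. e / N"])
  also have "\<dots> \<le> real N * (e / N)" using \<open>card (root_discs a t N e) \<le> N\<close> e
    by (intro mult_right_mono) auto
  finally have "sum snd (root_discs a t N e) \<le> e" using N by simp
  then show "sums_bounded snd (root_discs a t N e) e"
    using f * e by (intro sums_bounded_finite) auto
qed

text \<open>The point is that the bound does not involve \<open>N\<close>: the factor
  \<open>N\<close> gained near a root of unity cancels the \<open>1 / N\<close> in the radius. So
  \<open>N\<close> can be chosen after the bound is known.\<close>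

lemma root_factor_off_discs:
  assumes N: "N \<ge> 1" and t: "t > 0" and e: "e > 0"
    and z: "\<And>d. d \<in> root_discs a t N e \<Longrightarrow> z \<notin> ball (fst d) (snd d)"
  shows "((z - a) / of_real t) ^ N \<noteq> 1" "norm (root_factor a t N z) \<le> max 4 (4 * t / e)"
proof -
  have "e / N / t \<le> norm ((z - a) / of_real t - u)" if "u ^ N = 1" for u
  proof -
    have "(a + of_real t * u, e / N) \<in> root_discs a t N e" using that by (auto simp: root_discs_def)
    from z[OF this] have le: "e / N \<le> norm (z - a - of_real t * u)" by (simp add: dist_norm norm_minus_commute algebra_simps)
    moreover have "(z - a) / of_real t - u = (z - a - of_real t * u) / of_real t" using t by (simp add: field_simps)
    ultimately show ?thesis using t divide_right_mono[OF le, of t] by (simp add: norm_divide)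
  qed
  then have "min (1/4) (real N * (e / N / t) / 4) \<le> norm (1 - ((z - a) / of_real t) ^ N)"
    using N t e by (intro norm_one_minus_power_ge) auto
  then have *: "min (1/4) (e / (4 * t)) \<le> norm (1 - ((z - a) / of_real t) ^ N)" using N by (simp add: mult.commute)
  have m: "0 < min (1/4) (e / (4 * t))" using t e by simp
  then show "((z - a) / of_real t) ^ N \<noteq> 1" using * by auto
  have "norm (root_factor a t N z) \<le> 1 / min (1/4) (e / (4 * t))"
    unfolding root_factor_def norm_divide using * m by (auto intro!: divide_left_mono mult_pos_pos)
  also have "\<dots> \<le> max 4 (4 * t / e)" using t e by (auto simp: min_def max_def field_simps)
  finally show "norm (root_factor a t N z) \<le> max 4 (4 * t / e)" .
qed

lemma rational_limit_root_factor:
  assumes N: "N \<ge> 1" and t: "t > 0" and e: "e > 0"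
    and X: "\<And>d z. d \<in> root_discs a t N e \<Longrightarrow> z \<in> X \<Longrightarrow> z \<notin> ball (fst d) (snd d)"
  shows "rational_limit X (root_factor a t N)"
proof (rule rational_limit_rational[where p = 1 and q = "1 - [:- a / of_real t, 1 / of_real t:] ^ N"])
  have *: "poly (1 - [:- a / of_real t, 1 / of_real t:] ^ N) z = 1 - ((z - a) / of_real t) ^ N" for z
    by (simp add: diff_divide_distrib)
  fix z assume z: "z \<in> X"
  show "poly (1 - [:- a / of_real t, 1 / of_real t:] ^ N) z \<noteq> 0"
    unfolding * using root_factor_off_discs(1)[OF N t e] X z by (metis eq_iff_diff_eq_0)
  show "root_factor a t N z = poly 1 z / poly (1 - [:- a / of_real t, 1 / of_real t:] ^ N) z"
    unfolding * by (simp add: root_factor_def)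
qed

lemma root_factor_approx:
  assumes "0 < t1" "t1 < t" "t < t2" "\<delta> > 0"
  shows "\<exists>N\<ge>1. (\<forall>z. dist z a \<le> t1 \<longrightarrow> norm (1 - root_factor a t N z) \<le> \<delta>) \<and>
    (\<forall>z. dist z a \<ge> t2 \<longrightarrow> norm (root_factor a t N z) \<le> \<delta>)"
proof -
  define \<epsilon> where "\<epsilon> = min (1/2) (\<delta>/2)"
  have \<epsilon>: "\<epsilon> > 0" "\<epsilon> \<le> 1/2" "2 * \<epsilon> \<le> \<delta>" using assms by (auto simp: \<epsilon>_def)
  have "(\<lambda>N. (t1 / t) ^ N) \<longlonglongrightarrow> 0" "(\<lambda>N. (t / t2) ^ N) \<longlonglongrightarrow> 0"
    using assms by (auto intro!: LIMSEQ_realpow_zero)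
  then have "\<forall>\<^sub>F N in sequentially. (t1 / t) ^ N < \<epsilon>" "\<forall>\<^sub>F N in sequentially. (t / t2) ^ N < \<epsilon>"
    using \<epsilon>(1) by (auto intro: order_tendstoD(2))
  then have "\<forall>\<^sub>F N in sequentially. (t1 / t) ^ N < \<epsilon> \<and> (t / t2) ^ N < \<epsilon> \<and> N \<ge> 1"
    using eventually_ge_at_top[of 1] by eventually_elim auto
  then obtain N where N: "(t1 / t) ^ N < \<epsilon>" "(t / t2) ^ N < \<epsilon>" "N \<ge> 1"
    by (auto simp: eventually_sequentially)
  have in1: "norm (1 - root_factor a t N z) \<le> \<delta>" if z: "dist z a \<le> t1" for z
  proof -
    define q where "q = ((z - a) / of_real t) ^ N"
    have "norm q = (dist z a / t) ^ N" using assms by (simp add: q_def norm_power norm_divide dist_norm)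
    also have "\<dots> \<le> (t1 / t) ^ N" using z assms by (intro power_mono divide_right_mono) auto
    finally have q: "norm q \<le> \<epsilon>" using N(1) by simp
    have "1 - norm q \<le> norm (1 - q)" using norm_triangle_ineq2[of 1 q] by simp
    then have h: "1/2 \<le> norm (1 - q)" using q \<epsilon>(2) by simp
    then have "1 - q \<noteq> 0" by auto
    then have "1 - 1 / (1 - q) = - q / (1 - q)" by (simp add: field_simps)
    then have "norm (1 - root_factor a t N z) = norm q / norm (1 - q)"
      by (simp add: root_factor_def q_def norm_divide)
    also have "\<dots> \<le> \<epsilon> / (1/2)" using q h \<epsilon> by (intro frac_le) auto
    finally show ?thesis using \<epsilon>(3) by simp
  qed
  have out: "norm (root_factor a t N z) \<le> \<delta>" if z: "dist z a \<ge> t2" for z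
  proof -
    define q where "q = ((z - a) / of_real t) ^ N"
    have "norm q = (dist z a / t) ^ N" using assms by (simp add: q_def norm_power norm_divide dist_norm)
    also have "\<dots> \<ge> (t2 / t) ^ N" using z assms by (intro power_mono divide_right_mono) auto
    also have "(t2 / t) ^ N = 1 / (t / t2) ^ N" by (simp add: power_divide)
    also have "1 / (t / t2) ^ N \<ge> 1 / \<epsilon>" using N(2) assms \<epsilon> by (intro divide_left_mono mult_pos_pos) auto
    finally have q: "1 / \<epsilon> \<le> norm q" .
    have "1 \<le> 1 / (2 * \<epsilon>)" using \<epsilon> by (simp add: field_simps)
    moreover have "1 / \<epsilon> = 1 / (2 * \<epsilon>) + 1 / (2 * \<epsilon>)" by simp
    ultimately have h: "1 / (2 * \<epsilon>) \<le> norm (1 - q)" using q norm_triangle_ineq2[of q 1] by (simp add: norm_minus_commute)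
    have "norm (root_factor a t N z) = 1 / norm (1 - q)" by (simp add: root_factor_def q_def norm_divide)
    also have "\<dots> \<le> 1 / (1 / (2 * \<epsilon>))" using h \<epsilon> by (intro divide_left_mono mult_pos_pos) (auto intro: less_le_trans[OF _ h])
    finally show ?thesis using \<epsilon>(3) by simp
  qed
  show ?thesis using N(3) in1 out by blast
qed

text \<open>An infinite product whose \<open>m\<close>-th factor changes from about \<open>1\<close> to about \<open>0\<close> where \<open>\<rho>\<close> passes from
  \<open>\<tau> m\<close> to \<open>\<tau> (Suc m)\<close>. The possibly large value of a factor in its transition zone is compensated by the
  preceding one, whence the hypothesis on \<open>\<delta>\<close>.\<close>

lemma zone_product:
  fixes u :: "nat \<Rightarrow> complex \<Rightarrow> complex" and \<rho> :: "complex \<Rightarrow> real"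
  assumes X: "compact X" and u: "\<And>m. rational_limit X (u m)"
    and bound: "\<And>m z. z \<in> X \<Longrightarrow> norm (u m z) \<le> B m" and B: "\<And>m. B m \<ge> 1"
    and \<tau>: "\<And>m. \<tau> m \<le> \<tau> (Suc m)"
    and near: "\<And>m z. z \<in> X \<Longrightarrow> \<rho> z \<le> \<tau> m \<Longrightarrow> norm (1 - u m z) \<le> \<delta> m"
    and small: "\<And>m z. z \<in> X \<Longrightarrow> \<rho> z \<ge> \<tau> (Suc m) \<Longrightarrow> norm (u m z) \<le> \<delta> m"
    and \<delta>0: "\<And>m. 0 \<le> \<delta> m" and \<delta>: "\<And>m. \<delta> m * (B (Suc m) + 1) \<le> \<eta> * (1/2) ^ (m + 2)"
    and \<eta>: "0 < \<eta>" "\<eta> \<le> 1"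
  shows "\<exists>P. rational_limit X P \<and> (\<forall>z\<in>X. norm (P z) \<le> 2 * B 0) \<and>
    (\<forall>z\<in>X. (\<forall>m. \<tau> m \<le> \<rho> z) \<longrightarrow> P z = 0) \<and> (\<forall>z\<in>X. \<rho> z \<le> \<tau> 0 \<longrightarrow> norm (1 - P z) \<le> \<eta>)"
proof -
  define p where "p M z = (\<Prod>m<M. u m z)" for M z
  define \<sigma> where "\<sigma> M = (\<Sum>m<M. \<delta> m)" for M
  have p_Suc: "p (Suc M) z = p M z * u M z" and p0: "p 0 z = 1" for M z by (simp_all add: p_def)
  have \<sigma>_Suc: "\<sigma> (Suc M) = \<sigma> M + \<delta> M" and \<sigma>0: "\<sigma> 0 = 0" for M by (simp_all add: \<sigma>_def)
  have \<tau>_mono: "m \<le> n \<Longrightarrow> \<tau> m \<le> \<tau> n" for m n using \<tau> by (rule lift_Suc_mono_le)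
  have \<delta>B: "\<delta> m * (B (Suc m) + 1) \<le> (1/2) ^ (m + 2)" for m
  proof -
    have "\<eta> * (1/2) ^ (m + 2) \<le> (1/2 :: real) ^ (m + 2)" using \<eta> by (intro mult_left_le_one_le) auto
    then show ?thesis by (rule order_trans[OF \<delta>])
  qed
  have \<delta>1: "\<delta> m \<le> \<eta> * (1/2) ^ (m + 2)" for m
  proof -
    have "\<delta> m * 1 \<le> \<delta> m * (B (Suc m) + 1)" using B[of "Suc m"] \<delta>0 by (intro mult_left_mono) auto
    then show ?thesis using \<delta>[of m] by simp
  qed
  have pow2: "(1/2::real) ^ (m + 2) = (1/2) ^ m / 4" for m by simp
  have \<delta>2: "\<delta> m \<le> (1/2) ^ m / 4" for m
    using \<delta>B[of m] \<delta>0[of m] B[of "Suc m"] mult_left_mono[of 1 "B (Suc m) + 1" "\<delta> m"] unfolding pow2 by simp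
  have \<delta>3: "\<delta> m \<le> 1" for m using \<delta>2[of m] power_le_one[of "1/2::real" m] by simp
  have \<sigma>_le: "\<sigma> M \<le> \<eta> / 2 * (1 - (1/2) ^ M)" for M
  proof (induction M)
    case (Suc M)
    then show ?case using \<delta>1[of M] unfolding \<sigma>_Suc pow2 by (simp add: algebra_simps)
  qed (simp add: \<sigma>0)
  have \<sigma>: "0 \<le> \<sigma> M" "2 * \<sigma> M \<le> \<eta>" "2 * \<sigma> M \<le> 1" for M
  proof -
    show "0 \<le> \<sigma> M" unfolding \<sigma>_def using \<delta>0 by (simp add: sum_nonneg)
    have "\<eta> / 2 * (1 - (1/2) ^ M) \<le> \<eta> / 2 * 1" using \<eta> by (intro mult_left_mono) auto
    then have "\<sigma> M \<le> \<eta> / 2 * 1" by (rule order_trans[OF \<sigma>_le])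
    then show "2 * \<sigma> M \<le> \<eta>" "2 * \<sigma> M \<le> 1" using \<eta> by auto
  qed
  \<comment> \<open>Once the zone of the last factor is passed, that factor is tiny, and the product
    of the earlier ones is at most 1 by induction.\<close>
  have past: "norm (p M z) \<le> (if M = 0 then 1 else \<delta> (M - 1))" if z: "z \<in> X" "\<rho> z \<ge> \<tau> M" for M z
    using that(2)
  proof (induction M)
    case (Suc M)
    have "norm (p M z) \<le> (if M = 0 then 1 else \<delta> (M - 1))" using Suc \<tau>[of M] by simp
    also have "\<dots> \<le> 1" using \<delta>3 by simp
    finally have "norm (p M z) * norm (u M z) \<le> 1 * \<delta> M" using small[OF z(1) Suc.prems] by (intro mult_mono) auto
    then show ?case by (simp add: p_Suc norm_mult)
  qed (simp add: p0)
  \<comment> \<open>Before its zone the factor \<open>u M\<close> costs only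
    \<open>1 + \<delta> M\<close>. Within or after its zone the product so far is at most
    \<open>\<delta> (M - 1)\<close>, which absorbs \<open>B M\<close>. Only \<open>B 0\<close> has
    nothing preceding it and stays in the bound.\<close>
  have pb: "norm (p M z) \<le> B 0 * (1 + 2 * \<sigma> M)" if z: "z \<in> X" for M z
  proof (induction M)
    case 0
    show ?case using B[of 0] by (simp add: p0 \<sigma>0)
  next
    case (Suc M)
    show ?case
    proof (cases "\<rho> z \<le> \<tau> M")
      case True
      have "norm (u M z) \<le> 1 + \<delta> M" using near[OF z True] norm_triangle_sub[of "u M z" 1] by (simp add: norm_minus_commute)
      then have "norm (p M z) * norm (u M z) \<le> (B 0 * (1 + 2 * \<sigma> M)) * (1 + \<delta> M)"
        using Suc B[of 0] \<sigma>[of M] by (intro mult_mono) auto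
      also have "\<dots> = B 0 * (1 + 2 * \<sigma> M + (1 + 2 * \<sigma> M) * \<delta> M)" by (simp add: algebra_simps)
      also have "\<dots> \<le> B 0 * (1 + 2 * \<sigma> M + 2 * \<delta> M)"
        using B[of 0] \<sigma>(3)[of M] \<delta>0[of M] by (intro mult_left_mono add_left_mono mult_right_mono) auto
      finally show ?thesis by (simp add: p_Suc \<sigma>_Suc norm_mult algebra_simps)
    next
      case False
      have "norm (p (Suc M) z) \<le> B 0"
      proof (cases M)
        case 0
        then show ?thesis using bound[OF z, of 0] by (simp add: p_Suc p0)
      next
        case (Suc k)
        then have "norm (p M z) \<le> \<delta> k" using past[OF z, of M] False by simp
        then have "norm (p M z) * norm (u M z) \<le> \<delta> k * B M" using bound[OF z] \<delta>0 by (intro mult_mono) auto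
        also have "\<dots> \<le> 1" using \<delta>B[of k] Suc \<delta>0[of k] power_le_one[of "1/2::real" "k + 2"] by (simp add: algebra_simps)
        finally show ?thesis using B[of 0] by (simp add: p_Suc norm_mult)
      qed
      also have "B 0 * 1 \<le> B 0 * (1 + 2 * \<sigma> (Suc M))" using B[of 0] \<sigma>(1)[of "Suc M"] by (intro mult_left_mono) auto
      finally show ?thesis by simp
    qed
  qed
  have pb2: "norm (p M z) \<le> 2 * B 0" if z: "z \<in> X" for M z
  proof -
    have "B 0 * (1 + 2 * \<sigma> M) \<le> B 0 * 2" using B[of 0] \<sigma>(3)[of M] by (intro mult_left_mono) auto
    then show ?thesis using pb[OF z, of M] by simp
  qed
  have near1: "norm (1 - p M z) \<le> 2 * \<sigma> M" if z: "z \<in> X" "\<rho> z \<le> \<tau> 0" for M z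
  proof (induction M)
    case (Suc M)
    have n: "norm (1 - u M z) \<le> \<delta> M" using near[OF z(1)] z(2) \<tau>_mono[of 0 M] by simp
    have "norm (p M z) \<le> 2" using Suc \<sigma>(3)[of M] norm_triangle_sub[of "p M z" 1] by (simp add: norm_minus_commute)
    have "1 - p (Suc M) z = (1 - p M z) + p M z * (1 - u M z)" by (simp add: p_Suc algebra_simps)
    then have "norm (1 - p (Suc M) z) \<le> norm (1 - p M z) + norm (p M z) * norm (1 - u M z)"
      by (metis norm_triangle_ineq norm_mult)
    also have "\<dots> \<le> 2 * \<sigma> M + 2 * \<delta> M" using Suc n \<open>norm (p M z) \<le> 2\<close> by (intro add_mono mult_mono) auto
    finally show ?case by (simp add: \<sigma>_Suc)
  qed (simp add: p0 \<sigma>0)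
  \<comment> \<open>The same dichotomy bounds consecutive differences by a geometric sequence,
    uniformly in \<open>z\<close>.\<close>
  have step: "norm (p (Suc M) z - p M z) \<le> 2 * B 0 * (1/2) ^ M" if z: "z \<in> X" for M z
  proof -
    have e: "norm (p (Suc M) z - p M z) = norm (p M z) * norm (1 - u M z)"
    proof -
      have "p (Suc M) z - p M z = - (p M z * (1 - u M z))" by (simp add: p_Suc algebra_simps)
      then show ?thesis by (simp only: norm_minus_cancel norm_mult)
    qed
    show ?thesis
    proof (cases "\<rho> z \<le> \<tau> M")
      case True
      have "norm (p M z) * norm (1 - u M z) \<le> (2 * B 0) * \<delta> M"
        using pb2[OF z] near[OF z True] B[of 0] by (intro mult_mono) auto
      also have "\<dots> \<le> (2 * B 0) * (1/2) ^ M" using B[of 0] \<delta>2[of M] zero_le_power[of "1/2::real" M] by (intro mult_left_mono) linarith+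
      finally show ?thesis by (simp add: e)
    next
      case False
      have u1: "norm (1 - u M z) \<le> B M + 1" using bound[OF z, of M] norm_triangle_ineq4[of 1 "u M z"] by simp
      show ?thesis
      proof (cases M)
        case 0
        then show ?thesis using u1 B[of 0] e by (simp add: p0)
      next
        case (Suc k)
        then have "norm (p M z) \<le> \<delta> k" using past[OF z, of M] False by simp
        then have "norm (p M z) * norm (1 - u M z) \<le> \<delta> k * (B M + 1)" using u1 \<delta>0 by (intro mult_mono) auto
        also have "\<dots> \<le> (1/2) ^ (k + 2)" using \<delta>B[of k] Suc by simp
        also have "\<dots> \<le> (1/2) ^ M" using Suc by simp
        also have "1 * (1/2) ^ M \<le> 2 * B 0 * (1/2) ^ M" using B[of 0] by (intro mult_right_mono) auto
        finally show ?thesis by (simp add: e)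
      qed
    qed
  qed
  \<comment> \<open>The infinite product as a telescoping series, so that the Weierstrass test
    applies.\<close>
  define P where "P z = 1 + (\<Sum>M. p (Suc M) z - p M z)" for z
  have "uniform_limit X (\<lambda>n z. \<Sum>M<n. p (Suc M) z - p M z) (\<lambda>z. \<Sum>M. p (Suc M) z - p M z) sequentially"
  proof (rule Weierstrass_m_test)
    show "norm (p (Suc M) z - p M z) \<le> 2 * B 0 * (1/2) ^ M" if "z \<in> X" for M z by (rule step[OF that])
    show "summable (\<lambda>M. 2 * B 0 * (1/2) ^ M)" by (intro summable_mult summable_geometric) simp
  qed
  then have "uniform_limit X (\<lambda>n z. 1 + (\<Sum>M<n. p (Suc M) z - p M z)) P sequentially"
    unfolding P_def by (intro uniform_limit_add uniform_limit_const)
  moreover have "1 + (\<Sum>M<n. p (Suc M) z - p M z) = p n z" for n z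
    using sum_lessThan_telescope[of "\<lambda>M. p M z" n] by (simp add: p0)
  ultimately have lim: "uniform_limit X p P sequentially" by (simp add: eta_contract_eq)
  have "rational_limit X (p M)" for M
    unfolding p_def[abs_def] by (intro rational_limit_prod u X)
  with lim have "rational_limit X P" by (rule rational_limit_uniform_limit)
  moreover have ptw: "(\<lambda>n. p n z) \<longlonglongrightarrow> P z" if "z \<in> X" for z
    using tendsto_uniform_limitI[OF lim that] .
  moreover have "norm (P z) \<le> 2 * B 0" if "z \<in> X" for z
    using LIMSEQ_le_const2[OF tendsto_norm[OF ptw[OF that]]] pb2[OF that] by blast
  moreover have "P z = 0" if z: "z \<in> X" "\<And>m. \<tau> m \<le> \<rho> z" for z
  proof -
    have "norm (p (Suc n) z) \<le> (1/2) ^ n" for n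
    proof -
      have "norm (p (Suc n) z) \<le> \<delta> n" using past[OF z(1), of "Suc n"] z(2) by simp
      then show ?thesis using \<delta>2[of n] zero_le_power[of "1/2::real" n] by linarith
    qed
    then have "(\<lambda>n. p (Suc n) z) \<longlonglongrightarrow> 0"
      by (intro Lim_null_comparison[OF _ LIMSEQ_realpow_zero[of "1/2"]] always_eventually) auto
    then show ?thesis using LIMSEQ_Suc[OF ptw[OF z(1)]] LIMSEQ_unique by blast
  qed
  moreover have "norm (1 - P z) \<le> \<eta>" if z: "z \<in> X" "\<rho> z \<le> \<tau> 0" for z
  proof (rule LIMSEQ_le_const2)
    show "(\<lambda>n. norm (1 - p n z)) \<longlonglongrightarrow> norm (1 - P z)" by (intro tendsto_intros ptw z)
    show "\<exists>N. \<forall>n\<ge>N. norm (1 - p n z) \<le> \<eta>" using near1[OF z] \<sigma>(2) order_trans by blast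
  qed
  ultimately show ?thesis by blast
qed

text \<open>Two products with zones accumulating at opposite boundaries of the annulus:
  \<open>P\<close> vanishes outside and is near 1 for \<open>dist z a \<le> s\<close>,
  \<open>Q\<close> vanishes inside and is near 1 for \<open>dist z a \<ge> s\<close>. Hence
  \<open>(1 - P) * (1 - Q)\<close> is small everywhere, \<open>S = P + Q - P * Q\<close> has no
  zeros, and \<open>P / S\<close> takes the exact values 1 where \<open>Q = 0\<close> and 0 where
  \<open>P = 0\<close>.\<close>

lemma annular_cutoff:
  fixes a :: complex
  assumes w: "0 < w" "w < s" and \<epsilon>: "\<epsilon> > 0"
  shows "\<exists>D. countable D \<and> (\<forall>d\<in>D. 0 < snd d \<and> \<bar>dist (fst d) a - s\<bar> + 3 * snd d \<le> w) \<and> sums_bounded snd D \<epsilon> \<and>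
    (\<exists>h M. rational_limit (cball 0 1 - (\<Union>d\<in>D. ball (fst d) (snd d))) h \<and>
      (\<forall>z\<in>cball 0 1 - (\<Union>d\<in>D. ball (fst d) (snd d)). norm (h z) \<le> M \<and>
        (dist z a \<le> s - w \<longrightarrow> h z = 1) \<and> (s + w \<le> dist z a \<longrightarrow> h z = 0)))"
proof -
  \<comment> \<open>Taken twice, for \<open>P\<close> and \<open>Q\<close>, these sum to
    \<open>min \<epsilon> w\<close>. Since \<open>4 * e m \<le> w * (1/2) ^ m\<close>, a disc
    enlarged three times stays in the annulus around the radii \<open>tP m\<close> and
    \<open>tQ m\<close>, which are chosen between consecutive zone boundaries.\<close>
  define e where "e m = min \<epsilon> w * (1/2) ^ (m + 2)" for m :: nat
  define tP where "tP m = s + w * (1 - 3/4 * (1/2) ^ m)" for m :: nat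
  define \<tau>P where "\<tau>P m = s + w * (1 - (1/2) ^ m)" for m :: nat
  define tQ where "tQ m = s - w * (1 - 3/4 * (1/2) ^ m)" for m :: nat
  define \<tau>Q where "\<tau>Q m = s - w * (1 - (1/2) ^ m)" for m :: nat
  have h: "0 < (1/2::real) ^ m" "(1/2::real) ^ m \<le> 1" for m by (auto intro: power_le_one)
  have wh: "0 < w * (1/2) ^ m" "w * (1/2) ^ m \<le> w" for m
    using w h by (auto intro!: mult_left_le)
  have e: "e m > 0" "4 * e m \<le> w * (1/2) ^ m" for m
  proof -
    show "e m > 0" using w \<epsilon> by (simp add: e_def)
    have "min \<epsilon> w * (1/2) ^ m \<le> w * (1/2) ^ m" using h[of m] by (intro mult_right_mono) auto
    then show "4 * e m \<le> w * (1/2) ^ m" by (simp add: e_def)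
  qed
  have \<tau>P: "0 < \<tau>P m" "\<tau>P m < tP m" "tP m < \<tau>P (Suc m)" "0 < tP m" "tP m \<le> 2 * s" for m
    using w wh[of m] by (auto simp: \<tau>P_def tP_def algebra_simps)
  have \<tau>Q: "0 < \<tau>Q (Suc m)" "\<tau>Q (Suc m) < tQ m" "tQ m < \<tau>Q m" "0 < tQ m" "tQ m \<le> 2 * s" for m
    using w wh[of m] by (auto simp: \<tau>Q_def tQ_def algebra_simps)
  \<comment> \<open>All circles have radius at most \<open>2 * s\<close>; the summand 1 allows for
    the factors \<open>1 - root_factor\<close> in the second product.\<close>
  define B where "B m = max 4 (4 * (2 * s) / e m) + 1" for m
  have B: "B m \<ge> 1" for m by (simp add: B_def)
  \<comment> \<open>One of \<open>1 - P\<close> and \<open>1 - Q\<close> is at most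
    \<open>\<eta>\<close> and the other at most \<open>1 + 2 * B 0\<close>; the product of these
    bounds is 1/2.\<close>
  define \<eta> where "\<eta> = 1 / (4 * B 0 + 2)"
  have \<eta>: "0 < \<eta>" "\<eta> \<le> 1" "\<eta> * (1 + 2 * B 0) = 1/2" using B[of 0] by (auto simp: \<eta>_def field_simps)
  define \<delta> where "\<delta> m = \<eta> * (1/2) ^ (m + 2) / (B (Suc m) + 1)" for m
  have \<delta>: "\<delta> m > 0" "\<delta> m * (B (Suc m) + 1) \<le> \<eta> * (1/2) ^ (m + 2)" for m
  proof -
    have ne: "B (Suc m) + 1 \<noteq> 0" and p: "B (Suc m) + 1 > 0" using B[of "Suc m"] by linarith+
    show "\<delta> m > 0" using p \<eta>(1) by (simp add: \<delta>_def)
    show "\<delta> m * (B (Suc m) + 1) \<le> \<eta> * (1/2) ^ (m + 2)"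
      by (simp only: \<delta>_def times_divide_eq_left nonzero_mult_div_cancel_right[OF ne])
  qed
  \<comment> \<open>The exponents are chosen last; \<open>B\<close> and thus \<open>\<delta>\<close>
    are independent of them.\<close>
  have "\<forall>m. \<exists>N\<ge>1. (\<forall>z. dist z a \<le> \<tau>P m \<longrightarrow> norm (1 - root_factor a (tP m) N z) \<le> \<delta> m) \<and>
    (\<forall>z. dist z a \<ge> \<tau>P (Suc m) \<longrightarrow> norm (root_factor a (tP m) N z) \<le> \<delta> m)"
    using root_factor_approx \<tau>P \<delta>(1) by blast
  then obtain NP where NP: "\<And>m. NP m \<ge> 1"
    "\<And>m z. dist z a \<le> \<tau>P m \<Longrightarrow> norm (1 - root_factor a (tP m) (NP m) z) \<le> \<delta> m"
    "\<And>m z. dist z a \<ge> \<tau>P (Suc m) \<Longrightarrow> norm (root_factor a (tP m) (NP m) z) \<le> \<delta> m" by metis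
  have "\<forall>m. \<exists>N\<ge>1. (\<forall>z. dist z a \<le> \<tau>Q (Suc m) \<longrightarrow> norm (1 - root_factor a (tQ m) N z) \<le> \<delta> m) \<and>
    (\<forall>z. dist z a \<ge> \<tau>Q m \<longrightarrow> norm (root_factor a (tQ m) N z) \<le> \<delta> m)"
    using root_factor_approx \<tau>Q \<delta>(1) by blast
  then obtain NQ where NQ: "\<And>m. NQ m \<ge> 1"
    "\<And>m z. dist z a \<le> \<tau>Q (Suc m) \<Longrightarrow> norm (1 - root_factor a (tQ m) (NQ m) z) \<le> \<delta> m"
    "\<And>m z. dist z a \<ge> \<tau>Q m \<Longrightarrow> norm (root_factor a (tQ m) (NQ m) z) \<le> \<delta> m" by metis
  define DP where "DP m = root_discs a (tP m) (NP m) (e m)" for m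
  define DQ where "DQ m = root_discs a (tQ m) (NQ m) (e m)" for m
  define D where "D = (\<Union>m. DP m \<union> DQ m)"
  define X where "X = cball 0 1 - (\<Union>d\<in>D. ball (fst d) (snd d))"
  have X: "compact X" unfolding X_def by (intro compact_diff open_UN) auto
  have rP: "finite (DP m)" "d \<in> DP m \<Longrightarrow> snd d = e m / NP m \<and> dist (fst d) a = tP m"
    "sums_bounded snd (DP m) (e m)" for m d
    unfolding DP_def using root_discs_props[OF NP(1)[of m] \<tau>P(4)[of m] e(1)[of m]] by blast+
  have rQ: "finite (DQ m)" "d \<in> DQ m \<Longrightarrow> snd d = e m / NQ m \<and> dist (fst d) a = tQ m"
    "sums_bounded snd (DQ m) (e m)" for m d
    unfolding DQ_def using root_discs_props[OF NQ(1)[of m] \<tau>Q(4)[of m] e(1)[of m]] by blast+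
  have en: "e m / NP m \<le> e m" "e m / NQ m \<le> e m" for m
    using e(1)[of m] NP(1)[of m] NQ(1)[of m] frac_le[of "e m" "e m" 1] by auto
  have D_props: "0 < snd d \<and> \<bar>dist (fst d) a - s\<bar> + 3 * snd d \<le> w" if dD: "d \<in> D" for d
  proof -
    obtain m where "d \<in> DP m \<or> d \<in> DQ m" using dD by (auto simp: D_def)
    then show ?thesis
    proof
      assume "d \<in> DP m"
      then have "snd d = e m / NP m" "dist (fst d) a = tP m" using rP(2) by auto
      moreover have "e m / NP m > 0" using e(1)[of m] NP(1)[of m] by simp
      ultimately have "0 < snd d" "snd d \<le> e m" "dist (fst d) a = tP m" using en(1)[of m] by simp_all
      then show ?thesis using e(2)[of m] wh[of m] by (simp add: tP_def algebra_simps)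
    next
      assume "d \<in> DQ m"
      then have "snd d = e m / NQ m" "dist (fst d) a = tQ m" using rQ(2) by auto
      moreover have "e m / NQ m > 0" using e(1)[of m] NQ(1)[of m] by simp
      ultimately have "0 < snd d" "snd d \<le> e m" "dist (fst d) a = tQ m" using en(2)[of m] by simp_all
      then show ?thesis using e(2)[of m] wh[of m] by (simp add: tQ_def algebra_simps)
    qed
  qed
  have cnt: "countable D" unfolding D_def
    by (intro countable_UN countable_Un countable_finite[OF rP(1)] countable_finite[OF rQ(1)]) simp
  have "sums_bounded snd D \<epsilon>"
    unfolding D_def
  proof (rule sums_bounded_UN)
    show "0 \<le> snd d" if "d \<in> DP i \<union> DQ i" for i d using D_props[of d] that by (force simp: D_def)
    then show "sums_bounded snd (DP i \<union> DQ i) (e i + e i)" for i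
      using rP(3) rQ(3) by (intro sums_bounded_Un) auto
    have "(\<lambda>i. min \<epsilon> w / 2 * (1/2) ^ i) sums (min \<epsilon> w / 2 * (1 / (1 - 1/2)))"
      by (intro sums_mult geometric_sums) simp
    moreover have eq: "(\<lambda>i. e i + e i) = (\<lambda>i. min \<epsilon> w / 2 * (1/2) ^ i)" by (simp add: e_def fun_eq_iff)
    ultimately have s: "(\<lambda>i. e i + e i) sums min \<epsilon> w" unfolding eq by simp
    then show "summable (\<lambda>i. e i + e i)" "suminf (\<lambda>i. e i + e i) \<le> \<epsilon>" by (auto simp: sums_iff)
  qed
  have offP: "z \<notin> ball (fst d) (snd d)" if "d \<in> root_discs a (tP m) (NP m) (e m)" "z \<in> X" for d z m
    using that by (auto simp: X_def D_def DP_def)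
  have offQ: "z \<notin> ball (fst d) (snd d)" if "d \<in> root_discs a (tQ m) (NQ m) (e m)" "z \<in> X" for d z m
    using that by (auto simp: X_def D_def DQ_def)
  have tB: "max 4 (4 * t / e m) + 1 \<le> B m" if "t \<le> 2 * s" for t m
    unfolding B_def using that e(1)[of m] by (intro add_right_mono max.mono divide_right_mono) auto
  have "\<exists>P. rational_limit X P \<and> (\<forall>z\<in>X. norm (P z) \<le> 2 * B 0) \<and>
    (\<forall>z\<in>X. (\<forall>m. \<tau>P m \<le> dist z a) \<longrightarrow> P z = 0) \<and> (\<forall>z\<in>X. dist z a \<le> \<tau>P 0 \<longrightarrow> norm (1 - P z) \<le> \<eta>)"
  proof (rule zone_product[where u = "\<lambda>m. root_factor a (tP m) (NP m)" and \<delta> = \<delta>])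
    show "rational_limit X (root_factor a (tP m) (NP m))" for m
      by (rule rational_limit_root_factor[OF NP(1) \<tau>P(4) e(1)]) (rule offP)
    show "norm (root_factor a (tP m) (NP m) z) \<le> B m" if "z \<in> X" for m z
    proof -
      have "norm (root_factor a (tP m) (NP m) z) \<le> max 4 (4 * tP m / e m)"
        by (rule root_factor_off_discs(2)[OF NP(1) \<tau>P(4) e(1)]) (rule offP[OF _ that])
      then show ?thesis using tB[OF \<tau>P(5), of m m] by simp
    qed
    show "\<tau>P m \<le> \<tau>P (Suc m)" for m using \<tau>P[of m] by simp
  qed (use X B NP \<delta> \<eta> in \<open>auto simp: less_imp_le\<close>)
  then obtain P where P: "rational_limit X P" "\<And>z. z \<in> X \<Longrightarrow> norm (P z) \<le> 2 * B 0"
    "\<And>z. z \<in> X \<Longrightarrow> (\<And>m. \<tau>P m \<le> dist z a) \<Longrightarrow> P z = 0"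
    "\<And>z. z \<in> X \<Longrightarrow> dist z a \<le> \<tau>P 0 \<Longrightarrow> norm (1 - P z) \<le> \<eta>" by metis
  \<comment> \<open>The zones now move inwards, so the product is taken with respect to
    \<open>- dist z a\<close>, along which the thresholds increase.\<close>
  have "\<exists>P. rational_limit X P \<and> (\<forall>z\<in>X. norm (P z) \<le> 2 * B 0) \<and>
    (\<forall>z\<in>X. (\<forall>m. - \<tau>Q m \<le> - dist z a) \<longrightarrow> P z = 0) \<and> (\<forall>z\<in>X. - dist z a \<le> - \<tau>Q 0 \<longrightarrow> norm (1 - P z) \<le> \<eta>)"
  proof (rule zone_product[where u = "\<lambda>m z. 1 - root_factor a (tQ m) (NQ m) z" and \<delta> = \<delta>])
    show "rational_limit X (\<lambda>z. 1 - root_factor a (tQ m) (NQ m) z)" for m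
      by (intro rational_limit_diff rational_limit_const rational_limit_root_factor[OF NQ(1) \<tau>Q(4) e(1)]) (rule offQ)
    show "norm (1 - root_factor a (tQ m) (NQ m) z) \<le> B m" if "z \<in> X" for m z
    proof -
      have "norm (root_factor a (tQ m) (NQ m) z) \<le> max 4 (4 * tQ m / e m)"
        by (rule root_factor_off_discs(2)[OF NQ(1) \<tau>Q(4) e(1)]) (rule offQ[OF _ that])
      then show ?thesis using tB[OF \<tau>Q(5), of m m] norm_triangle_ineq4[of 1 "root_factor a (tQ m) (NQ m) z"] by simp
    qed
    show "- \<tau>Q m \<le> - \<tau>Q (Suc m)" for m using \<tau>Q[of m] by simp
  qed (use X B NQ \<delta> \<eta> in \<open>auto simp: less_imp_le\<close>)
  then obtain Q where Q: "rational_limit X Q" "\<And>z. z \<in> X \<Longrightarrow> norm (Q z) \<le> 2 * B 0"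
    "\<And>z. z \<in> X \<Longrightarrow> (\<And>m. dist z a \<le> \<tau>Q m) \<Longrightarrow> Q z = 0"
    "\<And>z. z \<in> X \<Longrightarrow> \<tau>Q 0 \<le> dist z a \<Longrightarrow> norm (1 - Q z) \<le> \<eta>" by (metis neg_le_iff_le)
  have \<tau>0: "\<tau>P 0 = s" "\<tau>Q 0 = s" by (simp_all add: \<tau>P_def \<tau>Q_def)
  have prod: "norm ((1 - P z) * (1 - Q z)) \<le> 1/2" if z: "z \<in> X" for z
  proof -
    have "norm (1 - P z) \<le> 1 + 2 * B 0" "norm (1 - Q z) \<le> 1 + 2 * B 0"
      using P(2)[OF z] Q(2)[OF z] norm_triangle_ineq4[of 1 "P z"] norm_triangle_ineq4[of 1 "Q z"] by auto
    moreover have "norm (1 - P z) \<le> \<eta> \<or> norm (1 - Q z) \<le> \<eta>"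
      using P(4)[OF z] Q(4)[OF z] unfolding \<tau>0 by linarith
    ultimately have "norm (1 - P z) * norm (1 - Q z) \<le> \<eta> * (1 + 2 * B 0)"
      using \<eta>(1) B[of 0] mult_mono[of "norm (1 - P z)" \<eta> "norm (1 - Q z)" "1 + 2 * B 0"]
        mult_mono[of "norm (1 - P z)" "1 + 2 * B 0" "norm (1 - Q z)" \<eta>] by (auto simp: mult.commute)
    then show ?thesis unfolding \<eta>(3) by (simp add: norm_mult)
  qed
  define S where "S z = P z + Q z - P z * Q z" for z
  have S: "norm (S z) \<ge> 1/2" if "z \<in> X" for z
  proof -
    have "S z = 1 - (1 - P z) * (1 - Q z)" by (simp add: S_def algebra_simps)
    then show ?thesis using prod[OF that] norm_triangle_ineq2[of 1 "(1 - P z) * (1 - Q z)"] by simp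
  qed
  then have S0: "S z \<noteq> 0" if "z \<in> X" for z using that by fastforce
  have rS: "rational_limit X S" unfolding S_def[abs_def]
    by (intro rational_limit_diff rational_limit_add rational_limit_mult P Q X)
  have "rational_limit X (\<lambda>z. P z / S z)" by (intro rational_limit_divide P rS X S0)
  moreover have "norm (P z / S z) \<le> 2 * B 0 / (1/2)" if "z \<in> X" for z
    unfolding norm_divide using P(2)[OF that] S[OF that] B[of 0] by (intro frac_le) auto
  moreover have "P z / S z = 1" if z: "z \<in> X" "dist z a \<le> s - w" for z
  proof -
    have "Q z = 0"
    proof (rule Q(3)[OF z(1)])
      show "dist z a \<le> \<tau>Q m" for m using z(2) wh[of m] by (simp add: \<tau>Q_def algebra_simps)
    qed
    then show ?thesis using S0[OF z(1)] by (simp add: S_def)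
  qed
  moreover have "P z / S z = 0" if z: "z \<in> X" "s + w \<le> dist z a" for z
  proof -
    have "P z = 0"
    proof (rule P(3)[OF z(1)])
      show "\<tau>P m \<le> dist z a" for m using z(2) wh[of m] by (simp add: \<tau>P_def algebra_simps)
    qed
    then show ?thesis by simp
  qed
  ultimately have "\<exists>h M. rational_limit X h \<and> (\<forall>z\<in>X. norm (h z) \<le> M \<and>
        (dist z a \<le> s - w \<longrightarrow> h z = 1) \<and> (s + w \<le> dist z a \<longrightarrow> h z = 0))" by blast
  then show ?thesis using cnt D_props \<open>sums_bounded snd D \<epsilon>\<close> unfolding X_def by blast
qed

section \<open>Logarithmic cutoffs with poles on a grid\<close>

text \<open>Linear in \<open>ln A\<close> between \<open>s\<close> and \<open>\<eta>\<close>: the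
  profile for which \<open>A\<close> times the slope is constant, namely the reciprocal of
  \<open>ln \<eta> - ln s\<close> up to sign. A profile linear in \<open>A\<close> would not gain
  this factor.\<close>

definition log_cutoff :: "real \<Rightarrow> real \<Rightarrow> real \<Rightarrow> real" where
  "log_cutoff s \<eta> A = (ln \<eta> - ln (max s (min \<eta> A))) / (ln \<eta> - ln s)"

lemma log_cutoff_bounds:
  assumes "0 < s" "s < \<eta>"
  shows "0 \<le> log_cutoff s \<eta> A" "log_cutoff s \<eta> A \<le> 1"
    "A \<le> s \<Longrightarrow> log_cutoff s \<eta> A = 1" "\<eta> \<le> A \<Longrightarrow> log_cutoff s \<eta> A = 0"
proof -
  have T: "ln \<eta> - ln s > 0" using assms by simp
  have m: "s \<le> max s (min \<eta> A)" "max s (min \<eta> A) \<le> \<eta>" using assms by auto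
  then have "ln s \<le> ln (max s (min \<eta> A))" "ln (max s (min \<eta> A)) \<le> ln \<eta>" using assms by (auto intro!: ln_mono)
  then show "0 \<le> log_cutoff s \<eta> A" "log_cutoff s \<eta> A \<le> 1" using T by (auto simp: log_cutoff_def)
  show "A \<le> s \<Longrightarrow> log_cutoff s \<eta> A = 1" "\<eta> \<le> A \<Longrightarrow> log_cutoff s \<eta> A = 0"
    using assms T by (auto simp: log_cutoff_def max_def min_def)
qed

text \<open>The slope of \<open>ln\<close> compensates the factor \<open>A\<close>. The truncated
  argument is at least \<open>s\<close>, so a step of at most \<open>s\<close> can halve it at
  worst, whence the 2.\<close>

lemma log_cutoff_lipschitz:
  assumes s: "0 < s" "s < \<eta>" and A: "0 \<le> A" "\<bar>A - B\<bar> \<le> s"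
  shows "A * \<bar>log_cutoff s \<eta> A - log_cutoff s \<eta> B\<bar> \<le> 2 * \<bar>A - B\<bar> / (ln \<eta> - ln s)"
proof -
  define \<mu> where "\<mu> A = max s (min \<eta> A)" for A
  have T: "ln \<eta> - ln s > 0" using s by simp
  have \<mu>: "s \<le> \<mu> C" "\<mu> C > 0" for C using s by (auto simp: \<mu>_def)
  have lnd: "ln (\<mu> C) - ln (\<mu> E) \<le> (\<mu> C - \<mu> E) / \<mu> E" for C E
  proof -
    have "ln (\<mu> C / \<mu> E) \<le> \<mu> C / \<mu> E - 1" using \<mu>(2) by (intro ln_le_minus_one divide_pos_pos)
    moreover have "ln (\<mu> C / \<mu> E) = ln (\<mu> C) - ln (\<mu> E)" by (rule ln_divide_pos[OF \<mu>(2) \<mu>(2)])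
    ultimately show ?thesis using \<mu>(2)[of E] by (simp add: diff_divide_distrib)
  qed
  have key: "A * \<bar>ln (\<mu> A) - ln (\<mu> B)\<bar> \<le> 2 * \<bar>A - B\<bar>"
  proof (cases "A \<ge> \<eta> \<and> B \<ge> \<eta>")
    case True
    then show ?thesis by (simp add: \<mu>_def)
  next
    case False
    show ?thesis
    proof (cases "A \<le> B")
      case True
      with False have "A \<le> \<mu> A" "\<mu> A \<le> \<mu> B" "\<mu> B - \<mu> A \<le> B - A" by (auto simp: \<mu>_def)
      have "\<bar>ln (\<mu> A) - ln (\<mu> B)\<bar> = ln (\<mu> B) - ln (\<mu> A)" using \<open>\<mu> A \<le> \<mu> B\<close> \<mu> ln_mono by (simp add: abs_if)
      also have "\<dots> \<le> (\<mu> B - \<mu> A) / \<mu> A" by (rule lnd)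
      also have "\<dots> \<le> (B - A) / \<mu> A" using \<open>\<mu> B - \<mu> A \<le> B - A\<close> \<mu> by (intro divide_right_mono) (auto intro: less_imp_le)
      finally have "A * \<bar>ln (\<mu> A) - ln (\<mu> B)\<bar> \<le> \<mu> A * ((B - A) / \<mu> A)"
        using A \<open>A \<le> \<mu> A\<close> by (intro mult_mono) (auto intro: less_imp_le[OF \<mu>(2)])
      also have "\<dots> = B - A" using \<mu>(2)[of A] by simp
      finally show ?thesis using True by simp
    next
      case AB: False
      with False have "B \<le> \<mu> B" "\<mu> B \<le> \<mu> A" "\<mu> A - \<mu> B \<le> A - B" by (auto simp: \<mu>_def)
      then have A2: "A \<le> 2 * \<mu> B" using A(2) \<mu>(1)[of B] by linarith
      have "\<bar>ln (\<mu> A) - ln (\<mu> B)\<bar> = ln (\<mu> A) - ln (\<mu> B)" using \<open>\<mu> B \<le> \<mu> A\<close> \<mu> ln_mono by (simp add: abs_if)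
      also have "\<dots> \<le> (\<mu> A - \<mu> B) / \<mu> B" by (rule lnd)
      also have "\<dots> \<le> (A - B) / \<mu> B" using \<open>\<mu> A - \<mu> B \<le> A - B\<close> \<mu> by (intro divide_right_mono) (auto intro: less_imp_le)
      finally have "A * \<bar>ln (\<mu> A) - ln (\<mu> B)\<bar> \<le> (2 * \<mu> B) * ((A - B) / \<mu> B)"
        using A A2 by (intro mult_mono) (auto intro: less_imp_le[OF \<mu>(2)])
      also have "\<dots> = 2 * (A - B)" using \<mu>(2)[of B] by simp
      finally show ?thesis using AB by simp
    qed
  qed
  have "log_cutoff s \<eta> A - log_cutoff s \<eta> B = (ln (\<mu> B) - ln (\<mu> A)) / (ln \<eta> - ln s)"
    by (simp add: log_cutoff_def \<mu>_def diff_divide_distrib[symmetric])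
  then have "A * \<bar>log_cutoff s \<eta> A - log_cutoff s \<eta> B\<bar> = (A * \<bar>ln (\<mu> A) - ln (\<mu> B)\<bar>) / (ln \<eta> - ln s)"
    using T by (simp add: abs_minus_commute)
  also have "\<dots> \<le> 2 * \<bar>A - B\<bar> / (ln \<eta> - ln s)" using key T by (intro divide_right_mono) auto
  finally show ?thesis .
qed

text \<open>The index 0 contributes 1; the others form the harmonic sum, compared with
  \<open>ln\<close> through \<open>ln x \<le> x - 1\<close>.\<close>

lemma sum_inverse_le:
  assumes "n \<ge> 1"
  shows "(\<Sum>k<n. 1 / max 1 (real k)) \<le> 2 + ln (real n)"
proof -
  have "(\<Sum>k<Suc n. 1 / max 1 (real k)) \<le> 2 + ln (real n)"
    using assms
  proof (induction n rule: dec_induct)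
    case (step n)
    have n: "real n > 0" using step by simp
    have "ln (real n / real (Suc n)) \<le> real n / real (Suc n) - 1" using n by (intro ln_le_minus_one) simp
    moreover have "ln (real n / real (Suc n)) = ln (real n) - ln (real (Suc n))" using n by (intro ln_divide_pos) auto
    moreover have "real n / real (Suc n) - 1 = - (1 / max 1 (real (Suc n)))" by (simp add: field_simps)
    ultimately have "1 / max 1 (real (Suc n)) \<le> ln (real (Suc n)) - ln (real n)" by linarith
    then show ?case using step.IH unfolding sum.lessThan_Suc[of _ "Suc n"] by linarith
  qed simp
  moreover have "(\<Sum>k<n. 1 / max 1 (real k)) \<le> (\<Sum>k<Suc n. 1 / max 1 (real k))" by simp
  ultimately show ?thesis by linarith
qed

lemma sum_inverse_dist_le:
  assumes "i0 < n"
  shows "(\<Sum>i<n. 1 / max 1 \<bar>real i - real i0\<bar>) \<le> 2 * (\<Sum>k<n. 1 / max 1 (real k))"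
proof -
  define f where "f k = 1 / max 1 (real k)" for k
  have f0: "f k \<ge> 0" for k by (simp add: f_def)
  have dec: "f (Suc k) \<le> f k" for k unfolding f_def by (intro divide_left_mono) auto
  have "(\<Sum>i<n. 1 / max 1 \<bar>real i - real i0\<bar>) = (\<Sum>i<i0. 1 / max 1 \<bar>real i - real i0\<bar>) + (\<Sum>i=i0..<n. 1 / max 1 \<bar>real i - real i0\<bar>)"
    using assms by (simp add: sum.atLeastLessThan_concat[of 0 i0 n, symmetric] lessThan_atLeast0)
  also have "(\<Sum>i<i0. 1 / max 1 \<bar>real i - real i0\<bar>) = (\<Sum>i<i0. f (Suc (i0 - Suc i)))"
    by (intro sum.cong) (auto simp: f_def of_nat_diff)
  also have "\<dots> = (\<Sum>i<i0. f (Suc i))" by (rule sum.nat_diff_reindex)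
  also have "\<dots> \<le> (\<Sum>i<i0. f i)" by (intro sum_mono dec)
  also have "\<dots> \<le> (\<Sum>i<n. f i)" using assms f0 by (intro sum_mono2) auto
  also have "(\<Sum>i=i0..<n. 1 / max 1 \<bar>real i - real i0\<bar>) = (\<Sum>i=i0..<n. f (i - i0))"
    by (intro sum.cong) (auto simp: f_def of_nat_diff)
  also have "\<dots> = (\<Sum>i<n - i0. f i)"
    using assms sum.shift_bounds_nat_ivl[of "\<lambda>i. f (i - i0)" 0 i0 "n - i0"] by (simp add: lessThan_atLeast0)
  also have "\<dots> \<le> (\<Sum>i<n. f i)" using f0 by (intro sum_mono2) auto
  finally show ?thesis by (simp add: f_def)
qed

text \<open>Bounding \<open>u\<^sup>2 + v\<^sup>2\<close> below by a multiple of a product separates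
  the double sum into two harmonic sums. The resulting squared logarithm is harmless, since the sum
  is used with a further factor \<open>l\<close>.\<close>

lemma lattice_sum_le:
  assumes l: "l > 0" and n: "n \<ge> 1" and z: "0 \<le> Re (z - a)" "Re (z - a) < n * l" "0 \<le> Im (z - a)" "Im (z - a) < n * l"
  shows "(\<Sum>p | p \<in> {..<n} \<times> {..<n} \<and> 5 * l \<le> dist (grid_point a l (fst p) (snd p)) z.
      l\<^sup>2 / (dist (grid_point a l (fst p) (snd p)) z)\<^sup>2) \<le> 16 * (2 + ln (real n))\<^sup>2"
proof -
  define x y where "x = Re (z - a) / l" and "y = Im (z - a) / l"
  define i0 j0 where "i0 = nat \<lfloor>x\<rfloor>" and "j0 = nat \<lfloor>y\<rfloor>"
  have xy: "0 \<le> x" "x < n" "0 \<le> y" "y < n" using l z by (auto simp: x_def y_def field_simps)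
  have ij: "real i0 \<le> x" "x < real i0 + 1" "real j0 \<le> y" "y < real j0 + 1" using xy unfolding i0_def j0_def by linarith+
  have lt: "i0 < n" "j0 < n" using ij xy by linarith+
  define P where "P i = max 1 \<bar>real i - real i0\<bar>" for i
  define R where "R j = max 1 \<bar>real j - real j0\<bar>" for j
  have PR: "P i \<ge> 1" "R i \<ge> 1" for i by (auto simp: P_def R_def)
  have bnd: "l\<^sup>2 / (dist (grid_point a l i j) z)\<^sup>2 \<le> 4 * (1 / P i) * (1 / R j)"
    if far: "5 * l \<le> dist (grid_point a l i j) z" for i j
  proof -
    define u v where "u = real i - x" and "v = real j - y"
    have c: "Re (grid_point a l i j - z) = l * u" "Im (grid_point a l i j - z) = l * v"
      using l by (auto simp: grid_point_def u_def v_def x_def y_def field_simps)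
    have "(dist (grid_point a l i j) z)\<^sup>2 = (Re (grid_point a l i j - z))\<^sup>2 + (Im (grid_point a l i j - z))\<^sup>2"
      by (simp add: dist_norm cmod_def)
    then have D: "(dist (grid_point a l i j) z)\<^sup>2 = l\<^sup>2 * (u\<^sup>2 + v\<^sup>2)"
      unfolding c by (simp add: power_mult_distrib algebra_simps)
    have "(5 * l)\<^sup>2 \<le> (dist (grid_point a l i j) z)\<^sup>2" using far l by (intro power_mono) auto
    then have uv25: "u\<^sup>2 + v\<^sup>2 \<ge> 25" unfolding D using l by (simp add: power_mult_distrib)
    have ui: "\<bar>u\<bar> \<ge> \<bar>real i - real i0\<bar> - 1" "\<bar>v\<bar> \<ge> \<bar>real j - real j0\<bar> - 1" using ij unfolding u_def v_def by linarith+
    \<comment> \<open>If both offsets are small, the distance of at least 5 cells decides; otherwise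
      the square of the larger offset alone is enough.\<close>
    have "P i * R j / 4 \<le> u\<^sup>2 + v\<^sup>2"
    proof (cases "P i \<le> 2 \<and> R j \<le> 2")
      case True
      then have "P i * R j \<le> 2 * 2" using PR[of i] PR[of j] by (intro mult_mono) auto
      then show ?thesis using uv25 by simp
    next
      case False
      have sq: "w\<^sup>2 \<ge> (M / 2)\<^sup>2" if "\<bar>w\<bar> \<ge> M - 1" "M \<ge> 2" for w M :: real
        using that power_mono[of "M / 2" "\<bar>w\<bar>" 2] by simp
      show ?thesis
      proof (cases "P i \<ge> R j")
        case True
        then have "P i \<ge> 2" "\<bar>u\<bar> \<ge> P i - 1" using False ui by (auto simp: P_def)
        then have "(P i / 2)\<^sup>2 \<le> u\<^sup>2" using sq by blast
        moreover have "P i * R j \<le> P i * P i" using True PR[of i] by (intro mult_left_mono) auto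
        moreover have "(P i / 2)\<^sup>2 = P i * P i / 4" by (simp add: power2_eq_square)
        ultimately show ?thesis using zero_le_power2[of v] by linarith
      next
        case PR': False
        then have "R j \<ge> 2" "\<bar>v\<bar> \<ge> R j - 1" using False ui by (auto simp: R_def)
        then have "(R j / 2)\<^sup>2 \<le> v\<^sup>2" using sq by blast
        moreover have "P i * R j \<le> R j * R j" using PR' PR(2)[of j] by (intro mult_right_mono) auto
        moreover have "(R j / 2)\<^sup>2 = R j * R j / 4" by (simp add: power2_eq_square)
        ultimately show ?thesis using zero_le_power2[of u] by linarith
      qed
    qed
    moreover have "P i * R j > 0" using PR[of i] PR[of j] by (intro mult_pos_pos) linarith+
    ultimately have "1 / (u\<^sup>2 + v\<^sup>2) \<le> 1 / (P i * R j / 4)" by (intro divide_left_mono mult_pos_pos) auto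
    then show ?thesis unfolding D using l by simp
  qed
  have "(\<Sum>p | p \<in> {..<n} \<times> {..<n} \<and> 5 * l \<le> dist (grid_point a l (fst p) (snd p)) z.
      l\<^sup>2 / (dist (grid_point a l (fst p) (snd p)) z)\<^sup>2)
    \<le> (\<Sum>p | p \<in> {..<n} \<times> {..<n} \<and> 5 * l \<le> dist (grid_point a l (fst p) (snd p)) z. 4 * (1 / P (fst p)) * (1 / R (snd p)))"
    using bnd by (intro sum_mono) auto
  also have "\<dots> \<le> (\<Sum>p\<in>{..<n} \<times> {..<n}. 4 * (1 / P (fst p)) * (1 / R (snd p)))"
    using PR by (intro sum_mono2) (auto intro!: mult_nonneg_nonneg divide_nonneg_nonneg intro: order_trans[OF zero_le_one])
  also have "\<dots> = (\<Sum>i<n. \<Sum>j<n. 4 * (1 / P i) * (1 / R j))" by (simp add: sum.cartesian_product case_prod_unfold)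
  also have "\<dots> = 4 * (\<Sum>i<n. 1 / P i) * (\<Sum>j<n. 1 / R j)"
    by (simp only: mult.assoc sum_distrib_left[symmetric] sum_distrib_right[symmetric])
  also have "\<dots> \<le> 4 * (2 * (2 + ln (real n))) * (2 * (2 + ln (real n)))"
  proof -
    have S: "2 * (\<Sum>k<n. 1 / max 1 (real k)) \<le> 2 * (2 + ln (real n))" using sum_inverse_le[OF n] by simp
    have "(\<Sum>i<n. 1 / P i) \<le> 2 * (2 + ln (real n))" "(\<Sum>j<n. 1 / R j) \<le> 2 * (2 + ln (real n))"
      unfolding P_def R_def using sum_inverse_dist_le[OF lt(1)] sum_inverse_dist_le[OF lt(2)] S by linarith+
    moreover have "0 \<le> (\<Sum>i<n. 1 / P i)" "0 \<le> (\<Sum>j<n. 1 / R j)"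
      using PR by (auto intro!: sum_nonneg divide_nonneg_nonneg intro: order_trans[OF zero_le_one])
    ultimately show ?thesis by (intro mult_mono) auto
  qed
  also have "4 * (2 * L) * (2 * L) = 16 * L\<^sup>2" for L :: real by (simp add: power2_eq_square)
  finally show ?thesis .
qed

text \<open>This kernel is \<open>1 / (\<zeta> - z)\<close> off a small disc, but continuous, so that \<open>z\<close> may lie on a grid line.\<close>

definition truncated_kernel :: "real \<Rightarrow> complex \<Rightarrow> complex \<Rightarrow> complex" where
  "truncated_kernel l z \<zeta> = cnj (\<zeta> - z) / of_real ((max l (norm (\<zeta> - z)))\<^sup>2)"

lemma truncated_kernel_props:
  assumes "l > 0"
  shows "continuous_on A (truncated_kernel l z)"
    and "norm (\<zeta> - z) \<ge> l \<Longrightarrow> truncated_kernel l z \<zeta> = 1 / (\<zeta> - z)"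
    and "norm (\<zeta> - z) * norm (truncated_kernel l z \<zeta>) \<le> 1"
proof -
  have m: "max l x > 0" for x :: real using assms by simp
  show "continuous_on A (truncated_kernel l z)"
    unfolding truncated_kernel_def[abs_def] using m by (intro continuous_intros) (auto simp: less_imp_neq[symmetric])
  show "truncated_kernel l z \<zeta> = 1 / (\<zeta> - z)" if "norm (\<zeta> - z) \<ge> l"
  proof -
    have "\<zeta> - z \<noteq> 0" using that assms by auto
    moreover have "cnj (\<zeta> - z) * (\<zeta> - z) = of_real ((norm (\<zeta> - z))\<^sup>2)"
      by (simp only: complex_norm_square mult.commute)
    ultimately show ?thesis using that by (simp add: truncated_kernel_def max_def field_simps)
  qed
  have "norm (\<zeta> - z) * norm (truncated_kernel l z \<zeta>) = (norm (\<zeta> - z))\<^sup>2 / (max l (norm (\<zeta> - z)))\<^sup>2"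
    by (simp only: truncated_kernel_def norm_divide complex_mod_cnj norm_of_real abs_power2)
      (simp add: power2_eq_square)
  also have "\<dots> \<le> 1" using m[of "norm (\<zeta> - z)"] by (auto intro!: power_mono)
  finally show "norm (\<zeta> - z) * norm (truncated_kernel l z \<zeta>) \<le> 1" .
qed

text \<open>The same discs serve all points \<open>x\<close> and all scales between \<open>s\<close> and \<open>\<eta>\<close>. With a logarithmic cutoff \<open>ct\<close> the
  function \<open>\<phi> = (\<zeta> - x) ct\<close> has small integral over the boundary of each square of side \<open>l\<close>, namely \<open>O(l\<^sup>2 / T)\<close>
  with \<open>T = ln (\<eta> / s)\<close>. Concentrating these integrals at the corners of the squares approximates \<open>\<phi>\<close> by a rational
  function \<open>g\<close>, and discs of radius comparable to \<open>\<kappa> l\<^sup>2\<close> suffice to bound its poles.\<close>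

lemma log_grid:
  fixes \<kappa> \<eta> :: real
  assumes \<kappa>: "\<kappa> > 0" and \<eta>: "0 < \<eta>" "\<eta> \<le> 1/4"
  shows "\<exists>s>0. \<forall>\<epsilon>>0. \<exists>D. finite D \<and> (\<forall>d\<in>D. 0 < snd d) \<and> sums_bounded snd D \<kappa> \<and>
    (\<forall>x\<in>cball 0 1. \<exists>g.
      (\<forall>X. (\<forall>d\<in>D. dist (fst d) x \<le> 2 * \<eta> \<longrightarrow> X \<inter> ball (fst d) (snd d) = {}) \<longrightarrow> rational_limit X g) \<and>
      (\<forall>z\<in>cball 0 1. (\<forall>d\<in>D. dist (fst d) x \<le> 2 * \<eta> \<longrightarrow> z \<notin> ball (fst d) (snd d)) \<longrightarrow>
        norm (g z) \<le> 3 * \<eta> \<and> (dist z x < s \<longrightarrow> norm (g z - (z - x)) \<le> \<epsilon>)))"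
proof -
  \<comment> \<open>\<open>30976 = 121 * 256\<close>: at most \<open>11^2\<close> corners lie within
    \<open>5 * l\<close> of a point, and each contributes at most \<open>(16 * l\<^sup>2 / T) /
    (\<kappa> * l\<^sup>2 / 16) = 256 / (T * \<kappa>)\<close>. So these poles together contribute
    at most \<open>\<eta>\<close>.\<close>
  define T where "T = 30976 / (\<kappa> * \<eta>) + 1"
  have T: "T \<ge> 1" "30976 / (T * \<kappa>) \<le> \<eta>"
  proof -
    show T1: "T \<ge> 1" using \<kappa> \<eta> by (simp add: T_def)
    have "30976 / (\<kappa> * \<eta>) \<le> T" by (simp add: T_def)
    then show "30976 / (T * \<kappa>) \<le> \<eta>" using \<kappa> \<eta> T1 by (simp add: field_simps)
  qed
  \<comment> \<open>Determined by \<kappa> and \<eta> alone, before the accuracy \<epsilon> is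
    given.\<close>
  define s where "s = \<eta> * exp (- T)"
  have s: "0 < s" "s < \<eta>" "ln \<eta> - ln s = T" using \<eta> T by (auto simp: s_def ln_mult)
  have "\<exists>D. finite D \<and> (\<forall>d\<in>D. 0 < snd d) \<and> sums_bounded snd D \<kappa> \<and>
    (\<forall>x\<in>cball 0 1. \<exists>g.
      (\<forall>X. (\<forall>d\<in>D. dist (fst d) x \<le> 2 * \<eta> \<longrightarrow> X \<inter> ball (fst d) (snd d) = {}) \<longrightarrow> rational_limit X g) \<and>
      (\<forall>z\<in>cball 0 1. (\<forall>d\<in>D. dist (fst d) x \<le> 2 * \<eta> \<longrightarrow> z \<notin> ball (fst d) (snd d)) \<longrightarrow>
        norm (g z) \<le> 3 * \<eta> \<and> (dist z x < s/2 \<longrightarrow> norm (g z - (z - x)) \<le> \<epsilon>)))" if \<epsilon>: "\<epsilon> > 0" for \<epsilon>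
  proof -
    obtain m :: nat where m: "real m > 200000 / min \<epsilon> s" using reals_Archimedean2 by blast
    have m0: "real m > 200000 / \<epsilon>" "real m > 200000 / s" "m \<ge> 1"
    proof -
      have "min \<epsilon> s > 0" using \<epsilon> s by simp
      then have "200000 / \<epsilon> \<le> 200000 / min \<epsilon> s" "200000 / s \<le> 200000 / min \<epsilon> s" "0 < 200000 / min \<epsilon> s"
        using \<epsilon> s by (auto intro!: divide_left_mono mult_pos_pos)
      then show "real m > 200000 / \<epsilon>" "real m > 200000 / s" using m by linarith+
      have "real m > 0" using m \<open>0 < 200000 / min \<epsilon> s\<close> by linarith
      then show "m \<ge> 1" by simp
    qed
    \<comment> \<open>With a fourth power the crude bound \<open>ln m \<le> m\<close> suffices:
      \<open>l * (2 + ln n)^2\<close> is at most of order \<open>1 / m\<^sup>2\<close>.\<close>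
    define n where "n = m ^ 4"
    define l where "l = 4 / real n"
    have n: "n \<ge> 1" using m0(3) by (simp add: n_def)
    have l: "l > 0" "real n * l = 4" using n by (auto simp: l_def)
    have lm: "l \<le> 4 / real m"
    proof -
      have "real m \<le> real m ^ 4" using m0(3) by (simp add: self_le_power)
      then show ?thesis using m0(3) by (auto simp: l_def n_def intro!: divide_left_mono mult_pos_pos)
    qed
    have "200000 / real m < s" using m0(2,3) s by (simp add: field_simps)
    then have ls: "20 * l < s" 
    proof -
      have "20 * l \<le> 80 / real m" using lm by simp
      also have "\<dots> \<le> 200000 / real m" by (intro divide_right_mono) auto
      finally show ?thesis using \<open>200000 / real m < s\<close> by simp
    qed
    \<comment> \<open>The error apart from the near poles: \<open>1452 = 121 * 12\<close> from the
      near cells, the rest from the lattice sum over the far cells.\<close>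
    define \<sigma> where "\<sigma> = 1452 * l + 80 * l * (16 * (2 + ln (real n))\<^sup>2)"
    have \<sigma>: "\<sigma> \<le> \<epsilon>" "\<sigma> \<le> \<eta>"
    proof -
      have "ln (real n) = 4 * ln (real m)" by (simp add: n_def ln_realpow)
      also have "\<dots> \<le> 4 * real m" using ln_bound[of "real m"] m0(3) by simp
      finally have "2 + ln (real n) \<le> 6 * real m" using m0(3) by linarith
      moreover have "0 \<le> ln (real n)" using n by simp
      ultimately have "(2 + ln (real n))\<^sup>2 \<le> (6 * real m)\<^sup>2" by (intro power_mono) auto
      then have "80 * l * (16 * (2 + ln (real n))\<^sup>2) \<le> 80 * l * (16 * (6 * real m)\<^sup>2)" using l by (intro mult_left_mono) auto
      moreover have "80 * l * (16 * (6 * real m)\<^sup>2) = 46080 * (l * (real m)\<^sup>2)" by (simp add: power_mult_distrib)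
      moreover have lm2: "l * (real m)\<^sup>2 = 4 / (real m)\<^sup>2" using m0(3) by (simp add: l_def n_def power4_eq_xxxx power2_eq_square)
      moreover have "4 / (real m)\<^sup>2 \<le> 4 / real m"
        using m0(3) by (intro divide_left_mono) (auto simp: power2_eq_square)
      ultimately have "80 * l * (16 * (2 + ln (real n))\<^sup>2) \<le> 46080 * (4 / real m)" by linarith
      then have "\<sigma> \<le> 200000 / real m" unfolding \<sigma>_def using lm m0(3) by (simp add: field_simps)
      moreover have "200000 / real m < \<epsilon>" using m0(1,3) \<epsilon> by (simp add: field_simps)
      moreover note \<open>200000 / real m < s\<close> s(2)
      ultimately show "\<sigma> \<le> \<epsilon>" "\<sigma> \<le> \<eta>" by linarith+
    qed
    define a where "a = Complex (-2) (-2)"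
    define q where "q p = grid_point a l (fst p) (snd p)" for p
    \<comment> \<open>\<open>n * n\<close> equal discs share the total radius
      \<open>\<kappa>\<close>.\<close>
    define \<rho> where "\<rho> = \<kappa> / (real n)\<^sup>2"
    have \<rho>: "\<rho> > 0" "\<rho> = \<kappa> * l\<^sup>2 / 16" using \<kappa> n by (auto simp: \<rho>_def l_def power2_eq_square)
    let ?P = "{..<n} \<times> {..<n}"
    define D where "D = (\<lambda>p. (q p, \<rho>)) ` ?P"
    have D: "finite D" "\<forall>d\<in>D. 0 < snd d" using \<rho> by (auto simp: D_def)
    have "sums_bounded snd D \<kappa>"
    proof (rule sums_bounded_finite)
      have "card D \<le> n * n" unfolding D_def using card_image_le[of ?P] by (simp add: card_cartesian_product)
      have "sum snd D = real (card D) * \<rho>" by (subst sum.cong[of D D snd "\<lambda>_. \<rho>"]) (auto simp: D_def)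
      also have "\<dots> \<le> real (n * n) * \<rho>" using \<open>card D \<le> n * n\<close> \<rho> by (intro mult_right_mono of_nat_mono) auto
      finally show "sum snd D \<le> \<kappa>" using n by (simp add: \<rho>_def power2_eq_square)
    qed (use D in auto)
    moreover have "\<exists>g. (\<forall>X. (\<forall>d\<in>D. dist (fst d) x \<le> 2 * \<eta> \<longrightarrow> X \<inter> ball (fst d) (snd d) = {}) \<longrightarrow> rational_limit X g) \<and>
      (\<forall>z\<in>cball 0 1. (\<forall>d\<in>D. dist (fst d) x \<le> 2 * \<eta> \<longrightarrow> z \<notin> ball (fst d) (snd d)) \<longrightarrow>
        norm (g z) \<le> 3 * \<eta> \<and> (dist z x < s/2 \<longrightarrow> norm (g z - (z - x)) \<le> \<epsilon>))" if x: "x \<in> cball 0 1" for x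
    proof -

      \<comment> \<open>The function with logarithmic cutoff and its modulus of continuity\<close>
      define ct where "ct \<zeta> = log_cutoff s \<eta> (dist \<zeta> x)" for \<zeta>
      define \<phi> where "\<phi> \<zeta> = (\<zeta> - x) * of_real (ct \<zeta>)" for \<zeta>
      have ct_diff: "norm (\<zeta> - x) * \<bar>ct \<zeta> - ct w\<bar> \<le> 2 / T * dist \<zeta> w" if "dist \<zeta> w \<le> s" for \<zeta> w
      proof -
        have d: "\<bar>dist \<zeta> x - dist w x\<bar> \<le> dist \<zeta> w"
          using dist_triangle[of \<zeta> x w] dist_triangle[of w x \<zeta>] by (auto simp: dist_commute abs_le_iff)
        then have "dist \<zeta> x * \<bar>log_cutoff s \<eta> (dist \<zeta> x) - log_cutoff s \<eta> (dist w x)\<bar>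
            \<le> 2 * \<bar>dist \<zeta> x - dist w x\<bar> / (ln \<eta> - ln s)"
          using that by (intro log_cutoff_lipschitz s) auto
        also have "\<dots> \<le> 2 * dist \<zeta> w / T" unfolding s(3) using d T by (intro divide_right_mono mult_left_mono) auto
        finally show ?thesis by (simp add: ct_def dist_norm)
      qed
      have \<phi>_diff: "norm (\<phi> \<zeta> - \<phi> w) \<le> 3 * dist \<zeta> w" if "dist \<zeta> w \<le> s" for \<zeta> w
      proof -
        have "\<phi> \<zeta> - \<phi> w = (\<zeta> - w) * of_real (ct w) + (\<zeta> - x) * of_real (ct \<zeta> - ct w)"
          by (simp add: \<phi>_def algebra_simps)
        then have "norm (\<phi> \<zeta> - \<phi> w) \<le> norm (\<zeta> - w) * \<bar>ct w\<bar> + norm (\<zeta> - x) * \<bar>ct \<zeta> - ct w\<bar>"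
          by (metis norm_triangle_ineq norm_mult norm_of_real)
        also have "norm (\<zeta> - w) * \<bar>ct w\<bar> \<le> dist \<zeta> w * 1"
          using log_cutoff_bounds[OF s(1,2), of "dist w x"] by (intro mult_mono) (auto simp: ct_def dist_norm)
        also note ct_diff[OF that]
        also have "2 / T * dist \<zeta> w \<le> 2 * dist \<zeta> w" using T(1) by (intro mult_right_mono) (auto simp: divide_le_eq)
        finally show ?thesis by simp
      qed
      have \<phi>_out: "\<phi> \<zeta> = 0" if "dist \<zeta> x \<ge> \<eta>" for \<zeta>
        using log_cutoff_bounds(4)[OF s(1,2) that] by (simp add: \<phi>_def ct_def)
      have \<phi>_in: "\<phi> \<zeta> = \<zeta> - x" if "dist \<zeta> x \<le> s" for \<zeta>
        using log_cutoff_bounds(3)[OF s(1,2) that] by (simp add: \<phi>_def ct_def)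
      have \<phi>_le: "norm (\<phi> \<zeta>) \<le> \<eta>" for \<zeta>
      proof (cases "dist \<zeta> x \<ge> \<eta>")
        case False
        then have "norm (\<zeta> - x) * \<bar>ct \<zeta>\<bar> \<le> \<eta> * 1"
          using log_cutoff_bounds[OF s(1,2), of "dist \<zeta> x"] \<eta> by (intro mult_mono) (auto simp: ct_def dist_norm)
        then show ?thesis by (simp add: \<phi>_def norm_mult)
      qed (use \<phi>_out \<eta> in simp)
      have cont: "continuous_on A \<phi>" for A
      proof (rule continuous_on_subset[OF _ subset_UNIV], unfold continuous_on_iff, intro ballI allI impI)
        fix \<zeta> :: complex and e :: real assume e: "0 < e"
        have "dist (\<phi> w) (\<phi> \<zeta>) < e" if "dist w \<zeta> < min s (e/3)" for w
          using \<phi>_diff[of w \<zeta>] that by (auto simp: dist_norm)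
        then show "\<exists>d>0. \<forall>w\<in>UNIV. dist w \<zeta> < d \<longrightarrow> dist (\<phi> w) (\<phi> \<zeta>) < e"
          using e s by (intro exI[of _ "min s (e/3)"]) auto
      qed

      \<comment> \<open>The cell integrals and the rational function with poles at the
        corners\<close>
      define S where "S p = square_integral (q p) l \<phi>" for p
      define g where "g z = (\<Sum>p\<in>?P. S p / (2 * pi * \<i>) / (z - q p))" for z
      have edge: "square_edges (q p) l \<subseteq> square (q p) l" for p using square_edges_subset l by simp
      have corner: "q p \<in> square (q p) l" for p using l by (simp add: mem_square)
      \<comment> \<open>Subtracting the holomorphic function with the cutoff frozen at the corner
        leaves an integrand of size \<open>(2 / T) * (2 * l)\<close> on a path of length
        \<open>4 * l\<close>.\<close>
      have S_small: "norm (S p) \<le> 16 * l\<^sup>2 / T" for p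
      proof -
        have c1: "continuous_on A (\<lambda>\<zeta>. of_real (ct (q p)) * (\<zeta> - x))" for A by (intro continuous_intros)
        have "square_integral (q p) l (\<lambda>\<zeta>. of_real (ct (q p)) * (\<zeta> - x)) = 0"
          using l by (intro square_integral_holomorphic holomorphic_intros) auto
        then have "S p = square_integral (q p) l (\<lambda>\<zeta>. \<phi> \<zeta> - of_real (ct (q p)) * (\<zeta> - x))"
          using square_integral_diff[OF cont c1, of "q p" l] by (simp add: S_def)
        moreover have "norm (square_integral (q p) l (\<lambda>\<zeta>. \<phi> \<zeta> - of_real (ct (q p)) * (\<zeta> - x))) \<le> 4 * l * (2 / T * (2 * l))"
        proof (rule square_integral_bound)
          show "continuous_on (square_edges (q p) l) (\<lambda>\<zeta>. \<phi> \<zeta> - of_real (ct (q p)) * (\<zeta> - x))"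
            by (intro continuous_on_diff cont c1)
          fix \<zeta> assume "\<zeta> \<in> square_edges (q p) l"
          then have d: "dist \<zeta> (q p) \<le> 2 * l" using edge corner dist_square_corner by blast
          have "\<phi> \<zeta> - of_real (ct (q p)) * (\<zeta> - x) = (\<zeta> - x) * of_real (ct \<zeta> - ct (q p))"
            by (simp add: \<phi>_def algebra_simps)
          then have "norm (\<phi> \<zeta> - of_real (ct (q p)) * (\<zeta> - x)) = norm (\<zeta> - x) * \<bar>ct \<zeta> - ct (q p)\<bar>"
            by (simp only: norm_mult norm_of_real)
          also have "\<dots> \<le> 2 / T * dist \<zeta> (q p)" using d ls l by (intro ct_diff) auto
          also have "\<dots> \<le> 2 / T * (2 * l)" using d T by (intro mult_left_mono) auto
          finally show "norm (\<phi> \<zeta> - of_real (ct (q p)) * (\<zeta> - x)) \<le> 2 / T * (2 * l)" .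
        qed (use l in simp)
        ultimately show ?thesis by (simp add: power2_eq_square)
      qed
      have S_out: "S p = 0" if "2 * \<eta> < dist (q p) x" for p
      proof -
        have "S p = square_integral (q p) l (\<lambda>_. 0)" unfolding S_def
        proof (rule square_integral_cong)
          fix \<zeta> assume "\<zeta> \<in> square_edges (q p) l"
          then have "dist \<zeta> (q p) \<le> 2 * l" using edge corner dist_square_corner by blast
          then show "\<phi> \<zeta> = 0" using that dist_triangle[of "q p" x \<zeta>] ls s(2) l by (intro \<phi>_out) (auto simp: dist_commute)
        qed
        then show ?thesis by (simp add: square_integral_def)
      qed
      \<comment> \<open>On these cells \<open>\<phi>\<close> is holomorphic. So \<open>g\<close> has
        no poles very close to \<open>x\<close>, while by \<open>S_out\<close> all its poles are
        within \<open>2 * \<eta>\<close> of \<open>x\<close>.\<close>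
      have S_in: "S p = 0" if "dist (q p) x + 2 * l \<le> s" for p
      proof -
        have "S p = square_integral (q p) l (\<lambda>\<zeta>. \<zeta> - x)" unfolding S_def
        proof (rule square_integral_cong)
          fix \<zeta> assume "\<zeta> \<in> square_edges (q p) l"
          then have "dist \<zeta> (q p) \<le> 2 * l" using edge corner dist_square_corner by blast
          then show "\<phi> \<zeta> = \<zeta> - x" using that dist_triangle[of \<zeta> x "q p"] by (intro \<phi>_in) auto
        qed
        also have "\<dots> = 0" using l by (intro square_integral_holomorphic holomorphic_intros) auto
        finally show ?thesis .
      qed
      have rat: "rational_limit X g" if X: "\<forall>d\<in>D. dist (fst d) x \<le> 2 * \<eta> \<longrightarrow> X \<inter> ball (fst d) (snd d) = {}" for X
        unfolding g_def[abs_def]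
      proof (rule rational_limit_sum)
        fix p assume p: "p \<in> ?P"
        show "rational_limit X (\<lambda>z. S p / (2 * pi * \<i>) / (z - q p))"
        proof (cases "S p = 0")
          case True
          then show ?thesis using rational_limit_const[of X 0] by simp
        next
          case False
          have "dist (q p) x \<le> 2 * \<eta>" by (metis S_out False not_le)
          then have "X \<inter> ball (q p) \<rho> = {}" using X p by (auto simp: D_def)
          then have "q p \<notin> X" using \<rho> by auto
          then show ?thesis
            by (intro rational_limit_rational[of X "[:- q p, 1:]" _ "[:S p / (2 * pi * \<i>):]"]) auto
        qed
      qed

      \<comment> \<open>Comparison of the rational function with the cut-off function\<close>
      have est: "norm (g z - \<phi> z) \<le> \<sigma> + \<eta>" "dist z x < s/2 \<Longrightarrow> norm (g z - \<phi> z) \<le> \<sigma>"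
        if z: "z \<in> cball 0 1" and off: "\<forall>d\<in>D. dist (fst d) x \<le> 2 * \<eta> \<longrightarrow> z \<notin> ball (fst d) (snd d)" for z
      proof -
        define k where "k = truncated_kernel l z"
        note kp = truncated_kernel_props[OF l(1), of _ z, folded k_def]
        have ck: "continuous_on A k" for A unfolding k_def by (rule truncated_kernel_props[OF l(1)])
        have cf: "continuous_on A (\<lambda>\<zeta>. (\<phi> \<zeta> - \<phi> z) * k \<zeta>)" for A by (intro continuous_intros cont ck)
        define I where "I p = square_integral (q p) l (\<lambda>\<zeta>. (\<phi> \<zeta> - \<phi> z) * k \<zeta>)" for p
        \<comment> \<open>The contribution of one cell to
          \<open>2 * pi * \<i> * (g z - \<phi> z)\<close>: the integrals \<open>I p\<close> add up
          to minus the Cauchy formula for the constant \<open>\<phi> z\<close>, because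
          \<open>\<phi>\<close> vanishes on the outer boundary.\<close>
        define t where "t p = I p + S p / (z - q p)" for p
        define N where "N = {p \<in> ?P. dist z (q p) < 5 * l}"
        define F where "F = {p. p \<in> ?P \<and> 5 * l \<le> dist (q p) z}"
        have "(\<Sum>p\<in>?P. I p) = square_integral a (n * l) (\<lambda>\<zeta>. (\<phi> \<zeta> - \<phi> z) * k \<zeta>)"
          using square_integral_grid_sum[OF l(1) cf, of a n] by (simp add: I_def q_def sum.cartesian_product case_prod_unfold)
        also have "\<dots> = square_integral a 4 (\<lambda>\<zeta>. - \<phi> z * (1 / (\<zeta> - z)))"
          unfolding l(2)
        proof (rule square_integral_cong)
          fix \<zeta> assume "\<zeta> \<in> square_edges a 4"
          then have "\<bar>Re \<zeta>\<bar> = 2 \<or> \<bar>Im \<zeta>\<bar> = 2"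
            by (auto simp: a_def square_edges_def closed_segment_same_Im closed_segment_same_Re)
          then have n2: "norm \<zeta> \<ge> 2" using abs_Re_le_cmod[of \<zeta>] abs_Im_le_cmod[of \<zeta>] by auto
          have "norm (\<zeta> - z) \<ge> l" "dist \<zeta> x \<ge> \<eta>"
            using n2 z x ls s \<eta> l norm_triangle_ineq2[of \<zeta> z] norm_triangle_ineq2[of \<zeta> x] by (auto simp: dist_norm)
          then show "(\<phi> \<zeta> - \<phi> z) * k \<zeta> = - \<phi> z * (1 / (\<zeta> - z))" by (simp add: kp(2) \<phi>_out)
        qed
        also have "\<dots> = - \<phi> z * (2 * pi * \<i>)"
        proof -
          have zb: "z \<in> box a (a + Complex 4 4)"
            using z abs_Re_le_cmod[of z] abs_Im_le_cmod[of z] by (auto simp: in_box_complex_iff a_def)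
          have zp: "z \<notin> path_image (rectpath a (a + Complex 4 4))"
            using zb path_image_rectpath_inter_box[of a "a + Complex 4 4"] by auto
          have c: "continuous_on (square_edges a 4) (\<lambda>\<zeta>. 1 / (\<zeta> - z))"
          proof -
            have "z \<notin> square_edges a 4"
            proof
              assume "z \<in> square_edges a 4"
              then have "\<bar>Re z\<bar> = 2 \<or> \<bar>Im z\<bar> = 2"
                by (auto simp: a_def square_edges_def closed_segment_same_Im closed_segment_same_Re)
              then show False using z abs_Re_le_cmod[of z] abs_Im_le_cmod[of z] by auto
            qed
            then show ?thesis by (intro continuous_intros) auto
          qed
          have "square_integral a 4 (\<lambda>\<zeta>. 1 / (\<zeta> - z)) = 2 * pi * \<i> * winding_number (rectpath a (a + Complex 4 4)) z"
            using square_integral_eq_rectpath[OF c] winding_number_valid_path[OF valid_path_rectpath zp] by simp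
          also have "winding_number (rectpath a (a + Complex 4 4)) z = 1" using zb by (rule winding_number_rectpath)
          finally have e: "square_integral a 4 (\<lambda>\<zeta>. 1 / (\<zeta> - z)) = 2 * pi * \<i> * 1" .
          show ?thesis unfolding square_integral_cmult[OF c] e by simp
        qed
        finally have sumI: "(\<Sum>p\<in>?P. I p) = - \<phi> z * (2 * pi * \<i>)" .
        have "2 * pi * \<i> * (g z - \<phi> z) = (\<Sum>p\<in>?P. t p)"
          by (simp add: t_def sum.distrib sumI g_def right_diff_distrib sum_distrib_left mult.commute)
        moreover have "norm (2 * pi * \<i> * (g z - \<phi> z)) = 2 * pi * norm (g z - \<phi> z)" by (simp add: norm_mult)
        moreover have "norm (g z - \<phi> z) \<le> 2 * pi * norm (g z - \<phi> z)"
          using mult_right_mono[of 1 "2 * pi" "norm (g z - \<phi> z)"] pi_ge_two by simp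
        ultimately have "norm (g z - \<phi> z) \<le> norm (\<Sum>p\<in>?P. t p)" by simp
        also have "\<dots> \<le> (\<Sum>p\<in>?P. norm (t p))" by (rule norm_sum)
        also have "?P = N \<union> F" by (auto simp: N_def F_def dist_commute)
        also have "(\<Sum>p\<in>N \<union> F. norm (t p)) = (\<Sum>p\<in>N. norm (t p)) + (\<Sum>p\<in>F. norm (t p))"
          by (rule sum.union_disjoint) (auto simp: N_def F_def dist_commute)
        finally have split: "norm (g z - \<phi> z) \<le> (\<Sum>p\<in>N. norm (t p)) + (\<Sum>p\<in>F. norm (t p))" .
        \<comment> \<open>Far from \<open>z\<close> there are two small factors, the oscillation of
          \<open>\<phi>\<close> and that of the Cauchy kernel over the cell.\<close>
        have far: "norm (t p) \<le> 80 * l * (l\<^sup>2 / (dist (q p) z)\<^sup>2)" if p: "p \<in> F" for p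
        proof -
          define d where "d = dist (q p) z"
          have d: "d \<ge> 5 * l" "d > 0" using p l by (auto simp: F_def d_def)
          have sq: "dist \<zeta> (q p) \<le> 2 * l" "3/5 * d \<le> norm (\<zeta> - z)" "norm (\<zeta> - z) \<ge> l" "\<zeta> \<noteq> z" if "\<zeta> \<in> square (q p) l" for \<zeta>
          proof -
            show 1: "dist \<zeta> (q p) \<le> 2 * l" using dist_square_corner[OF that corner] .
            have "d \<le> dist (q p) \<zeta> + dist \<zeta> z" unfolding d_def by (rule dist_triangle)
            then show "3/5 * d \<le> norm (\<zeta> - z)" "norm (\<zeta> - z) \<ge> l" using 1 d l by (auto simp: dist_norm dist_commute norm_minus_commute)
            then show "\<zeta> \<noteq> z" using l by auto
          qed
          have qz: "q p \<noteq> z" using d by (auto simp: d_def)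
          \<comment> \<open>The integrand of \<open>t p\<close> is \<open>?m\<close> plus
            \<open>?h\<close>; \<open>?h\<close> is holomorphic on the cell and integrates to 0,
            \<open>?m\<close> is the product of the two oscillations.\<close>
          let ?h = "\<lambda>\<zeta>. (\<phi> (q p) - \<phi> z) * (1 / (\<zeta> - z)) - \<phi> (q p) * (1 / (q p - z))"
          let ?m = "\<lambda>\<zeta>. (\<phi> \<zeta> - \<phi> (q p)) * (1 / (\<zeta> - z) - 1 / (q p - z))"
          have ne: "\<zeta> - z \<noteq> 0" if "\<zeta> \<in> square_edges (q p) l" for \<zeta> using sq(4) edge that by (metis eq_iff_diff_eq_0 subsetD)
          have ch: "continuous_on (square_edges (q p) l) ?h" "continuous_on (square_edges (q p) l) ?m"
            by (intro continuous_intros cont; use ne in blast)+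
          have "t p = I p + (1 / (z - q p)) * S p" by (simp add: t_def)
          also have "(1 / (z - q p)) * S p = square_integral (q p) l (\<lambda>\<zeta>. (1 / (z - q p)) * \<phi> \<zeta>)"
            unfolding S_def by (rule square_integral_cmult[OF cont, symmetric])
          also have "I p + \<dots> = square_integral (q p) l (\<lambda>\<zeta>. (\<phi> \<zeta> - \<phi> z) * k \<zeta> + (1 / (z - q p)) * \<phi> \<zeta>)"
            unfolding I_def by (rule square_integral_add[symmetric, OF cf]) (intro continuous_intros cont)
          also have "\<dots> = square_integral (q p) l (\<lambda>\<zeta>. ?m \<zeta> + ?h \<zeta>)"
          proof (rule square_integral_cong)
            fix \<zeta> assume "\<zeta> \<in> square_edges (q p) l"
            then have "\<zeta> \<in> square (q p) l" using edge by blast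
            note f = sq[OF this]
            have inv: "1 / (z - q p) = - (1 / (q p - z))" by (metis minus_diff_eq minus_divide_right)
            have "(\<phi> \<zeta> - \<phi> z) * k \<zeta> + (1 / (z - q p)) * \<phi> \<zeta> = (\<phi> \<zeta> - \<phi> z) * (1 / (\<zeta> - z)) - (1 / (q p - z)) * \<phi> \<zeta>"
              by (simp only: kp(2)[OF f(3)] inv) simp
            also have "\<dots> = ?m \<zeta> + ?h \<zeta>" by (simp only: algebra_simps)
            finally show "(\<phi> \<zeta> - \<phi> z) * k \<zeta> + (1 / (z - q p)) * \<phi> \<zeta> = ?m \<zeta> + ?h \<zeta>" .
          qed
          also have "\<dots> = square_integral (q p) l ?m + square_integral (q p) l ?h" by (rule square_integral_add[OF ch(2,1)])
          also have "square_integral (q p) l ?h = 0"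
            using l sq(4) by (intro square_integral_holomorphic holomorphic_intros) auto
          finally have "t p = square_integral (q p) l ?m" by simp
          moreover have "norm (square_integral (q p) l ?m) \<le> 4 * l * (20 * l\<^sup>2 / d\<^sup>2)"
          proof (rule square_integral_bound[OF ch(2)])
            fix \<zeta> assume "\<zeta> \<in> square_edges (q p) l"
            then have "\<zeta> \<in> square (q p) l" using edge by blast
            note f = sq[OF this]
            have "1 / (\<zeta> - z) - 1 / (q p - z) = (q p - \<zeta>) / ((\<zeta> - z) * (q p - z))"
              using f(4) qz by (simp add: field_simps)
            then have "norm (1 / (\<zeta> - z) - 1 / (q p - z)) = dist \<zeta> (q p) / (norm (\<zeta> - z) * d)"
              by (simp only: norm_divide norm_mult d_def dist_norm) (simp add: norm_minus_commute)
            also have "\<dots> \<le> 2 * l / (3/5 * d * d)" using f d l by (intro frac_le mult_right_mono mult_pos_pos) auto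
            finally have "norm (1 / (\<zeta> - z) - 1 / (q p - z)) \<le> 2 * l / (3/5 * d * d)" .
            moreover have "norm (\<phi> \<zeta> - \<phi> (q p)) \<le> 6 * l" using \<phi>_diff[of \<zeta> "q p"] f(1) ls l by auto
            ultimately have "norm (\<phi> \<zeta> - \<phi> (q p)) * norm (1 / (\<zeta> - z) - 1 / (q p - z)) \<le> (6 * l) * (2 * l / (3/5 * d * d))"
              using l by (intro mult_mono) auto
            also have "\<dots> = 20 * l\<^sup>2 / d\<^sup>2" using d by (simp add: power2_eq_square)
            finally show "norm (?m \<zeta>) \<le> 20 * l\<^sup>2 / d\<^sup>2" by (simp only: norm_mult)
          qed (use l in simp)
          ultimately show ?thesis by (simp add: d_def)
        qed
        have "(\<Sum>p\<in>F. norm (t p)) \<le> (\<Sum>p\<in>F. 80 * l * (l\<^sup>2 / (dist (q p) z)\<^sup>2))" by (intro sum_mono far)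
        also have "\<dots> = 80 * l * (\<Sum>p\<in>F. l\<^sup>2 / (dist (q p) z)\<^sup>2)" by (simp add: sum_distrib_left)
        also have "(\<Sum>p\<in>F. l\<^sup>2 / (dist (q p) z)\<^sup>2) \<le> 16 * (2 + ln (real n))\<^sup>2"
          unfolding F_def q_def
        proof (rule lattice_sum_le[OF l(1) n])
          have "\<bar>Re z\<bar> \<le> 1" "\<bar>Im z\<bar> \<le> 1" using z abs_Re_le_cmod[of z] abs_Im_le_cmod[of z] by auto
          then show "0 \<le> Re (z - a)" "Re (z - a) < real n * l" "0 \<le> Im (z - a)" "Im (z - a) < real n * l"
            unfolding l(2) by (auto simp: a_def)
        qed
        finally have Fsum: "(\<Sum>p\<in>F. norm (t p)) \<le> 80 * l * (16 * (2 + ln (real n))\<^sup>2)" using l by simp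
        have cN: "real (card N) \<le> 121"
        proof -
          have "l\<^sup>2 * real (card N) \<le> (2 * (5 * l) + l)\<^sup>2"
            unfolding N_def q_def using l by (intro grid_count) auto
          then have "l\<^sup>2 * real (card N) \<le> l\<^sup>2 * 121" by (simp add: power2_eq_square)
          then show ?thesis using l by simp
        qed
        \<comment> \<open>Near \<open>z\<close> the Lipschitz bound of \<open>\<phi>\<close> cancels
          the singularity of the kernel.\<close>
        have In: "norm (I p) \<le> 12 * l" if p: "p \<in> N" for p
        proof -
          have "norm (I p) \<le> 4 * l * 3" unfolding I_def
          proof (rule square_integral_bound[OF cf])
            fix \<zeta> assume "\<zeta> \<in> square_edges (q p) l"
            then have "dist \<zeta> (q p) \<le> 2 * l" using edge corner dist_square_corner by blast
            then have "dist \<zeta> z \<le> s" using p ls l dist_triangle[of \<zeta> z "q p"] by (auto simp: N_def dist_commute)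
            then have "norm (\<phi> \<zeta> - \<phi> z) \<le> 3 * norm (\<zeta> - z)" using \<phi>_diff by (simp add: dist_norm)
            then have "norm (\<phi> \<zeta> - \<phi> z) * norm (k \<zeta>) \<le> 3 * norm (\<zeta> - z) * norm (k \<zeta>)" by (intro mult_right_mono) auto
            also have "\<dots> \<le> 3" using kp(3)[of \<zeta>] by simp
            finally show "norm ((\<phi> \<zeta> - \<phi> z) * k \<zeta>) \<le> 3" by (simp add: norm_mult)
          qed (use l in simp)
          then show ?thesis by simp
        qed
        have card_mult: "real (card N) * c \<le> 121 * c" if "c \<ge> 0" for c using cN that by (intro mult_right_mono) auto
        \<comment> \<open>Only here are the deleted discs used: they keep \<open>z\<close> at
          distance at least \<open>\<rho>\<close> from the poles.\<close>
        have Nsum1: "(\<Sum>p\<in>N. norm (t p)) \<le> 121 * (12 * l) + \<eta>"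
        proof -
          have "norm (t p) \<le> 12 * l + 256 / (T * \<kappa>)" if p: "p \<in> N" for p
          proof -
            have "norm (S p / (z - q p)) \<le> 256 / (T * \<kappa>)"
            proof (cases "S p = 0")
              case True
              then show ?thesis using T \<kappa> by simp
            next
              case False
              have "dist (q p) x \<le> 2 * \<eta>" by (metis S_out False not_le)
              moreover have "(q p, \<rho>) \<in> D" using p by (auto simp: D_def N_def)
              ultimately have "z \<notin> ball (q p) \<rho>" using off by fastforce
              then have "\<rho> \<le> norm (z - q p)" by (simp add: dist_norm norm_minus_commute)
              then have "norm (S p) / norm (z - q p) \<le> (16 * l\<^sup>2 / T) / \<rho>" using S_small[of p] \<rho>(1) T by (intro frac_le) auto
              also have "\<dots> = 256 / (T * \<kappa>)" unfolding \<rho>(2) using l T \<kappa> by (simp add: field_simps)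
              finally show ?thesis by (simp add: norm_divide)
            qed
            then show ?thesis using In[OF p] norm_triangle_ineq[of "I p" "S p / (z - q p)"] by (simp add: t_def)
          qed
          then have "(\<Sum>p\<in>N. norm (t p)) \<le> real (card N) * (12 * l + 256 / (T * \<kappa>))"
            using sum_bounded_above[of N "\<lambda>p. norm (t p)"] by simp
          also have "\<dots> \<le> 121 * (12 * l + 256 / (T * \<kappa>))" using l T \<kappa> by (intro card_mult) auto
          also have "\<dots> = 121 * (12 * l) + 30976 / (T * \<kappa>)" by (simp add: algebra_simps)
          finally show ?thesis using T(2) by simp
        qed
        show "norm (g z - \<phi> z) \<le> \<sigma> + \<eta>" using split Fsum Nsum1 by (simp add: \<sigma>_def)
        \<comment> \<open>Within \<open>s / 2\<close> of \<open>x\<close> the near cells lie within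
          \<open>s\<close> of \<open>x\<close>, as \<open>20 * l < s\<close>, so their poles are
          absent. This is why the final inner scale is \<open>s / 2\<close>.\<close>
        show "norm (g z - \<phi> z) \<le> \<sigma>" if zx: "dist z x < s/2"
        proof -
          have "norm (t p) \<le> 12 * l" if p: "p \<in> N" for p
          proof -
            have "dist (q p) x + 2 * l \<le> s" using p zx ls l dist_triangle[of "q p" x z] by (auto simp: N_def dist_commute)
            then show ?thesis using In[OF p] S_in by (simp add: t_def)
          qed
          then have "(\<Sum>p\<in>N. norm (t p)) \<le> real (card N) * (12 * l)"
            using sum_bounded_above[of N "\<lambda>p. norm (t p)"] by simp
          also have "\<dots> \<le> 121 * (12 * l)" using l by (intro card_mult) auto
          finally show ?thesis using split Fsum by (simp add: \<sigma>_def)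
        qed
      qed
      have "norm (g z) \<le> 3 * \<eta> \<and> (dist z x < s/2 \<longrightarrow> norm (g z - (z - x)) \<le> \<epsilon>)"
        if z: "z \<in> cball 0 1" "\<forall>d\<in>D. dist (fst d) x \<le> 2 * \<eta> \<longrightarrow> z \<notin> ball (fst d) (snd d)" for z
      proof
        show "norm (g z) \<le> 3 * \<eta>"
          using est(1)[OF z] \<phi>_le[of z] \<sigma>(2) norm_triangle_sub[of "g z" "\<phi> z"] by linarith
        show "dist z x < s/2 \<longrightarrow> norm (g z - (z - x)) \<le> \<epsilon>"
          using est(2)[OF z] \<phi>_in[of z] \<sigma>(1) s(1) by auto
      qed
      with rat show ?thesis by blast
    qed
    ultimately show ?thesis using D by blast
  qed
  then show ?thesis using s(1) by (intro exI[of _ "s/2"]) auto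
qed

section \<open>The ideals generated by inner functions\<close>

text \<open>For \<mu> on the unit circle, \<open>exp (of_real \<rho> * cayley \<mu> z)\<close> is
  the singular inner function of the point mass \<rho> at \<mu>.\<close>

definition cayley :: "complex \<Rightarrow> complex \<Rightarrow> complex" where
  "cayley \<mu> z = (z + \<mu>) / (z - \<mu>)"

lemma Re_cayley: "Re (cayley \<mu> z) = ((norm z)\<^sup>2 - (norm \<mu>)\<^sup>2) / (norm (z - \<mu>))\<^sup>2"
proof -
  have "cayley \<mu> z = (z + \<mu>) * cnj (z - \<mu>) / of_real ((norm (z - \<mu>))\<^sup>2)"
    unfolding cayley_def using complex_div_cnj[of "z + \<mu>" "z - \<mu>"] by simp
  then have "Re (cayley \<mu> z) = Re ((z + \<mu>) * cnj (z - \<mu>)) / (norm (z - \<mu>))\<^sup>2" by (simp only: Re_divide_of_real)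
  also have "Re ((z + \<mu>) * cnj (z - \<mu>)) = (norm z)\<^sup>2 - (norm \<mu>)\<^sup>2"
    by (simp add: cmod_power2) (simp add: power2_eq_square algebra_simps)
  finally show ?thesis .
qed

lemma cayley_alt: "z \<noteq> \<mu> \<Longrightarrow> cayley \<mu> z = 1 + 2 * \<mu> / (z - \<mu>)"
  by (simp add: cayley_def field_simps)

definition inner_gen :: "real \<Rightarrow> complex \<Rightarrow> complex \<Rightarrow> complex" where
  "inner_gen \<rho> lam z = (if z = lam then 0 else (z - lam) * exp (of_real \<rho> * cayley lam z))"

lemma I_gen_eq: "I_gen K \<rho> lam = restrict (inner_gen \<rho> lam) K"
  by (auto simp: I_gen_def inner_gen_def cayley_def)

lemma inner_gen_eq: "inner_gen \<rho> lam z = (z - lam) * exp (of_real \<rho> * cayley lam z)"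
  by (simp add: inner_gen_def)

lemma norm_exp_cayley_le:
  assumes "\<rho> \<ge> 0" "norm z \<le> norm \<mu>"
  shows "norm (exp (of_real \<rho> * cayley \<mu> z)) \<le> 1"
proof -
  have "(norm z)\<^sup>2 \<le> (norm \<mu>)\<^sup>2" using assms by (intro power_mono) auto
  then have "\<rho> * Re (cayley \<mu> z) \<le> 0" using assms by (auto simp: Re_cayley intro!: mult_nonneg_nonpos divide_nonpos_nonneg)
  then show ?thesis by (simp add: norm_exp_eq_Re)
qed

text \<open>The singularity at \<open>\<lambda>\<close> is moved to the point \<open>\<mu> = (1 + t) \<lambda>\<close> outside the closed disc.\<close>

lemma inner_approx:
  assumes lam: "norm lam = 1" and \<rho>: "\<rho> \<ge> 0" and \<delta>: "\<delta> > 0" and e: "e > 0"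
  shows "\<exists>\<phi> \<mu>. rational_limit (cball 0 1) \<phi> \<and> norm \<mu> > 1 \<and>
    (\<forall>z\<in>cball 0 1. \<phi> z \<noteq> 0 \<and> norm (\<phi> z) \<le> 1 \<and>
      (dist z lam \<ge> \<delta> \<longrightarrow> norm (exp (of_real \<rho> * cayley lam z) - \<phi> z) \<le> e * norm (\<phi> z) \<and>
        norm (z - lam - (z - \<mu>)) \<le> e * norm (z - \<mu>)))"
proof -
  \<comment> \<open>The first bound keeps \<open>z\<close> at distance at least
    \<open>\<delta> / 2\<close> from \<mu>, the second controls the linear factor, the third the
    exponent, which changes by at most \<open>\<rho> * (4 * t / \<delta>\<^sup>2)\<close>.\<close>
  define t where "t = min (\<delta> / 2) (min (e * \<delta> / 2) (min 1 (e * 2 / 3) * \<delta>\<^sup>2 / (8 * (\<rho> + 1))))"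
  have t: "0 < t" "t \<le> \<delta> / 2" "t \<le> e * \<delta> / 2" "t \<le> min 1 (e * 2 / 3) * \<delta>\<^sup>2 / (8 * (\<rho> + 1))"
  proof -
    show "0 < t" using \<delta> e \<rho> by (auto simp: t_def intro!: divide_pos_pos mult_pos_pos)
    show "t \<le> \<delta> / 2" unfolding t_def by (rule min.cobounded1)
    show "t \<le> e * \<delta> / 2" unfolding t_def by (rule min.coboundedI2, rule min.cobounded1)
    show "t \<le> min 1 (e * 2 / 3) * \<delta>\<^sup>2 / (8 * (\<rho> + 1))" unfolding t_def by (rule min.coboundedI2, rule min.cobounded2)
  qed
  define \<mu> where "\<mu> = of_real (1 + t) * lam"
  have \<mu>: "norm \<mu> = 1 + t" "\<mu> - lam = of_real t * lam"
    unfolding \<mu>_def norm_mult norm_of_real using lam t by (simp_all add: algebra_simps)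
  have ml: "norm (\<mu> - lam) = t" unfolding \<mu>(2) using lam t by (simp add: norm_mult)
  define \<phi> where "\<phi> z = exp (of_real \<rho> * cayley \<mu> z)" for z
  have z\<mu>: "z \<noteq> \<mu>" if "z \<in> cball 0 1" for z using that \<mu>(1) t by auto
  have "rational_limit (cball 0 1) (\<lambda>z. of_real \<rho> * cayley \<mu> z)" unfolding cayley_def
    using z\<mu> by (intro rational_limit_mult rational_limit_divide rational_limit_add rational_limit_diff_const
        rational_limit_ident rational_limit_const) auto
  then have "rational_limit (cball 0 1) \<phi>" unfolding \<phi>_def[abs_def] by (rule rational_limit_exp) simp
  moreover have "norm (\<phi> z) \<le> 1" if "z \<in> cball 0 1" for z
    unfolding \<phi>_def using that \<rho> \<mu>(1) t by (intro norm_exp_cayley_le) auto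
  moreover have "norm (exp (of_real \<rho> * cayley lam z) - \<phi> z) \<le> e * norm (\<phi> z) \<and>
        norm (z - lam - (z - \<mu>)) \<le> e * norm (z - \<mu>)" if z: "z \<in> cball 0 1" "dist z lam \<ge> \<delta>" for z
  proof
    have zl: "norm (z - lam) \<ge> \<delta>" using z(2) by (simp add: dist_norm)
    have "norm (z - lam) \<le> norm (z - \<mu>) + norm (\<mu> - lam)" using norm_triangle_ineq[of "z - \<mu>" "\<mu> - lam"] by simp
    then have zm: "norm (z - \<mu>) \<ge> \<delta> / 2" using zl t(2) ml by linarith
    have "norm (z - lam - (z - \<mu>)) = t" using ml by simp
    also have "t \<le> e * (\<delta> / 2)" using t(3) by simp
    also have "\<dots> \<le> e * norm (z - \<mu>)" using zm e by (intro mult_left_mono) auto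
    finally show "norm (z - lam - (z - \<mu>)) \<le> e * norm (z - \<mu>)" .
    have n0: "z - lam \<noteq> 0" "z - \<mu> \<noteq> 0" using zl zm \<delta> by auto
    have "cayley lam z - cayley \<mu> z = 2 * z * (lam - \<mu>) / ((z - lam) * (z - \<mu>))"
      using n0 by (simp add: cayley_def divide_simps) (simp add: algebra_simps)
    then have "norm (cayley lam z - cayley \<mu> z) = 2 * norm z * t / (norm (z - lam) * norm (z - \<mu>))"
      using ml by (simp add: norm_divide norm_mult norm_minus_commute)
    also have "\<dots> \<le> 2 * 1 * t / (\<delta> * (\<delta> / 2))"
      using z(1) zl zm t \<delta> by (intro frac_le mult_mono mult_right_mono mult_left_mono) auto
    also have "\<dots> = 4 * t / \<delta>\<^sup>2" using \<delta> by (simp add: power2_eq_square)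
    finally have c: "norm (cayley lam z - cayley \<mu> z) \<le> 4 * t / \<delta>\<^sup>2" .
    define d where "d = of_real \<rho> * (cayley lam z - cayley \<mu> z)"
    have "norm d \<le> \<rho> * (4 * t / \<delta>\<^sup>2)" 
      unfolding d_def norm_mult norm_of_real using mult_left_mono[OF c \<rho>] by (simp only: abs_of_nonneg[OF \<rho>])
    also have "\<dots> \<le> (\<rho> + 1) * (4 * t / \<delta>\<^sup>2)" using t \<delta> by (intro mult_right_mono) auto
    also have "\<dots> \<le> (\<rho> + 1) * (4 * (min 1 (e * 2 / 3) * \<delta>\<^sup>2 / (8 * (\<rho> + 1))) / \<delta>\<^sup>2)"
      using t(4) \<rho> by (intro mult_left_mono divide_right_mono) auto
    also have "\<dots> = min 1 (e * 2 / 3) / 2"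
    proof -
      have gen: "a * (4 * (m * b / (8 * a)) / b) = m / 2" if "a \<noteq> 0" "b \<noteq> 0" for a b m :: real using that by simp
      show ?thesis by (rule gen) (use \<rho> \<delta> in auto)
    qed
    finally have dn: "norm d \<le> 1/2" "norm d \<le> e * 2 / 3" using e by (auto simp: min_def split: if_splits)
    have "exp (of_real \<rho> * cayley lam z) = \<phi> z * exp d" by (simp add: \<phi>_def d_def exp_add[symmetric] algebra_simps)
    then have "exp (of_real \<rho> * cayley lam z) - \<phi> z = \<phi> z * (exp d - 1)" by (simp add: algebra_simps)
    then have "norm (exp (of_real \<rho> * cayley lam z) - \<phi> z) = norm (\<phi> z) * norm (exp d - 1)" by (simp only: norm_mult)
    also have "\<dots> \<le> norm (\<phi> z) * (3/2 * norm d)" using norm_exp_bounds(2)[OF dn(1)] by (intro mult_left_mono) auto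
    also have "\<dots> \<le> norm (\<phi> z) * e" using dn(2) by (intro mult_left_mono) auto
    finally show "norm (exp (of_real \<rho> * cayley lam z) - \<phi> z) \<le> e * norm (\<phi> z)" by (simp add: mult.commute)
  qed
  moreover have "\<phi> z \<noteq> 0" for z by (simp add: \<phi>_def)
  ultimately show ?thesis using \<mu>(1) t(1) by (intro exI[of _ \<phi>] exI[of _ \<mu>]) auto
qed

text \<open>The two generators differ by the factor with exponent \<open>\<rho>2 - \<rho>1\<close>,
  which is discontinuous at \<open>lam\<close>. Its approximation is accurate away from
  \<open>lam\<close>; near \<open>lam\<close> both are bounded by 1 and the factor
  \<open>z - lam\<close> is small.\<close>

lemma inner_gen_mult_approx:
  assumes lam: "norm lam = 1" and \<rho>: "0 \<le> \<rho>1" "\<rho>1 \<le> \<rho>2" and e: "e > 0"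
  shows "\<exists>\<phi>. rational_limit (cball 0 1) \<phi> \<and>
    (\<forall>z\<in>cball 0 1. norm (inner_gen \<rho>2 lam z - inner_gen \<rho>1 lam z * \<phi> z) < e)"
proof -
  obtain \<phi> where \<phi>: "rational_limit (cball 0 1) \<phi>" "\<And>z. z \<in> cball 0 1 \<Longrightarrow> norm (\<phi> z) \<le> 1"
    "\<And>z. z \<in> cball 0 1 \<Longrightarrow> dist z lam \<ge> e/3 \<Longrightarrow>
       norm (exp (of_real (\<rho>2 - \<rho>1) * cayley lam z) - \<phi> z) \<le> e/3 * norm (\<phi> z)"
    using inner_approx[OF lam, of "\<rho>2 - \<rho>1" "e/3" "e/3"] \<rho> e by auto
  have "norm (inner_gen \<rho>2 lam z - inner_gen \<rho>1 lam z * \<phi> z) < e" if z: "z \<in> cball 0 1" for z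
  proof -
    define E where "E = exp (of_real (\<rho>2 - \<rho>1) * cayley lam z)"
    have E1: "norm (exp (of_real \<rho>1 * cayley lam z)) \<le> 1" "norm E \<le> 1"
      unfolding E_def by (rule norm_exp_cayley_le; use \<rho> z lam in simp)+
    have "exp (of_real \<rho>2 * cayley lam z) = exp (of_real \<rho>1 * cayley lam z) * E"
      by (simp add: E_def exp_add[symmetric] algebra_simps)
    then have "inner_gen \<rho>2 lam z - inner_gen \<rho>1 lam z * \<phi> z = (z - lam) * exp (of_real \<rho>1 * cayley lam z) * (E - \<phi> z)"
      by (simp add: inner_gen_eq algebra_simps)
    then have "norm (inner_gen \<rho>2 lam z - inner_gen \<rho>1 lam z * \<phi> z)
        = dist z lam * norm (exp (of_real \<rho>1 * cayley lam z)) * norm (E - \<phi> z)" by (simp add: norm_mult dist_norm)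
    also have "\<dots> \<le> dist z lam * 1 * norm (E - \<phi> z)" using E1 by (intro mult_mono) auto
    also have "\<dots> < e"
    proof (cases "dist z lam \<ge> e/3")
      case True
      have "norm (E - \<phi> z) \<le> e/3 * norm (\<phi> z)" using \<phi>(3)[OF z True] by (simp only: E_def)
      also have "\<dots> \<le> e/3 * 1" using \<phi>(2)[OF z] e by (intro mult_left_mono) auto
      finally have *: "norm (E - \<phi> z) \<le> e/3" by simp
      have "dist z lam \<le> 2" using z lam dist_triangle[of z lam 0] by (simp add: dist_commute)
      then have "dist z lam * 1 * norm (E - \<phi> z) \<le> 2 * (e/3)" using * by (intro mult_mono) auto
      then show ?thesis using e by simp
    next
      case False
      have "norm (E - \<phi> z) \<le> 2" using E1(2) \<phi>(2)[OF z] norm_triangle_ineq4[of E "\<phi> z"] by simp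
      then have "dist z lam * 1 * norm (E - \<phi> z) \<le> (e/3) * 2" using False e by (intro mult_mono) auto
      then show ?thesis using e by simp
    qed
    finally show ?thesis .
  qed
  with \<phi>(1) show ?thesis by blast
qed

lemma rational_limit_inner_gen:
  assumes lam: "norm lam = 1" and \<rho>: "0 \<le> \<rho>"
  shows "rational_limit (cball 0 1) (inner_gen \<rho> lam)"
proof (rule rational_limit_closed)
  fix e :: real assume "e > 0"
  then obtain \<phi> where \<phi>: "rational_limit (cball 0 1) \<phi>"
    "\<forall>z\<in>cball 0 1. norm (inner_gen \<rho> lam z - inner_gen 0 lam z * \<phi> z) < e"
    using inner_gen_mult_approx[OF lam _ \<rho>] by blast
  have "rational_limit (cball 0 1) (\<lambda>z. (z - lam) * \<phi> z)"
    by (intro rational_limit_mult rational_limit_diff_const \<phi>) auto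
  then show "\<exists>g. rational_limit (cball 0 1) g \<and> (\<forall>z\<in>cball 0 1. norm (inner_gen \<rho> lam z - g z) < e)"
    using \<phi>(2) by (intro exI[of _ "\<lambda>z. (z - lam) * \<phi> z"]) (auto simp: inner_gen_eq)
qed

lemma mem_closed_ideal_if_approx:
  assumes "closed_ideal (top_of_set K) (R_alg K) I" "restrict g K \<in> I" "f \<in> extensional K" "rational_limit K f"
    and approx: "\<And>e. e > 0 \<Longrightarrow> \<exists>h. rational_limit K h \<and> (\<forall>z\<in>K. norm (f z - g z * h z) < e)"
  shows "f \<in> I"
proof -
  have "f \<in> R_alg K" using assms(3,4) by (simp add: R_alg_iff)
  then have "f \<in> cont_funs (top_of_set K)" using R_alg_subset_cont_funs by blast
  moreover have "\<exists>j\<in>I. \<forall>z\<in>K. norm (f z - j z) < e" if "e > 0" for e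
  proof -
    obtain h where h: "rational_limit K h" "\<forall>z\<in>K. norm (f z - g z * h z) < e" using approx \<open>e > 0\<close> by blast
    have "fmult (top_of_set K) (restrict h K) (restrict g K) \<in> I"
      using assms(1,2) h(1) by (auto simp: closed_ideal_def restrict_in_R_alg_iff)
    then show ?thesis using h(2) by (intro bexI) (auto simp: fmult_restrict mult.commute)
  qed
  ultimately have "f \<in> uniform_closure (top_of_set K) I" by (simp add: uniform_closure_def)
  then show ?thesis using assms(1) by (simp add: closed_ideal_def)
qed

lemma uniform_closure_mono: "S \<subseteq> T \<Longrightarrow> uniform_closure X S \<subseteq> uniform_closure X T"
  unfolding uniform_closure_def by blast

lemma uniform_closureD:
  "f \<in> uniform_closure X S \<Longrightarrow> e > 0 \<Longrightarrow> \<exists>g\<in>S. \<forall>x\<in>topspace X. norm (f x - g x) < e"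
  by (simp add: uniform_closure_def)

text \<open>The uniform limits of multiples of \<open>g\<close> contain the closed ideal generated
  by \<open>g\<close>; so non-membership becomes a statement about failing approximation.\<close>

lemma closed_ideal_approx_multiples:
  assumes K: "compact K" and g: "rational_limit K g"
  shows "closed_ideal (top_of_set K) (R_alg K)
    {f \<in> R_alg K. \<forall>e>0. \<exists>h. rational_limit K h \<and> (\<forall>z\<in>K. norm (f z - g z * h z) < e)}" (is "closed_ideal _ _ ?I")
  unfolding closed_ideal_def
proof (intro conjI ballI)
  show "?I \<subseteq> R_alg K" by blast
  show "fconst (top_of_set K) 0 \<in> ?I"
    using R_alg_fconst[of K 0] rational_limit_const[of K 0] by (auto simp: fconst_restrict intro!: exI[of _ "\<lambda>_. 0"])
  show "fadd (top_of_set K) f1 f2 \<in> ?I" if f: "f1 \<in> ?I" "f2 \<in> ?I" for f1 f2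
  proof -
    have "\<exists>h. rational_limit K h \<and> (\<forall>z\<in>K. norm (fadd (top_of_set K) f1 f2 z - g z * h z) < e)" if "e > 0" for e
    proof -
      have "e/2 > 0" using that by simp
      then obtain h1 h2 where h: "rational_limit K h1" "\<forall>z\<in>K. norm (f1 z - g z * h1 z) < e/2"
        "rational_limit K h2" "\<forall>z\<in>K. norm (f2 z - g z * h2 z) < e/2" using f by blast
      have "norm (f1 z + f2 z - g z * (h1 z + h2 z)) < e" if "z \<in> K" for z
      proof -
        have "f1 z + f2 z - g z * (h1 z + h2 z) = (f1 z - g z * h1 z) + (f2 z - g z * h2 z)" by (simp add: algebra_simps)
        moreover have "norm (f1 z - g z * h1 z) < e/2" "norm (f2 z - g z * h2 z) < e/2" using h(2,4) that by auto
        ultimately show ?thesis using norm_triangle_lt[of "f1 z - g z * h1 z" "f2 z - g z * h2 z" e] by (simp only: )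
      qed
      then show ?thesis using rational_limit_add[OF h(1,3)]
        by (intro exI[of _ "\<lambda>z. h1 z + h2 z"]) (auto simp: fadd_restrict)
    qed
    then show ?thesis using f R_alg_fadd by blast
  qed
  show "fmult (top_of_set K) f1 f2 \<in> ?I" if f: "f1 \<in> R_alg K" "f2 \<in> ?I" for f1 f2
  proof -
    have f1: "rational_limit K f1" using f(1) by (rule R_alg_rational_limit)
    obtain B where B: "B > 0" "\<And>z. z \<in> K \<Longrightarrow> norm (f1 z) \<le> B" using rational_limit_bounded[OF f1 K] by blast
    have "\<exists>h. rational_limit K h \<and> (\<forall>z\<in>K. norm (fmult (top_of_set K) f1 f2 z - g z * h z) < e)" if "e > 0" for e
    proof -
      have "e / B > 0" using that B by simp
      then obtain h where h: "rational_limit K h" "\<forall>z\<in>K. norm (f2 z - g z * h z) < e / B" using f(2) by blast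
      have "norm (f1 z * f2 z - g z * (f1 z * h z)) < e" if z: "z \<in> K" for z
      proof -
        have "f1 z * f2 z - g z * (f1 z * h z) = f1 z * (f2 z - g z * h z)" by (simp add: algebra_simps)
        then have "norm (f1 z * f2 z - g z * (f1 z * h z)) \<le> B * norm (f2 z - g z * h z)"
          using B(2)[OF z] by (simp add: norm_mult mult_right_mono)
        also have "\<dots> < B * (e / B)" using h(2) z B(1) by (intro mult_strict_left_mono) auto
        finally show ?thesis using B(1) by simp
      qed
      then show ?thesis using rational_limit_mult[OF f1 h(1) K]
        by (intro exI[of _ "\<lambda>z. f1 z * h z"]) (auto simp: fmult_restrict)
    qed
    then show ?thesis using f R_alg_fmult[OF K] by blast
  qed
  show "uniform_closure (top_of_set K) ?I = ?I"
  proof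
    show "?I \<subseteq> uniform_closure (top_of_set K) ?I"
      by (rule uniform_closure_superset) (use R_alg_subset_cont_funs in blast)
    show "uniform_closure (top_of_set K) ?I \<subseteq> ?I"
    proof
      fix f assume f: "f \<in> uniform_closure (top_of_set K) ?I"
      have "uniform_closure (top_of_set K) ?I \<subseteq> uniform_closure (top_of_set K) (R_alg K)"
        unfolding uniform_closure_def by blast
      then have "f \<in> R_alg K" using f uniform_closure_R_alg by blast
      moreover have "\<exists>h. rational_limit K h \<and> (\<forall>z\<in>K. norm (f z - g z * h z) < e)" if "e > 0" for e
      proof -
        have e2: "e/2 > 0" using that by simp
        obtain f' where f': "f' \<in> ?I" "\<forall>z\<in>K. norm (f z - f' z) < e/2"
          using uniform_closureD[OF f e2] by (elim bexE) (simp only: topspace_euclidean_subtopology)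
        then obtain h where h: "rational_limit K h" "\<forall>z\<in>K. norm (f' z - g z * h z) < e/2" using e2 by blast
        have "norm (f z - g z * h z) < e" if "z \<in> K" for z
          using norm_diff_triangle_less[of "f z" "f' z" "e/2" "g z * h z" "e/2"] f' h that by simp
        with h(1) show ?thesis by blast
      qed
      ultimately show "f \<in> ?I" by blast
    qed
  qed
qed

lemma I_gen_in_R_alg:
  assumes "norm lam = 1" "K \<subseteq> cball 0 1" "0 \<le> \<rho>"
  shows "I_gen K \<rho> lam \<in> R_alg K"
  using rational_limit_inner_gen[OF assms(1,3)] rational_limit_subset assms(2)
  by (auto simp: I_gen_eq restrict_in_R_alg_iff)

lemma I_gen_in_I_ideal:
  assumes "norm lam = 1" "K \<subseteq> cball 0 1" "0 \<le> \<rho>"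
  shows "I_gen K \<rho> lam \<in> I_ideal K \<rho> lam"
  using I_gen_in_R_alg[OF assms] by (simp add: I_ideal_def closed_ideal_generated_def)

lemma uniform_closure_I_ideal:
  assumes K: "compact K" "norm lam = 1" "K \<subseteq> cball 0 1" "0 \<le> \<rho>"
  shows "uniform_closure (top_of_set K) (I_ideal K \<rho> lam) \<subseteq> I_ideal K \<rho> lam"
proof
  fix f assume f: "f \<in> uniform_closure (top_of_set K) (I_ideal K \<rho> lam)"
  have mono: "f \<in> uniform_closure (top_of_set K) I" if "I_ideal K \<rho> lam \<subseteq> I" for I
    using f that unfolding uniform_closure_def by blast
  have "f \<in> R_alg K" using mono[of "R_alg K"] uniform_closure_R_alg
    by (auto simp: I_ideal_def closed_ideal_generated_def)
  moreover have "f \<in> I" if "closed_ideal (top_of_set K) (R_alg K) I" "I_gen K \<rho> lam \<in> I" for I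
    using mono[of I] that by (auto simp: I_ideal_def closed_ideal_generated_def closed_ideal_def)
  ultimately show "f \<in> I_ideal K \<rho> lam" by (simp add: I_ideal_def closed_ideal_generated_def)
qed

lemma I_ideal_antimono:
  assumes lam: "norm lam = 1" and K: "K \<subseteq> cball 0 1" and \<rho>: "0 \<le> \<rho>1" "\<rho>1 \<le> \<rho>2"
  shows "I_ideal K \<rho>2 lam \<subseteq> I_ideal K \<rho>1 lam"
proof -
  have "I_gen K \<rho>2 lam \<in> I" if I: "closed_ideal (top_of_set K) (R_alg K) I" "I_gen K \<rho>1 lam \<in> I" for I
  proof (rule mem_closed_ideal_if_approx[OF I(1) I(2)[unfolded I_gen_eq]])
    show "I_gen K \<rho>2 lam \<in> extensional K" by (simp add: I_gen_eq)
    show "rational_limit K (I_gen K \<rho>2 lam)" using I_gen_in_R_alg[OF lam K] \<rho> by (simp add: R_alg_iff)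
    fix e :: real assume "e > 0"
    then obtain \<phi> where \<phi>: "rational_limit (cball 0 1) \<phi>"
      "\<forall>z\<in>cball 0 1. norm (inner_gen \<rho>2 lam z - inner_gen \<rho>1 lam z * \<phi> z) < e"
      using inner_gen_mult_approx[OF lam \<rho>] by blast
    then show "\<exists>h. rational_limit K h \<and> (\<forall>z\<in>K. norm (I_gen K \<rho>2 lam z - inner_gen \<rho>1 lam z * h z) < e)"
      using K rational_limit_subset by (intro exI[of _ \<phi>]) (auto simp: I_gen_eq)
  qed
  then show ?thesis unfolding I_ideal_def closed_ideal_generated_def by blast
qed

text \<open>Where \<open>f\<close> does not vanish, the generator is relatively close to
  \<open>g z = (z - \<mu>) * \<phi> z\<close>, which has no zeros on \<open>K\<close>. Thus
  \<open>f\<close> is nearly the generator times \<open>f / g\<close>.\<close>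

lemma J_ideal_subset_I_ideal:
  assumes lam: "norm lam = 1" and K: "compact K" "K \<subseteq> cball 0 1" "lam \<in> K" and \<rho>: "0 \<le> \<rho>"
  shows "J_ideal (top_of_set K) (R_alg K) lam \<subseteq> I_ideal K \<rho> lam"
proof
  fix f assume "f \<in> J_ideal (top_of_set K) (R_alg K) lam"
  then obtain U where f: "f \<in> R_alg K" and U: "openin (top_of_set K) U" "lam \<in> U" "\<forall>z\<in>U. f z = 0"
    by (auto simp: J_ideal_def)
  obtain \<delta> where \<delta>: "\<delta> > 0" "\<And>z. z \<in> K \<Longrightarrow> dist z lam < \<delta> \<Longrightarrow> f z = 0"
    using U unfolding openin_euclidean_subtopology_iff by blast
  have rf: "rational_limit K f" using f by (rule R_alg_rational_limit)
  obtain B where B: "B > 0" "\<And>z. z \<in> K \<Longrightarrow> norm (f z) \<le> B" using rational_limit_bounded[OF rf K(1)] by blast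
  have "f \<in> I" if I: "closed_ideal (top_of_set K) (R_alg K) I" "I_gen K \<rho> lam \<in> I" for I
  proof (rule mem_closed_ideal_if_approx[OF I(1) I(2)[unfolded I_gen_eq]])
    show "f \<in> extensional K" "rational_limit K f" using f by (auto simp: R_alg_iff)
    fix e :: real assume e: "e > 0"
    \<comment> \<open>The relative error of the generator will be \<open>3 * d\<close>: one
      \<open>d\<close> from the exponential and two from the linear factor.\<close>
    define d where "d = min 1 (e / (4 * B))"
    have d: "d > 0" "d \<le> 1" "d \<le> e / (4 * B)" using e B by (auto simp: d_def)
    then have dB: "d * B \<le> e / 4" using B by (simp add: field_simps)
    obtain \<phi> \<mu> where \<phi>: "rational_limit (cball 0 1) \<phi>" "norm \<mu> > 1" "\<And>z. z \<in> cball 0 1 \<Longrightarrow> \<phi> z \<noteq> 0"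
      "\<And>z. z \<in> cball 0 1 \<Longrightarrow> dist z lam \<ge> \<delta> \<Longrightarrow> norm (exp (of_real \<rho> * cayley lam z) - \<phi> z) \<le> d * norm (\<phi> z)"
      "\<And>z. z \<in> cball 0 1 \<Longrightarrow> dist z lam \<ge> \<delta> \<Longrightarrow> norm (z - lam - (z - \<mu>)) \<le> d * norm (z - \<mu>)"
      using inner_approx[OF lam \<rho> \<delta>(1) d(1)] by blast
    define g where "g z = (z - \<mu>) * \<phi> z" for z
    have zm: "z - \<mu> \<noteq> 0" if "z \<in> K" for z using that K(2) \<phi>(2) by auto
    have g0: "g z \<noteq> 0" if "z \<in> K" for z using that zm \<phi>(3) K(2) by (auto simp: g_def)
    have rg: "rational_limit K g" unfolding g_def
      using rational_limit_subset[OF \<phi>(1) K(2)] by (intro rational_limit_mult rational_limit_diff_const K(1))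
    have "norm (f z - inner_gen \<rho> lam z * (f z / g z)) < e" if z: "z \<in> K" for z
    proof (cases "dist z lam < \<delta>")
      case True
      then show ?thesis using \<delta>(2) z e by simp
    next
      case False
      define E where "E = exp (of_real \<rho> * cayley lam z)"
      have zc: "z \<in> cball 0 1" using z K(2) by blast
      have 1: "norm (E - \<phi> z) \<le> d * norm (\<phi> z)" "norm ((z - lam) - (z - \<mu>)) \<le> d * norm (z - \<mu>)"
        using \<phi>(4,5)[OF zc] False by (auto simp: E_def)
      have "norm E \<le> 2 * norm (\<phi> z)"
      proof -
        have "d * norm (\<phi> z) \<le> 1 * norm (\<phi> z)" using d by (intro mult_right_mono) auto
        then show ?thesis using 1(1) norm_triangle_sub[of E "\<phi> z"] by linarith
      qed
      have "g z - inner_gen \<rho> lam z = (z - \<mu>) * (\<phi> z - E) - ((z - lam) - (z - \<mu>)) * E"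
        by (simp add: g_def inner_gen_eq E_def algebra_simps)
      then have "norm (g z - inner_gen \<rho> lam z) \<le> norm (z - \<mu>) * norm (E - \<phi> z) + norm ((z - lam) - (z - \<mu>)) * norm E"
        by (metis norm_triangle_ineq4 norm_mult norm_minus_commute)
      also have "\<dots> \<le> norm (z - \<mu>) * (d * norm (\<phi> z)) + (d * norm (z - \<mu>)) * (2 * norm (\<phi> z))"
        using 1 \<open>norm E \<le> 2 * norm (\<phi> z)\<close> d(1) by (intro add_mono mult_mono) auto
      also have "\<dots> = 3 * d * norm (g z)" by (simp add: g_def norm_mult)
      finally have le: "norm (g z - inner_gen \<rho> lam z) \<le> 3 * d * norm (g z)" .
      have "f z - inner_gen \<rho> lam z * (f z / g z) = f z * ((g z - inner_gen \<rho> lam z) / g z)"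
        using g0[OF z] by (simp add: field_simps)
      then have "norm (f z - inner_gen \<rho> lam z * (f z / g z)) = norm (f z) * (norm (g z - inner_gen \<rho> lam z) / norm (g z))"
        by (simp only: norm_mult norm_divide)
      also have "\<dots> \<le> B * (3 * d)"
        using B(2)[OF z] B(1) le g0[OF z] by (intro mult_mono) (auto simp: divide_le_eq)
      also have "\<dots> < e" using dB e by (simp add: algebra_simps)
      finally show ?thesis .
    qed
    then show "\<exists>h. rational_limit K h \<and> (\<forall>z\<in>K. norm (f z - inner_gen \<rho> lam z * h z) < e)"
      using rational_limit_divide[OF rf rg K(1) g0] by blast
  qed
  then show "f \<in> I_ideal K \<rho> lam" using f by (simp add: I_ideal_def closed_ideal_generated_def)
qed

section \<open>Strictness of the chain of ideals\<close>

text \<open>\<open>w exp (- c / w)\<close> differs from \<open>c\<^sup>2 / (2 w)\<close> by a function with a primitive off \<open>0\<close>; the primitive is found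
  by partial integration.\<close>

lemma essential_residue:
  assumes l: "l > 0"
  shows "square_integral (lam - Complex (l/2) (l/2)) l (\<lambda>z. (z - lam) * exp (- c / (z - lam))) = of_real pi * \<i> * c\<^sup>2"
proof -
  define f where "f v = exp (- c * v)" for v :: complex
  \<comment> \<open>The difference quotient of \<open>f\<close> at 0 with its removable singularity
    filled in. It is entire, hence has a primitive \<open>P\<close>.\<close>
  define h where "h v = (if v = 0 then deriv f 0 else (f v - f 0) / (v - 0))" for v
  have "f holomorphic_on UNIV" unfolding f_def by (intro holomorphic_intros)
  then have "h holomorphic_on UNIV" unfolding h_def[abs_def] by (intro pole_lemma_open) auto
  then obtain P where P: "\<And>v. (P has_field_derivative h v) (at v)"
    using holomorphic_convex_primitive'[of UNIV h] by auto
  \<comment> \<open>With \<open>E = exp (- c / w)\<close>, two partial integrations reduce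
    \<open>w * E\<close> to \<open>c\<^sup>2 / 2 * E / w\<close>. There \<open>E / w\<close> differs
    from \<open>1 / w\<close> by \<open>(E - 1) / w\<close>, the derivative of
    \<open>- P (1 / w)\<close>.\<close>
  define \<Psi> where "\<Psi> z = (z - lam)\<^sup>2 * exp (- c / (z - lam)) / 2 - c / 2 * ((z - lam) * exp (- c / (z - lam)))
      - c\<^sup>2 / 2 * P (1 / (z - lam))" for z
  define g where "g z = (z - lam) * exp (- c / (z - lam)) - c\<^sup>2 / 2 * (1 / (z - lam))" for z
  have \<Psi>: "(\<Psi> has_field_derivative g z) (at z within - {lam})" if "z \<in> - {lam}" for z
  proof -
    define w where "w = z - lam"
    have w: "w \<noteq> 0" using that by (simp add: w_def)
    have "(P has_field_derivative h (1 / w)) (at (1 / (z - lam)))" using P[of "1 / w"] by (simp add: w_def)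
    then have dP: "((\<lambda>z. P (1 / (z - lam))) has_field_derivative h (1 / w) * (- 1 / w\<^sup>2)) (at z)"
      by (rule DERIV_chain2) (use w in \<open>auto intro!: derivative_eq_intros simp: w_def power2_eq_square\<close>)
    have dE: "((\<lambda>z. exp (- c / (z - lam))) has_field_derivative exp (- c / w) * (c / w\<^sup>2)) (at z)"
      using w by (auto intro!: derivative_eq_intros simp: w_def power2_eq_square)
    have d1: "((\<lambda>z. (z - lam)\<^sup>2) has_field_derivative 2 * w) (at z)" "((\<lambda>z. z - lam) has_field_derivative 1) (at z)"
      by (auto intro!: derivative_eq_intros simp: w_def)
    have hw: "h (1 / w) = (exp (- c / w) - 1) * w" using w by (simp add: h_def f_def)
    have alg: "(2 * w * E + E * (c / w\<^sup>2) * w\<^sup>2) / 2 - c / 2 * (1 * E + E * (c / w\<^sup>2) * w) - c\<^sup>2 / 2 * ((E - 1) * w * (- 1 / w\<^sup>2))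
        = w * E - c\<^sup>2 / 2 * (1 / w)" for E using w by (simp add: field_simps power2_eq_square)
    have "(\<Psi> has_field_derivative g z) (at z)" unfolding \<Psi>_def[abs_def] g_def
      by (rule DERIV_cong[OF DERIV_diff[OF DERIV_diff[OF DERIV_cdivide[OF DERIV_mult[OF d1(1) dE]]
          DERIV_cmult[OF DERIV_mult[OF d1(2) dE]]] DERIV_cmult[OF dP]]])
        (unfold hw w_def[symmetric], rule alg)
    then show ?thesis by (rule has_field_derivative_at_within)
  qed
  define a where "a = lam - Complex (l/2) (l/2)"
  have lb: "lam \<in> box a (a + Complex l l)" using l by (simp add: a_def in_box_complex_iff)
  have lp: "lam \<notin> path_image (rectpath a (a + Complex l l))"
    using lb path_image_rectpath_inter_box[of a "a + Complex l l"] l by auto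
  have le: "lam \<notin> square_edges a l"
    using l by (auto simp: square_edges_def a_def closed_segment_same_Im closed_segment_same_Re)
  have cg: "continuous_on (square_edges a l) g" unfolding g_def using le by (intro continuous_intros) auto
  have ci: "continuous_on (square_edges a l) (\<lambda>z. 1 / (z - lam))" using le by (intro continuous_intros) auto
  have cc: "continuous_on (square_edges a l) (\<lambda>z. c\<^sup>2 / 2 * (1 / (z - lam)))" using le by (intro continuous_intros) auto
  have "(g has_contour_integral 0) (rectpath a (a + Complex l l))"
    by (rule Cauchy_theorem_primitive[OF \<Psi>]) (use lp in auto)
  then have 0: "square_integral a l g = 0"
    using square_integral_eq_rectpath[OF cg] contour_integral_unique by metis
  have "square_integral a l (\<lambda>z. 1 / (z - lam)) = 2 * pi * \<i> * winding_number (rectpath a (a + Complex l l)) lam"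
    using square_integral_eq_rectpath[OF ci] winding_number_valid_path[OF valid_path_rectpath lp] by simp
  also have "winding_number (rectpath a (a + Complex l l)) lam = 1" using lb by (rule winding_number_rectpath)
  finally have 1: "square_integral a l (\<lambda>z. 1 / (z - lam)) = 2 * pi * \<i>" by simp
  have "square_integral a l (\<lambda>z. (z - lam) * exp (- c / (z - lam)))
      = square_integral a l (\<lambda>z. g z + c\<^sup>2 / 2 * (1 / (z - lam)))" by (simp add: g_def)
  also have "\<dots> = square_integral a l g + c\<^sup>2 / 2 * square_integral a l (\<lambda>z. 1 / (z - lam))"
    unfolding square_integral_add[OF cg cc] square_integral_cmult[OF ci] ..
  finally have "square_integral a l (\<lambda>z. (z - lam) * exp (- c / (z - lam))) = of_real pi * \<i> * c\<^sup>2" unfolding 0 1 by simp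
  then show ?thesis by (simp only: a_def)
qed

text \<open>After division by \<open>exp (of_real \<rho>2 * cayley lam z)\<close> a good
  approximation would give a function \<open>H\<close> small on \<open>K\<close> up to a factor
  \<open>exp (2 * \<rho>2 / dist z lam)\<close>. The discs are small enough for
  \<open>residue_bound_by_cheese\<close>, so the integral of \<open>H\<close> around
  \<open>lam\<close> would be small; but the rational part contributes nothing and the essential
  singularity a fixed amount.\<close>

lemma inner_gen_not_approx:
  fixes D :: "(complex \<times> real) set"
  assumes lam: "norm lam = 1"
    and pos: "\<And>d. d \<in> D \<Longrightarrow> snd d > 0"
    and away: "\<And>d. d \<in> D \<Longrightarrow> 3 * snd d < dist (fst d) lam"
    and sums: "\<And>N. N \<ge> 0 \<Longrightarrow> \<exists>C. sums_bounded (\<lambda>d. snd d * exp (N / (dist (fst d) lam - 3 * snd d))) D C"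
    and K: "K = cball 0 1 - (\<Union>(c,r)\<in>D. ball c r)"
    and \<rho>: "0 \<le> \<rho>1" "\<rho>1 < \<rho>2"
  shows "\<exists>\<eta>>0. \<forall>p q. (\<forall>z\<in>K. poly q z \<noteq> 0) \<longrightarrow>
    (\<exists>z\<in>K. \<eta> \<le> norm (inner_gen \<rho>1 lam z - inner_gen \<rho>2 lam z * (poly p z / poly q z)))"
proof -
  define \<sigma> where "\<sigma> = \<rho>2 - \<rho>1"
  have \<sigma>: "\<sigma> > 0" using \<rho> by (simp add: \<sigma>_def)
  obtain C where C: "sums_bounded (\<lambda>d. snd d * exp (2 * \<rho>2 / (dist (fst d) lam - 3 * snd d))) D C"
    using sums[of "2 * \<rho>2"] \<rho> by auto
  have C0: "C \<ge> 0" using C by (rule sums_bounded_nonneg)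
  \<comment> \<open>The modulus of the integral to be computed, from
    \<open>essential_residue\<close> with \<open>c = 2 * \<sigma> * lam\<close> and the constant
    part 1 of \<open>cayley\<close>.\<close>
  define L where "L = exp (- \<sigma>) * pi * (2 * \<sigma>)\<^sup>2"
  have L: "L > 0" using \<sigma> by (simp add: L_def)
  define \<eta> where "\<eta> = L / (4 * (392 * C + 7744))"
  have \<eta>: "\<eta> > 0" "2 * \<eta> * (392 * C + 7744) < L" 
  proof -
    have X: "392 * C + 7744 > 0" using C0 by linarith
    then show "\<eta> > 0" using L by (simp add: \<eta>_def)
    have "2 * (L / (4 * x)) * x = L / 2" if "x > 0" for x using that by simp
    then have "2 * \<eta> * (392 * C + 7744) = L / 2" using X unfolding \<eta>_def by blast
    then show "2 * \<eta> * (392 * C + 7744) < L" using L by linarith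
  qed
  have "\<exists>z\<in>K. \<eta> \<le> norm (inner_gen \<rho>1 lam z - inner_gen \<rho>2 lam z * (poly p z / poly q z))"
    if q: "\<forall>z\<in>K. poly q z \<noteq> 0" for p q
  proof (rule ccontr)
    assume "\<not> ?thesis"
    then have small: "\<And>z. z \<in> K \<Longrightarrow> norm (inner_gen \<rho>1 lam z - inner_gen \<rho>2 lam z * (poly p z / poly q z)) < \<eta>"
      by force
    \<comment> \<open>As \<open>q\<close> has no zero at \<open>lam\<close>, only the exponential
      term contributes to the integral around \<open>lam\<close>.\<close>
    define H where "H z = (z - lam) * exp (- of_real \<sigma> * cayley lam z) - (z - lam) * (poly p z / poly q z)" for z
    \<comment> \<open>\<open>norm (H z) * m z\<close> is the smaller of \<open>norm (H z)\<close> and of the error whose bound on \<open>K\<close> is \<open>\<eta>\<close>. Unlike the two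
      separately, it is continuous at \<open>lam\<close>.\<close>
    define m where "m z = min 1 (norm (exp (of_real \<rho>2 * cayley lam z)))" for z
    have lamK: "lam \<in> K"
    proof -
      have "lam \<notin> ball c r" if "(c, r) \<in> D" for c r using pos[OF that] away[OF that] by simp
      then show ?thesis using lam by (auto simp: K)
    qed
    have F: "H z * exp (of_real \<rho>2 * cayley lam z) = inner_gen \<rho>1 lam z - inner_gen \<rho>2 lam z * (poly p z / poly q z)" for z
    proof -
      have "exp (- of_real \<sigma> * cayley lam z) * exp (of_real \<rho>2 * cayley lam z) = exp (of_real \<rho>1 * cayley lam z)"
        by (simp add: \<sigma>_def exp_add[symmetric] algebra_simps)
      moreover have "H z * exp (of_real \<rho>2 * cayley lam z)
          = (z - lam) * (exp (- of_real \<sigma> * cayley lam z) * exp (of_real \<rho>2 * cayley lam z))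
            - (z - lam) * exp (of_real \<rho>2 * cayley lam z) * (poly p z / poly q z)"
      proof -
        have "(d * A - d * B) * E = d * (A * E) - d * E * B" for d A B E :: complex by (simp add: algebra_simps)
        then show ?thesis unfolding H_def .
      qed
      ultimately show ?thesis by (simp only: inner_gen_eq)
    qed
    \<comment> \<open>A continuous majorant that is 0 at \<open>lam\<close>; it brings a full
      neighbourhood of \<open>lam\<close> into the open set \<open>W\<close>.\<close>
    define k where "k z = dist z lam * (1 + norm (poly p z / poly q z))" for z
    have Hm: "norm (H z) * m z \<le> k z" for z
    proof (cases "norm z \<le> 1")
      case True
      have "norm (H z) * m z \<le> norm (H z) * norm (exp (of_real \<rho>2 * cayley lam z))"
        unfolding m_def by (intro mult_left_mono) auto
      also have "\<dots> = norm (inner_gen \<rho>1 lam z - inner_gen \<rho>2 lam z * (poly p z / poly q z))"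
        by (simp only: norm_mult[symmetric] F)
      also have "\<dots> \<le> norm (inner_gen \<rho>1 lam z) + norm (inner_gen \<rho>2 lam z) * norm (poly p z / poly q z)"
        by (metis norm_triangle_ineq4 norm_mult)
      also have "\<dots> \<le> dist z lam * 1 + dist z lam * 1 * norm (poly p z / poly q z)"
        unfolding inner_gen_eq norm_mult dist_norm using True lam \<rho>
        by (intro add_mono mult_right_mono mult_left_mono norm_exp_cayley_le) auto
      finally show ?thesis by (simp add: k_def algebra_simps)
    next
      case False
      have "norm (exp (- of_real \<sigma> * cayley lam z)) \<le> 1"
      proof -
        have "1\<^sup>2 \<le> (norm z)\<^sup>2" using False by (intro power_mono) auto
        then have "0 \<le> \<sigma> * Re (cayley lam z)" using \<sigma> lam by (simp add: Re_cayley)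
        then show ?thesis by (simp add: norm_exp_eq_Re)
      qed
      then have "norm ((z - lam) * exp (- of_real \<sigma> * cayley lam z)) \<le> dist z lam * 1"
        unfolding norm_mult dist_norm by (intro mult_left_mono) auto
      moreover have "norm ((z - lam) * (poly p z / poly q z)) = dist z lam * norm (poly p z / poly q z)"
        by (simp only: norm_mult dist_norm)
      ultimately have "norm (H z) \<le> dist z lam * 1 + dist z lam * norm (poly p z / poly q z)"
        unfolding H_def
        using norm_triangle_ineq4[of "(z - lam) * exp (- of_real \<sigma> * cayley lam z)" "(z - lam) * (poly p z / poly q z)"]
        by linarith
      moreover have "norm (H z) * m z \<le> norm (H z) * 1" unfolding m_def by (intro mult_left_mono) auto
      ultimately show ?thesis by (simp add: k_def algebra_simps)
    qed
    define V where "V = {z. poly q z \<noteq> 0}"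
    have V: "open V"
    proof -
      have "V = - (poly q -` {0})" by (auto simp: V_def)
      moreover have "closed (poly q -` {0})" by (intro closed_vimage continuous_on_poly continuous_on_id) auto
      ultimately show ?thesis by (simp add: open_Compl)
    qed
    have lamV: "lam \<in> V" using q lamK by (auto simp: V_def)
    have V': "open (V - {lam})" using V by (simp add: open_delete)
    have Hcont: "continuous_on (V - {lam}) (\<lambda>z. norm (H z) * m z)"
      unfolding H_def m_def cayley_def V_def by (intro continuous_intros) auto
    have kcont: "continuous_on V k" unfolding k_def V_def by (intro continuous_intros) auto
    \<comment> \<open>Doubling \<open>\<eta>\<close> leaves room for an open neighbourhood of
      \<open>K\<close>.\<close>
    define W where "W = {z \<in> V - {lam}. norm (H z) * m z < 2 * \<eta>} \<union> {z \<in> V. k z < 2 * \<eta>}"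
    have "open W" unfolding W_def
      using continuous_on_open_vimage[OF V'] continuous_on_open_vimage[OF V] Hcont kcont
        continuous_open_preimage[OF Hcont V', of "{..< 2 * \<eta>}"] continuous_open_preimage[OF kcont V, of "{..< 2 * \<eta>}"]
      by (intro open_Un) (auto simp: vimage_def Int_def)
    have WV: "W \<subseteq> V" by (auto simp: W_def)
    have Wm: "norm (H z) * m z \<le> 2 * \<eta>" if "z \<in> W - {lam}" for z
      using that Hm[of z] by (auto simp: W_def)
    have "K \<subseteq> W"
    proof
      fix z assume z: "z \<in> K"
      show "z \<in> W"
      proof (cases "z = lam")
        case True
        then show ?thesis using lamV \<eta> by (simp add: W_def k_def)
      next
        case False
        have "norm (H z) * m z \<le> norm (H z * exp (of_real \<rho>2 * cayley lam z))"
          unfolding m_def norm_mult by (intro mult_left_mono) auto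
        also have "\<dots> < \<eta>" unfolding F by (rule small[OF z])
        finally show ?thesis using False z q \<eta>(1) by (auto simp: W_def V_def)
      qed
    qed
    have holH: "H holomorphic_on W - {lam}"
      unfolding H_def cayley_def using WV by (intro holomorphic_intros) (auto simp: V_def)
    have b2: "norm (H z) \<le> 2 * \<eta>" if z: "z \<in> W - {lam}" "norm z \<ge> 1" for z
    proof -
      have "1\<^sup>2 \<le> (norm z)\<^sup>2" using z by (intro power_mono) auto
      then have "0 \<le> \<rho>2 * Re (cayley lam z)" using \<rho> lam by (simp add: Re_cayley)
      then have "m z = 1" by (simp add: m_def norm_exp_eq_Re)
      then show ?thesis using Wm[OF z(1)] by simp
    qed
    \<comment> \<open>Inside the disc \<open>1 - (norm z)\<^sup>2 \<le> 2 * dist z lam\<close>, so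
      the inner function decays no faster than
      \<open>exp (- 2 * \<rho>2 / dist z lam)\<close>.\<close>
    have b1: "norm (H z) \<le> 2 * \<eta> * exp (2 * \<rho>2 / dist z lam)" if z: "z \<in> W - {lam}" for z
    proof (cases "norm z \<ge> 1")
      case True
      have "2 * \<eta> * 1 \<le> 2 * \<eta> * exp (2 * \<rho>2 / dist z lam)" using \<eta> \<rho> by (intro mult_left_mono) auto
      then show ?thesis using b2[OF z True] by linarith
    next
      case False
      have dl: "dist z lam > 0" using z by simp
      have "1 - norm z \<le> dist z lam" using norm_triangle_ineq2[of lam z] lam by (simp add: dist_norm norm_minus_commute)
      then have "(1 - norm z) * (1 + norm z) \<le> dist z lam * 2" using False by (intro mult_mono) auto
      then have "1 - (norm z)\<^sup>2 \<le> dist z lam * 2" by (simp add: power2_eq_square algebra_simps)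
      then have "(1 - (norm z)\<^sup>2) / (dist z lam)\<^sup>2 \<le> dist z lam * 2 / (dist z lam)\<^sup>2" by (intro divide_right_mono) auto
      also have "\<dots> = 2 / dist z lam" using dl by (simp add: power2_eq_square)
      finally have "- Re (cayley lam z) \<le> 2 / dist z lam" unfolding Re_cayley lam
        by (simp add: dist_norm minus_divide_left)
      then have R: "- (\<rho>2 * Re (cayley lam z)) \<le> 2 * \<rho>2 / dist z lam"
        using \<rho> mult_left_mono[of "- Re (cayley lam z)" "2 / dist z lam" \<rho>2] by (simp add: mult_ac)
      have "exp (- (2 * \<rho>2 / dist z lam)) \<le> m z"
        using R \<rho> by (auto simp: m_def norm_exp_eq_Re)
      then have "norm (H z) * exp (- (2 * \<rho>2 / dist z lam)) \<le> norm (H z) * m z" by (intro mult_left_mono) auto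
      then have "norm (H z) * exp (- (2 * \<rho>2 / dist z lam)) \<le> 2 * \<eta>" using Wm[OF z] by linarith
      then have "norm (H z) * exp (- (2 * \<rho>2 / dist z lam)) * exp (2 * \<rho>2 / dist z lam) \<le> 2 * \<eta> * exp (2 * \<rho>2 / dist z lam)"
        by (intro mult_right_mono) auto
      then show ?thesis by (simp add: mult.assoc exp_add[symmetric])
    qed
    have "\<exists>l0>0. \<forall>l. 0 < l \<and> l < l0 \<longrightarrow>
      norm (square_integral (lam - Complex (l/2) (l/2)) l H) \<le> 2 * \<eta> * (392 * C + 7744)"
    proof (rule residue_bound_by_cheese[OF lam pos away])
      show "(\<Sum>d\<in>F. snd d * exp (2 * \<rho>2 / (dist (fst d) lam - 3 * snd d))) \<le> C" if "finite F" "F \<subseteq> D" for F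
        using sums_boundedD[OF C that] .
      show "cball 0 1 - (\<Union>(c,r)\<in>D. ball c r) \<subseteq> W" using \<open>K \<subseteq> W\<close> K by simp
    qed (use \<rho> \<open>open W\<close> holH b1 b2 \<eta> in auto)
    then obtain l0 where l0: "l0 > 0" "\<And>l. 0 < l \<Longrightarrow> l < l0 \<Longrightarrow>
      norm (square_integral (lam - Complex (l/2) (l/2)) l H) \<le> 2 * \<eta> * (392 * C + 7744)" by blast
    obtain e where e: "e > 0" "ball lam e \<subseteq> V" using V lamV by (meson openE)
    define l where "l = min (l0 / 2) (e / 4)"
    have l: "0 < l" "l < l0" "2 * l < e" using l0 e by (auto simp: l_def)
    define a where "a = lam - Complex (l/2) (l/2)"
    have sq: "square a l \<subseteq> V"
    proof
      fix z assume "z \<in> square a l"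
      moreover have "lam \<in> square a l" using l by (simp add: a_def mem_square)
      ultimately have "dist lam z \<le> 2 * l" by (intro dist_square_corner)
      then show "z \<in> V" using e(2) l(3) by (auto simp: subset_iff)
    qed
    have le: "lam \<notin> square_edges a l"
      using l by (auto simp: square_edges_def a_def closed_segment_same_Im closed_segment_same_Re)
    have h2: "(\<lambda>z. (z - lam) * (poly p z / poly q z)) holomorphic_on square a l"
      using sq by (intro holomorphic_intros) (auto simp: V_def)
    have c2: "continuous_on (square_edges a l) (\<lambda>z. (z - lam) * (poly p z / poly q z))"
      by (rule continuous_on_subset[OF holomorphic_on_imp_continuous_on[OF h2] square_edges_subset]) (use l(1) in simp)
    define E where "E z = (z - lam) * exp (- (2 * of_real \<sigma> * lam) / (z - lam))" for z
    have cE: "continuous_on (square_edges a l) E" unfolding E_def using le by (intro continuous_intros) auto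
    have c1: "continuous_on (square_edges a l) (\<lambda>z. exp (- of_real \<sigma>) * E z)" by (rule continuous_on_mult_left[OF cE])
    have "square_integral a l H = square_integral a l (\<lambda>z. exp (- of_real \<sigma>) * E z - (z - lam) * (poly p z / poly q z))"
    proof (rule square_integral_cong)
      fix z assume "z \<in> square_edges a l"
      then have "z \<noteq> lam" using le by auto
      then have "exp (- of_real \<sigma> * cayley lam z) = exp (- of_real \<sigma>) * exp (- (2 * of_real \<sigma> * lam) / (z - lam))"
        by (simp add: cayley_alt exp_add[symmetric] algebra_simps)
      then show "H z = exp (- of_real \<sigma>) * E z - (z - lam) * (poly p z / poly q z)"
        by (simp add: H_def E_def)
    qed
    also have "\<dots> = exp (- of_real \<sigma>) * square_integral a l E"
      unfolding square_integral_diff[OF c1 c2] square_integral_cmult[OF cE]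
      using square_integral_holomorphic[OF h2] l by simp
    also have "square_integral a l E = of_real pi * \<i> * (2 * of_real \<sigma> * lam)\<^sup>2"
      unfolding a_def E_def by (rule essential_residue[OF l(1)])
    finally have "norm (square_integral a l H) = L"
      unfolding L_def using lam \<sigma> by (simp add: norm_mult norm_power norm_exp_eq_Re)
    then show False using l0(2)[OF l(1,2)] \<eta>(2) by (simp add: a_def)
  qed
  then show ?thesis using \<eta>(1) by blast
qed

text \<open>Strictness is witnessed by the generator for \<open>\<rho>1\<close>, which is not a
  uniform limit of multiples of the generator for \<open>\<rho>2\<close>.\<close>

lemma I_ideal_strict_antimono:
  fixes D :: "(complex \<times> real) set"
  assumes lam: "norm lam = 1"
    and pos: "\<And>d. d \<in> D \<Longrightarrow> snd d > 0"
    and away: "\<And>d. d \<in> D \<Longrightarrow> 3 * snd d < dist (fst d) lam"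
    and sums: "\<And>N. N \<ge> 0 \<Longrightarrow> \<exists>C. sums_bounded (\<lambda>d. snd d * exp (N / (dist (fst d) lam - 3 * snd d))) D C"
    and K: "K = cball 0 1 - (\<Union>(c,r)\<in>D. ball c r)"
    and \<rho>: "0 \<le> \<rho>1" "\<rho>1 < \<rho>2"
  shows "I_ideal K \<rho>2 lam \<subset> I_ideal K \<rho>1 lam"
proof (rule psubsetI)
  have K1: "K \<subseteq> cball 0 1" "compact K" using K by (auto intro!: compact_diff)
  show "I_ideal K \<rho>2 lam \<subseteq> I_ideal K \<rho>1 lam" using I_ideal_antimono[OF lam K1(1)] \<rho> by simp
  let ?I = "{f \<in> R_alg K. \<forall>e>0. \<exists>h. rational_limit K h \<and> (\<forall>z\<in>K. norm (f z - inner_gen \<rho>2 lam z * h z) < e)}"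
  have g: "rational_limit K (inner_gen \<rho>2 lam)"
    using rational_limit_inner_gen[OF lam] rational_limit_subset K1(1) \<rho> by (meson less_imp_le order_trans)
  have "I_gen K \<rho>2 lam \<in> ?I"
    using I_gen_in_R_alg[OF lam K1(1), of \<rho>2] \<rho> rational_limit_const[of K 1]
    by (auto simp: I_gen_eq intro!: exI[of _ "\<lambda>_. 1"])
  then have sub: "I_ideal K \<rho>2 lam \<subseteq> ?I"
    using closed_ideal_approx_multiples[OF K1(2) g] unfolding I_ideal_def closed_ideal_generated_def by blast
  obtain \<eta> where \<eta>: "\<eta> > 0" "\<And>p q. \<forall>z\<in>K. poly q z \<noteq> 0 \<Longrightarrow>
    \<exists>z\<in>K. \<eta> \<le> norm (inner_gen \<rho>1 lam z - inner_gen \<rho>2 lam z * (poly p z / poly q z))"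
    using inner_gen_not_approx[OF lam pos away sums K \<rho>] by blast
  have "I_gen K \<rho>1 lam \<notin> ?I"
  proof
    assume "I_gen K \<rho>1 lam \<in> ?I"
    moreover have "\<eta>/2 > 0" using \<eta> by simp
    ultimately obtain h where h: "rational_limit K h" "\<forall>z\<in>K. norm (I_gen K \<rho>1 lam z - inner_gen \<rho>2 lam z * h z) < \<eta>/2" by blast
    \<comment> \<open>The generator is bounded by 2, so an error \<open>\<eta>/4\<close> in the
      multiplier costs at most \<open>\<eta>/2\<close>.\<close>
    obtain q p where q: "\<forall>z\<in>K. poly q z \<noteq> 0" and p: "\<forall>z\<in>K. norm (h z - poly p z / poly q z) < \<eta>/4"
      by (rule rational_limitE[OF h(1), of "\<eta>/4"]) (use \<eta> in auto)
    have "norm (inner_gen \<rho>1 lam z - inner_gen \<rho>2 lam z * (poly p z / poly q z)) < \<eta>" if z: "z \<in> K" for z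
    proof -
      have "norm z \<le> 1" using z K1(1) by auto
      then have "norm (exp (of_real \<rho>2 * cayley lam z)) \<le> 1" using lam \<rho> by (intro norm_exp_cayley_le) auto
      moreover have "norm (z - lam) \<le> 2" using \<open>norm z \<le> 1\<close> lam norm_triangle_ineq4[of z lam] by simp
      ultimately have g2: "norm (inner_gen \<rho>2 lam z) \<le> 2 * 1"
        unfolding inner_gen_eq norm_mult by (intro mult_mono) auto
      have "norm (inner_gen \<rho>2 lam z * (h z - poly p z / poly q z)) \<le> 2 * 1 * norm (h z - poly p z / poly q z)"
        unfolding norm_mult using g2 by (intro mult_right_mono) auto
      also have "\<dots> < \<eta>/2" using p[rule_format, OF z] by simp
      finally have "norm (inner_gen \<rho>2 lam z * (h z - poly p z / poly q z)) < \<eta>/2" .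
      moreover have "norm (inner_gen \<rho>1 lam z - inner_gen \<rho>2 lam z * h z) < \<eta>/2" using h(2) z by (auto simp: I_gen_eq)
      moreover have "inner_gen \<rho>1 lam z - inner_gen \<rho>2 lam z * (poly p z / poly q z)
          = (inner_gen \<rho>1 lam z - inner_gen \<rho>2 lam z * h z) + inner_gen \<rho>2 lam z * (h z - poly p z / poly q z)"
        by (simp add: algebra_simps)
      ultimately show ?thesis
        using norm_triangle_lt[of "inner_gen \<rho>1 lam z - inner_gen \<rho>2 lam z * h z" "inner_gen \<rho>2 lam z * (h z - poly p z / poly q z)" \<eta>]
        by (simp only:)
    qed
    then show False using \<eta>(2)[OF q] by (meson not_less)
  qed
  then show "I_ideal K \<rho>2 lam \<noteq> I_ideal K \<rho>1 lam"
    using sub I_gen_in_I_ideal[OF lam K1(1) \<rho>(1)] by blast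
qed

text \<open>Strong regularity would squeeze the maximal ideal into the ideal for exponent 1; but it
  contains \<open>z - lam\<close>, the generator for exponent 0.\<close>

lemma not_strongly_regular_at_if_ideals_strict:
  assumes lam: "norm lam = 1" and K: "compact K" "K \<subseteq> cball 0 1" "lam \<in> K"
    and strict: "I_ideal K 1 lam \<subset> I_ideal K 0 lam"
  shows "\<not> strongly_regular_at (top_of_set K) (R_alg K) lam"
proof
  assume "strongly_regular_at (top_of_set K) (R_alg K) lam"
  then have "M_ideal (R_alg K) lam = uniform_closure (top_of_set K) (J_ideal (top_of_set K) (R_alg K) lam)"
    by (simp add: strongly_regular_at_def)
  also have "\<dots> \<subseteq> uniform_closure (top_of_set K) (I_ideal K 1 lam)"
    using J_ideal_subset_I_ideal[OF lam K, of 1] by (intro uniform_closure_mono) simp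
  also have "\<dots> \<subseteq> I_ideal K 1 lam" by (rule uniform_closure_I_ideal[OF K(1) lam K(2)]) simp
  finally have sub: "M_ideal (R_alg K) lam \<subseteq> I_ideal K 1 lam" .
  have "I_gen K 0 lam \<in> M_ideal (R_alg K) lam"
    using I_gen_in_R_alg[OF lam K(2), of 0] K(3) by (simp add: M_ideal_def I_gen_eq inner_gen_def)
  then have "I_gen K 0 lam \<in> I_ideal K 1 lam" using sub by blast
  then have "I_ideal K 0 lam \<subseteq> I_ideal K 1 lam" unfolding I_ideal_def closed_ideal_generated_def by blast
  with strict show False by blast
qed

section \<open>Arcs of small measure\<close>

lemma inj_on_cis: "inj_on cis {0..<2 * pi}"
proof (rule inj_onI)
  fix x y assume xy: "x \<in> {0..<2 * pi}" "y \<in> {0..<2 * pi}" "cis x = cis y"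
  then obtain n :: int where n: "x = y + 2 * pi * n" using sin_cos_eq_iff[of x y] by (auto simp: complex_eq_iff)
  have "\<bar>x - y\<bar> < 2 * pi" using xy(1,2) by auto
  then have "2 * pi * \<bar>real_of_int n\<bar> < 2 * pi * 1" using n by (simp add: abs_mult)
  then have "\<bar>real_of_int n\<bar> < 1" using mult_less_cancel_left_pos[of "2 * pi"] pi_gt_zero by simp
  then have "n = 0" by linarith
  then show "x = y" using n by simp
qed

text \<open>On the unit circle \<open>cnj z = 1 / z\<close>, so the equation becomes quadratic in
  \<open>z\<close>, and nontrivial since \<open>a\<close> is not 0.\<close>

lemma finite_circle_inter_circle:
  fixes a :: complex
  assumes a: "a \<noteq> 0"
  shows "finite {z \<in> sphere 0 1. dist z a = s}"
proof -
  define k where "k = 1 + (norm a)\<^sup>2 - s\<^sup>2"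
  define p where "p = [:a, - of_real k, cnj a:]"
  have fin: "finite {z. poly p z = 0}" using a by (intro poly_roots_finite) (simp add: p_def)
  have "{z \<in> sphere 0 1. dist z a = s} \<subseteq> {z. poly p z = 0}"
  proof (rule subsetI)
    fix z assume "z \<in> {z \<in> sphere 0 1. dist z a = s}"
    then have z: "z \<in> sphere 0 1" "dist z a = s" by auto
    have zz: "z * cnj z = 1" using z(1) complex_norm_square[of z] by (simp add: dist_norm)
    have "of_real (s\<^sup>2) = (z - a) * cnj (z - a)" using z(2) complex_norm_square[of "z - a"] by (simp add: dist_norm)
    also have "\<dots> = z * cnj z + a * cnj a - (z * cnj a + a * cnj z)" by (simp add: algebra_simps)
    also have "a * cnj a = of_real ((norm a)\<^sup>2)" by (rule complex_norm_square[symmetric])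
    finally have "of_real k = z * cnj a + a * cnj z" unfolding zz k_def by (simp add: algebra_simps)
    then have "of_real k * z = z * z * cnj a + a * (z * cnj z)" by (simp add: algebra_simps)
    then show "z \<in> {z. poly p z = 0}" unfolding zz p_def by (simp add: algebra_simps)
  qed
  then show ?thesis using fin by (rule finite_subset)
qed

text \<open>The measure before completion, where every set is a trace of a Borel set and measures
  can be read off in the angle.\<close>

definition circle_distr :: "complex measure" where
  "circle_distr = distr (restrict_space lborel {0..<2 * pi}) (restrict_space borel (sphere 0 1)) cis"

lemma cis_measurable: "cis \<in> measurable (restrict_space lborel {0..<2 * pi}) (restrict_space borel (sphere 0 1))"
proof (rule measurable_restrict_space2)
  have "cis \<in> borel_measurable borel" by (intro borel_measurable_continuous_onI continuous_on_cis continuous_on_id)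
  then show "cis \<in> borel_measurable (restrict_space lborel {0..<2 * pi})"
    by (intro measurable_restrict_space1) simp
qed (auto simp: space_restrict_space)

lemma closed_sphere_sets: "closed A \<Longrightarrow> sphere 0 1 \<inter> A \<in> sets circle_distr"
  unfolding circle_distr_def by (auto simp: sets_restrict_space)

lemma emeasure_circle_distr:
  assumes "A \<in> sets circle_distr"
  shows "emeasure circle_distr A = emeasure lborel (cis -` A \<inter> {0..<2 * pi})"
proof -
  have "emeasure circle_distr A = emeasure (restrict_space lborel {0..<2 * pi}) (cis -` A \<inter> {0..<2 * pi})"
    using assms unfolding circle_distr_def
    by (subst emeasure_distr[OF cis_measurable]) (auto simp: space_restrict_space)
  then show ?thesis by (simp add: emeasure_restrict_space)
qed

lemma circle_measure_eq:
  "sets circle_distr \<subseteq> sets circle_measure"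
  "A \<in> sets circle_distr \<Longrightarrow> emeasure circle_measure A = emeasure circle_distr A"
  unfolding circle_measure_def circle_distr_def[symmetric] by auto

text \<open>The closed annuli shrink to a circle, which meets the unit circle in finitely many
  points; continuity from above finishes. The width \<open>2 * w\<close> leaves a margin
  \<open>w\<close> beyond discs contained in the annulus of half-width \<open>w\<close>.\<close>

lemma circle_annulus_small:
  fixes a :: complex
  assumes a: "a \<noteq> 0" and s: "s > 0" and e: "e > 0"
  shows "\<exists>w>0. w < s \<and> w \<le> s / 2 \<and>
    emeasure circle_distr (sphere 0 1 \<inter> {z. \<bar>dist z a - s\<bar> \<le> 2 * w}) < ennreal e"
proof -
  define A where "A n = sphere 0 1 \<inter> {z. \<bar>dist z a - s\<bar> \<le> 2 * (s / 2 / real (Suc n))}" for n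
  have cl: "closed {z. \<bar>dist z a - s\<bar> \<le> x}" for x by (intro closed_Collect_le continuous_intros)
  have A: "A n \<in> sets circle_distr" for n unfolding A_def by (rule closed_sphere_sets[OF cl])
  have "(\<lambda>n. emeasure circle_distr (A n)) \<longlonglongrightarrow> emeasure circle_distr (\<Inter>n. A n)"
  proof (rule Lim_emeasure_decseq)
    show "decseq A"
    proof (rule decseq_SucI, rule subsetI)
      fix n z assume "z \<in> A (Suc n)"
      moreover have "s / 2 / real (Suc (Suc n)) \<le> s / 2 / real (Suc n)" using s by (intro divide_left_mono) auto
      ultimately show "z \<in> A n" by (auto simp: A_def)
    qed
    show "emeasure circle_distr (A n) \<noteq> \<infinity>" for n
    proof -
      have "emeasure circle_distr (A n) \<le> emeasure lborel {0..<2 * pi}"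
        unfolding emeasure_circle_distr[OF A] by (rule emeasure_mono) auto
      then show ?thesis by (auto simp: top_unique)
    qed
  qed (use A in auto)
  also have "(\<Inter>n. A n) = {z \<in> sphere 0 1. dist z a = s}"
  proof (intro equalityI subsetI)
    fix z assume z: "z \<in> (\<Inter>n. A n)"
    have "\<bar>dist z a - s\<bar> \<le> 0"
    proof (rule LIMSEQ_le_const)
      have "\<bar>dist z a - s\<bar> \<le> s * (1 / real (Suc n))" for n
      proof -
        have "\<bar>dist z a - s\<bar> \<le> 2 * (s / 2 / real (Suc n))" using z unfolding A_def by blast
        also have "2 * (s / 2 / x) = s * (1 / x)" for x by simp
        finally show ?thesis .
      qed
      then show "\<exists>N. \<forall>n\<ge>N. \<bar>dist z a - s\<bar> \<le> s * (1 / real (Suc n))" by blast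
      show "(\<lambda>n. s * (1 / real (Suc n))) \<longlonglongrightarrow> 0"
        using tendsto_mult_right_zero[OF LIMSEQ_Suc[OF lim_1_over_n], of s] by simp
    qed
    moreover have "z \<in> sphere 0 1" using z by (auto simp: A_def)
    ultimately show "z \<in> {z \<in> sphere 0 1. dist z a = s}" by simp
  qed (use s in \<open>auto simp: A_def\<close>)
  also have "emeasure circle_distr {z \<in> sphere 0 1. dist z a = s} = 0"
  proof -
    have "closed {z \<in> sphere 0 1. dist z a = s}" using finite_circle_inter_circle[OF a] by (rule finite_imp_closed)
    then have "sphere 0 1 \<inter> {z \<in> sphere 0 1. dist z a = s} \<in> sets circle_distr" by (rule closed_sphere_sets)
    moreover have "sphere 0 1 \<inter> {z \<in> sphere 0 1. dist z a = s} = {z \<in> sphere 0 1. dist z a = s}" by auto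
    ultimately have S: "{z \<in> sphere 0 1. dist z a = s} \<in> sets circle_distr" by simp
    have "finite (cis -` {z \<in> sphere 0 1. dist z a = s} \<inter> {0..<2 * pi})"
      by (rule finite_vimage_IntI[OF finite_circle_inter_circle[OF a] inj_on_cis])
    then show ?thesis unfolding emeasure_circle_distr[OF S] by (simp add: emeasure_lborel_countable countable_finite)
  qed
  finally have "\<forall>\<^sub>F n in sequentially. emeasure circle_distr (A n) < ennreal e"
    using e by (intro order_tendstoD(2)) auto
  then have "\<forall>\<^sub>F n in sequentially. emeasure circle_distr (A n) < ennreal e \<and> n \<ge> 1"
    using eventually_ge_at_top[of 1] by eventually_elim auto
  then obtain n where n: "emeasure circle_distr (A n) < ennreal e" "n \<ge> 1" by (auto simp: eventually_sequentially)
  define w where "w = s / 2 / real (Suc n)"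
  have "w \<le> s / 2 / 1" unfolding w_def using s by (intro divide_left_mono) auto
  moreover have "w > 0" using s by (simp add: w_def)
  moreover have "emeasure circle_distr (sphere 0 1 \<inter> {z. \<bar>dist z a - s\<bar> \<le> 2 * w}) < ennreal e"
    using n(1) by (simp only: A_def w_def)
  ultimately show ?thesis using s by (intro exI[of _ w]) auto
qed

section \<open>The Swiss cheese\<close>

text \<open>For \<open>j \<ge> N\<close> the factor \<open>exp (- j / w j)\<close> cancels
  \<open>exp (N / w j)\<close>, leaving a geometric series; the finitely many remaining
  \<open>j\<close> cannot affect convergence.\<close>

lemma weighted_sums_bounded:
  fixes D :: "nat \<Rightarrow> (complex \<times> real) set" and C :: real
  assumes D: "\<And>j. sums_bounded snd (D j) (C * (1/2) ^ j * exp (- real j / w j))"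
    and w: "\<And>j. w j > 0" and C: "C \<ge> 0" and N: "N \<ge> 0"
    and dist: "\<And>j d. d \<in> D j \<Longrightarrow> 0 \<le> snd d \<and> w j \<le> dist (fst d) lam - 3 * snd d"
  shows "\<exists>B. sums_bounded (\<lambda>d. snd d * exp (N / (dist (fst d) lam - 3 * snd d))) (\<Union>j. D j) B"
proof -
  let ?f = "\<lambda>d. snd d * exp (N / (dist (fst d) lam - 3 * snd d))"
  define B where "B j = C * (1/2) ^ j * exp (- real j / w j) * exp (N / w j)" for j
  have Bj: "sums_bounded ?f (D j) (B j)" for j
    unfolding sums_bounded_def
  proof clarify
    fix F assume F: "finite F" "F \<subseteq> D j"
    have "sum ?f F \<le> (\<Sum>d\<in>F. snd d * exp (N / w j))"
    proof (rule sum_mono)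
      fix d assume "d \<in> F"
      then have d: "0 \<le> snd d" "w j \<le> dist (fst d) lam - 3 * snd d" using dist[OF subsetD[OF F(2)]] by blast+
      then have "N / (dist (fst d) lam - 3 * snd d) \<le> N / w j" using N w[of j] by (intro divide_left_mono mult_pos_pos) auto
      then show "?f d \<le> snd d * exp (N / w j)" using d by (intro mult_left_mono) auto
    qed
    also have "\<dots> = sum snd F * exp (N / w j)" by (simp add: sum_distrib_right)
    also have "\<dots> \<le> B j" unfolding B_def using sums_boundedD[OF D F] by (intro mult_right_mono) auto
    finally show "sum ?f F \<le> B j" .
  qed
  have "summable B"
  proof (rule summable_comparison_test')
    show "summable (\<lambda>j. C * (1/2) ^ j)" by (intro summable_mult summable_geometric) simp
    fix j assume j: "j \<ge> nat \<lceil>N\<rceil>"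
    then have "N \<le> real j" by linarith
    then have "- real j / w j + N / w j \<le> 0" using divide_right_mono[of N "real j" "w j"] w[of j] by simp
    then have "exp (- real j / w j) * exp (N / w j) \<le> 1" by (simp add: exp_add[symmetric])
    then have "B j \<le> C * (1/2) ^ j * 1" unfolding B_def mult.assoc[of "C * (1/2) ^ j"] using C by (intro mult_left_mono) auto
    moreover have "B j \<ge> 0" using C by (simp add: B_def)
    ultimately show "norm (B j) \<le> C * (1/2) ^ j" by simp
  qed
  then have "sums_bounded ?f (\<Union>j. D j) (suminf B)" using dist by (intro sums_bounded_UN[OF Bj]) auto
  then show ?thesis by blast
qed

theorem theorem1p5:
  fixes r :: real
  assumes "r > 0"
  shows "\<exists>(c :: nat \<Rightarrow> complex) (s :: nat \<Rightarrow> real) K \<Lambda>.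
    (\<forall>k. s k > 0) \<and> summable s \<and> (\<Sum>k. s k) < r \<and>
    K = cball 0 1 - (\<Union>k. ball (c k) (s k)) \<and>
    normal_algebra (top_of_set K) (R_alg K) \<and>
    (\<forall>x \<in> K - sphere 0 1. strongly_regular_at (top_of_set K) (R_alg K) x) \<and>
    \<Lambda> \<subseteq> sphere 0 1 \<and> \<Lambda> \<in> sets circle_measure \<and>
    emeasure circle_measure (sphere 0 1 - \<Lambda>) < ennreal r \<and>
    \<Lambda> \<subseteq> K \<and>
    (\<forall>\<zeta>\<in>\<Lambda>. \<not> strongly_regular_at (top_of_set K) (R_alg K) \<zeta>) \<and>
    (\<forall>\<zeta>\<in>\<Lambda>. \<forall>\<rho>1 \<rho>2. 0 \<le> \<rho>1 \<and> \<rho>1 < \<rho>2 \<longrightarrow> I_ideal K \<rho>2 \<zeta> \<subset> I_ideal K \<rho>1 \<zeta>)"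
proof -

  \<comment> \<open>A countable family of circles and their widths\<close>
  define C where "C = min r 1 / 8"
  \<comment> \<open>Three families of total radius at most \<open>2 * C\<close> each give
    \<open>6 * C < r\<close>.\<close>
  have C: "0 < C" "8 * C \<le> r" "C \<le> 1/8" using assms by (auto simp: C_def)
  have geo: "(\<lambda>j. C * (1/2) ^ j) sums (2 * C)" using sums_mult[OF geometric_sums[of "1/2::real"], of C] by (simp add: mult.commute)
  obtain Q :: "complex set" where Q: "countable Q" "\<And>X. open X \<Longrightarrow> X \<noteq> {} \<Longrightarrow> \<exists>d\<in>Q. d \<in> X"
    using countable_dense_exists[where 'a = complex] by blast
  \<comment> \<open>The centre 0 is excluded because the circle could then coincide with the unit
    circle.\<close>
  define I where "I = (Q - {0}) \<times> (\<rat> \<inter> {0<..} :: real set)"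
  have near: "\<exists>p\<in>I. snd p < e \<and> 4 * dist x (fst p) < snd p" if e: "e > 0" for x :: complex and e
  proof -
    obtain s where s: "s \<in> \<rat>" "0 < s" "s < e" using Rats_dense_in_real[OF e] by auto
    have "open (ball x (s/4) - {0})" by (simp add: open_delete)
    moreover have "ball x (s/4) - {0} \<noteq> {}"
    proof
      assume "ball x (s/4) - {0} = {}"
      then have "ball x (s/4) \<subseteq> {0}" by blast
      then have "countable (ball x (s/4))" by (rule countable_subset) simp
      then show False using uncountable_ball[of "s/4" x] s by simp
    qed
    ultimately obtain a where "a \<in> Q" "a \<in> ball x (s/4) - {0}" using Q(2) by blast
    then show ?thesis using s by (intro bexI[of _ "(a, s)"]) (auto simp: I_def)
  qed
  have I: "countable I" "I \<noteq> {}"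
    unfolding I_def using Q(1) countable_rat near[of 1 0] by (auto simp: I_def intro!: countable_SIGMA countable_Int1)
  define a where "a j = fst (from_nat_into I j)" for j
  define s where "s j = snd (from_nat_into I j)" for j
  have as: "a j \<noteq> 0" "s j > 0" for j using from_nat_into[OF I(2), of j] by (auto simp: a_def s_def I_def)
  have near: "\<exists>j. s j < e \<and> 4 * dist x (a j) < s j" if e: "e > 0" for x e
  proof -
    obtain p where p: "p \<in> I" "snd p < e" "4 * dist x (fst p) < snd p" using near[OF e] by blast
    obtain j where "from_nat_into I j = p" using p(1) I by (metis from_nat_into_surj)
    then show ?thesis using p by (auto simp: a_def s_def)
  qed
  have "\<exists>w>0. w < s j \<and> w \<le> s j / 2 \<and>
    emeasure circle_distr (sphere 0 1 \<inter> {z. \<bar>dist z (a j) - s j\<bar> \<le> 2 * w}) < ennreal (C * (1/2) ^ j)" for j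
    using circle_annulus_small[OF as, of "C * (1/2) ^ j" j] C by simp
  then obtain w where w: "\<And>j. w j > 0" "\<And>j. w j < s j" "\<And>j. w j \<le> s j / 2"
    "\<And>j. emeasure circle_distr (sphere 0 1 \<inter> {z. \<bar>dist z (a j) - s j\<bar> \<le> 2 * w j}) < ennreal (C * (1/2) ^ j)" by metis
  \<comment> \<open>The radius budget of stage \<open>j\<close> for discs at distance at least
    \<open>v\<close> from all points of \<Lambda>, in the form that
    \<open>weighted_sums_bounded\<close> expects.\<close>
  define \<epsilon> where "\<epsilon> v j = C * (1/2) ^ j * exp (- real j / v)" for v :: real and j :: nat
  have \<epsilon>: "\<epsilon> v j > 0" for v j using C by (simp add: \<epsilon>_def)
  have \<epsilon>_le: "\<epsilon> v j \<le> C * (1/2) ^ j" if "v > 0" for v j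
  proof -
    have "exp (- real j / v) \<le> 1" using that by simp
    then show ?thesis unfolding \<epsilon>_def using C by (intro mult_left_le) auto
  qed
  define XX where "XX D = cball 0 1 - (\<Union>d\<in>D. ball (fst d) (snd d))" for D :: "(complex \<times> real) set"
  have XX_compact: "compact (XX D)" for D unfolding XX_def by (intro compact_diff open_UN) auto
  define cut where "cut j D h M \<longleftrightarrow> countable D \<and> (\<forall>d\<in>D. 0 < snd d \<and> \<bar>dist (fst d) (a j) - s j\<bar> + 3 * snd d \<le> w j) \<and>
    sums_bounded snd D (\<epsilon> (w j) j) \<and> rational_limit (XX D) h \<and>
      (\<forall>z\<in>XX D. norm (h z) \<le> M \<and> (dist z (a j) \<le> s j - w j \<longrightarrow> h z = 1) \<and> (s j + w j \<le> dist z (a j) \<longrightarrow> h z = 0))"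
    for j D h M
  have "\<exists>D h M. cut j D h M" for j
    using annular_cutoff[OF w(1)[of j] w(2)[of j] \<epsilon>[of "w j" j], of "a j"] unfolding cut_def XX_def
    by (elim exE conjE) (intro exI conjI; assumption)
  then obtain D1 h M where cut: "\<And>j. cut j (D1 j) (h j) (M j)" by metis
  have D1a: "countable (D1 j)" "sums_bounded snd (D1 j) (\<epsilon> (w j) j)" "rational_limit (XX (D1 j)) (h j)" for j
    using cut[of j] by (simp_all add: cut_def)
  have D1b: "0 < snd d \<and> \<bar>dist (fst d) (a j) - s j\<bar> + 3 * snd d \<le> w j" if "d \<in> D1 j" for d j
    using cut[of j] that unfolding cut_def by blast
  have D1c: "norm (h j z) \<le> M j" "dist z (a j) \<le> s j - w j \<Longrightarrow> h j z = 1" "s j + w j \<le> dist z (a j) \<Longrightarrow> h j z = 0"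
    if "z \<in> XX (D1 j)" for z j
    using cut[of j] that unfolding cut_def by blast+
  note D1 = D1a D1b D1c

  \<comment> \<open>The grids and the order of the choices for them\<close>
  define v where "v m = 1 / (8 * (real m + 1))" for m :: nat
  have v: "v m > 0" "v m \<le> 1/8" for m by (auto simp: v_def divide_simps)
  \<comment> \<open>The bound \<open>v m / 3\<close> keeps even the tripled radius of a single disc
    below \<open>v m\<close>.\<close>
  define \<kappa> where "\<kappa> m = min (\<epsilon> (v m) m) (v m / 3)" for m
  have \<kappa>: "\<kappa> m > 0" for m using \<epsilon> v(1) by (auto simp: \<kappa>_def)
  define grid where "grid m sg \<epsilon>' D \<longleftrightarrow> finite D \<and> (\<forall>d\<in>D. 0 < snd d) \<and> sums_bounded snd D (\<kappa> m) \<and>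
    (\<forall>x\<in>cball 0 1. \<exists>g.
      (\<forall>X. (\<forall>d\<in>D. dist (fst d) x \<le> v m \<longrightarrow> X \<inter> ball (fst d) (snd d) = {}) \<longrightarrow> rational_limit X g) \<and>
      (\<forall>z\<in>cball 0 1. (\<forall>d\<in>D. dist (fst d) x \<le> v m \<longrightarrow> z \<notin> ball (fst d) (snd d)) \<longrightarrow>
        norm (g z) \<le> 3 * (v m / 2) \<and> (dist z x < sg \<longrightarrow> norm (g z - (z - x)) \<le> \<epsilon>')))" for m sg \<epsilon>' D
  have "\<exists>sg>0. \<forall>\<epsilon>'>0. \<exists>D. grid m sg \<epsilon>' D" for m
    using log_grid[OF \<kappa>[of m], of "v m / 2"] v[of m] unfolding grid_def by simp
  then obtain sg where sg: "\<And>m. sg m > 0" "\<And>m \<epsilon>'. \<epsilon>' > 0 \<Longrightarrow> \<exists>D. grid m (sg m) \<epsilon>' D" by metis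
  \<comment> \<open>With the inner scale \<open>sg m\<close> known, finitely many circles small
    compared to it cover the disc. Their cutoffs have a common bound \<open>MM m\<close>, and only
    then is the accuracy \<open>v m / MM m\<close> of the grid fixed.\<close>
  have "\<exists>G. finite G \<and> (\<forall>j\<in>G. 4 * s j < sg m) \<and> cball 0 1 \<subseteq> (\<Union>j\<in>G. ball (a j) (s j - w j))" for m
  proof -
    have "cball 0 1 \<subseteq> (\<Union>j\<in>{j. 4 * s j < sg m}. ball (a j) (s j - w j))"
    proof
      fix x :: complex
      obtain j where j: "s j < sg m / 4" "4 * dist x (a j) < s j" using near[of "sg m / 4" x] sg(1)[of m] by auto
      then have "x \<in> ball (a j) (s j - w j)" using w(3)[of j] as(2)[of j] by (simp add: dist_commute)
      moreover have "j \<in> {j. 4 * s j < sg m}" using j(1) by simp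
      ultimately show "x \<in> (\<Union>j\<in>{j. 4 * s j < sg m}. ball (a j) (s j - w j))" by blast
    qed
    then obtain G where "G \<subseteq> {j. 4 * s j < sg m}" "finite G" "cball 0 1 \<subseteq> (\<Union>j\<in>G. ball (a j) (s j - w j))"
      by (rule compactE_image[OF compact_cball open_ball])
    then show ?thesis by blast
  qed
  then obtain G where G: "\<And>m. finite (G m)" "\<And>m j. j \<in> G m \<Longrightarrow> 4 * s j < sg m"
    "\<And>m. cball 0 1 \<subseteq> (\<Union>j\<in>G m. ball (a j) (s j - w j))" by metis
  define MM where "MM m = 1 + (\<Sum>j\<in>G m. \<bar>M j\<bar>)" for m
  have MM: "MM m \<ge> 1" for m by (simp add: MM_def sum_nonneg)
  have MM_ge: "M j \<le> MM m" if "j \<in> G m" for j m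
    using member_le_sum[OF that, of "\<lambda>j. \<bar>M j\<bar>"] G(1)[of m] by (simp add: MM_def)
  have "\<exists>D. grid m (sg m) (v m / MM m) D" for m using sg(2) v(1)[of m] MM[of m] by simp
  then obtain D0 where D0: "\<And>m. grid m (sg m) (v m / MM m) (D0 m)" by metis
  \<comment> \<open>Discs near the unit circle are dropped to protect \<Lambda>. None is lost within
    \<open>v m\<close> of a point with \<open>norm x \<le> 1 - 8 * v m\<close>.\<close>
  define D2 where "D2 m = {d \<in> D0 m. norm (fst d) \<le> 1 - 4 * v m}" for m
  have D0': "finite (D0 m)" "\<And>d. d \<in> D0 m \<Longrightarrow> 0 < snd d" "sums_bounded snd (D0 m) (\<kappa> m)" for m
    using D0[of m] by (auto simp: grid_def)
  have D2: "countable (D2 m)" "sums_bounded snd (D2 m) (\<epsilon> (v m) m)" for m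
  proof -
    show "countable (D2 m)" using D0'(1)[of m] by (intro countable_finite) (simp add: D2_def)
    show "sums_bounded snd (D2 m) (\<epsilon> (v m) m)"
      by (rule sums_bounded_mono[OF D0'(3)[of m]]) (auto simp: D2_def \<kappa>_def)
  qed
  have D2_d: "0 < snd d \<and> norm (fst d) + 3 * snd d + v m \<le> 1" if d: "d \<in> D2 m" for m d
  proof -
    have d0: "d \<in> D0 m" "norm (fst d) \<le> 1 - 4 * v m" using d by (auto simp: D2_def)
    have "sum snd {d} \<le> \<kappa> m" using d0(1) by (intro sums_boundedD[OF D0'(3)]) auto
    then have "3 * snd d \<le> v m" by (simp add: \<kappa>_def)
    then show ?thesis using D0'(2)[OF d0(1)] d0(2) v(1)[of m] by auto
  qed

  \<comment> \<open>Discs far from \<open>cball 0 1\<close>; they only serve to make the family infinite.\<close>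
  define D3 where "D3 = range (\<lambda>k::nat. (10 :: complex, C * (1/2) ^ k))"
  have D3_d: "fst d = 10 \<and> 0 < snd d \<and> snd d \<le> C" if "d \<in> D3" for d
    using that C by (auto simp: D3_def intro!: mult_left_le power_le_one)
  have D3_inf: "infinite D3"
  proof -
    have "inj (\<lambda>k::nat. (10 :: complex, C * (1/2) ^ k))" using C by (auto intro!: injI simp: power_one_over)
    then show ?thesis unfolding D3_def by (rule range_inj_infinite)
  qed
  have D3_sum: "sums_bounded snd D3 (2 * C)"
  proof -
    have "sums_bounded snd (\<Union>k. {(10 :: complex, C * (1/2) ^ k)}) (2 * C)"
      by (rule sums_bounded_UN[where B = "\<lambda>k. C * (1/2) ^ k"])
        (use geo C in \<open>auto intro!: sums_bounded_finite simp: sums_iff\<close>)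
    moreover have "(\<Union>k. {(10 :: complex, C * (1/2) ^ k)}) = D3" by (auto simp: D3_def)
    ultimately show ?thesis by simp
  qed

  \<comment> \<open>All discs together and their total radius\<close>
  define D where "D = (\<Union>j. D1 j) \<union> (\<Union>m. D2 m) \<union> D3"
  have D_pos: "0 < snd d" if "d \<in> D" for d using that D1(4) D2_d D3_d unfolding D_def by blast
  have D_sum: "sums_bounded snd D (6 * C)"
  proof -
    have U: "sums_bounded snd (\<Union>j. E j) (2 * C)"
      if E: "\<And>j. sums_bounded snd (E j) (\<epsilon> (u j) j)" "\<And>j. u j > 0" "\<And>j d. d \<in> E j \<Longrightarrow> 0 < snd d"
      for E :: "nat \<Rightarrow> (complex \<times> real) set" and u
    proof (rule sums_bounded_UN)
      show "sums_bounded snd (E j) (C * (1/2) ^ j)" for j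
        using sums_bounded_mono[OF E(1) order_refl \<epsilon>_le[OF E(2)]] .
    qed (use E(3) geo in \<open>auto simp: sums_iff less_imp_le\<close>)
    have "sums_bounded snd D (2 * C + 2 * C + 2 * C)"
      unfolding D_def
      by (intro sums_bounded_Un U[OF D1(2) w(1)] U[OF D2(2) v(1)] D3_sum)
        (use D1(4) D2_d D3_d in \<open>auto simp: less_imp_le\<close>)
    then show ?thesis by simp
  qed
  have D_count: "countable D" "infinite D"
    using D1(1) D2(1) D3_inf by (auto simp: D_def D3_def intro!: countable_UN countable_Un)
  define K where "K = XX D"
  have K: "compact K" "K \<subseteq> cball 0 1" using XX_compact by (auto simp: K_def XX_def)
  have K1: "K \<subseteq> XX (D1 j)" for j by (auto simp: K_def XX_def D_def)
  have hK: "rational_limit K (h j)" for j using rational_limit_subset[OF D1(3) K1] .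

  \<comment> \<open>The good boundary points\<close>
  define Bad where "Bad j = sphere 0 1 \<inter> {z. \<bar>dist z (a j) - s j\<bar> \<le> 2 * w j}" for j
  have Bad: "Bad j \<in> sets circle_distr" for j
    unfolding Bad_def by (intro closed_sphere_sets closed_Collect_le continuous_intros)
  define \<Lambda> where "\<Lambda> = sphere 0 1 - (\<Union>j. Bad j)"
  have sph: "sphere 0 1 \<in> sets circle_distr" using closed_sphere_sets[of UNIV] by simp
  have \<Lambda>: "\<Lambda> \<in> sets circle_distr" unfolding \<Lambda>_def using Bad sph by auto
  have meas: "emeasure circle_measure (sphere 0 1 - \<Lambda>) < ennreal r"
  proof -
    have eq: "sphere 0 1 - \<Lambda> = (\<Union>j. Bad j)" by (auto simp: \<Lambda>_def Bad_def)
    have "emeasure circle_measure (sphere 0 1 - \<Lambda>) = emeasure circle_distr (\<Union>j. Bad j)"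
      unfolding eq using Bad by (intro circle_measure_eq(2)) auto
    also have "\<dots> \<le> (\<Sum>j. emeasure circle_distr (Bad j))" using Bad by (intro emeasure_subadditive_countably) auto
    also have "\<dots> \<le> (\<Sum>j. ennreal (C * (1/2) ^ j))"
      using w(4) by (intro suminf_le summableI) (auto simp: Bad_def less_imp_le)
    also have "\<dots> = ennreal (2 * C)" using geo C by (intro suminf_ennreal_eq) auto
    also have "\<dots> < ennreal r" using C by (intro ennreal_lessI) auto
    finally show ?thesis .
  qed
  have good: "norm lam = 1" "\<bar>dist lam (a j) - s j\<bar> > 2 * w j" if "lam \<in> \<Lambda>" for lam j
    using that by (auto simp: \<Lambda>_def Bad_def not_le)
  \<comment> \<open>A good point is \<open>2 * w j\<close> away from the circle in radial distance,
    a tripled disc at most \<open>w j\<close>.\<close>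
  have dist1: "0 \<le> snd d \<and> w j \<le> dist (fst d) lam - 3 * snd d" if "lam \<in> \<Lambda>" "d \<in> D1 j" for lam d j
    using good(2)[OF that(1), of j] D1(4)[OF that(2)] dist_triangle[of lam "a j" "fst d"] dist_triangle[of "fst d" "a j" lam]
    by (auto simp: dist_commute)
  have dist2: "0 \<le> snd d \<and> v m \<le> dist (fst d) lam - 3 * snd d" if "lam \<in> \<Lambda>" "d \<in> D2 m" for lam d m
    using good(1)[OF that(1)] D2_d[OF that(2)] norm_triangle_ineq2[of lam "fst d"] by (auto simp: dist_norm norm_minus_commute)
  have dist3: "0 \<le> snd d \<and> 1 \<le> dist (fst d) lam - 3 * snd d" if "lam \<in> \<Lambda>" "d \<in> D3" for lam d
    using good(1)[OF that(1)] D3_d[OF that(2)] C norm_triangle_ineq2[of 10 lam] by (auto simp: dist_norm)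
  have away: "3 * snd d < dist (fst d) lam" if lam: "lam \<in> \<Lambda>" and d: "d \<in> D" for lam d
  proof -
    from d consider j where "d \<in> D1 j" | m where "d \<in> D2 m" | "d \<in> D3" by (auto simp: D_def)
    then show ?thesis
    proof cases
      case (1 j) then show ?thesis using dist1[OF lam, of d j] w(1)[of j] by linarith
    next
      case (2 m) then show ?thesis using dist2[OF lam, of d m] v(1)[of m] by linarith
    next
      case 3 then show ?thesis using dist3[OF lam, of d] by linarith
    qed
  qed
  have weights: "\<exists>B. sums_bounded (\<lambda>d. snd d * exp (N / (dist (fst d) lam - 3 * snd d))) D B"
    if lam: "lam \<in> \<Lambda>" and N: "N \<ge> 0" for lam N
  proof -
    let ?f = "\<lambda>d. snd d * exp (N / (dist (fst d) lam - 3 * snd d))"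
    obtain B1 where B1: "sums_bounded ?f (\<Union>j. D1 j) B1"
      using weighted_sums_bounded[OF D1(2)[unfolded \<epsilon>_def] w(1) _ N dist1[OF lam]] C by auto
    obtain B2 where B2: "sums_bounded ?f (\<Union>m. D2 m) B2"
      using weighted_sums_bounded[OF D2(2)[unfolded \<epsilon>_def] v(1) _ N dist2[OF lam]] C by auto
    have "sums_bounded ?f D3 (2 * C * exp N)"
      unfolding sums_bounded_def
    proof clarify
      fix F assume F: "finite F" "F \<subseteq> D3"
      have "sum ?f F \<le> (\<Sum>d\<in>F. snd d * exp N)"
      proof (rule sum_mono)
        fix d assume "d \<in> F"
        then have d: "0 \<le> snd d" "1 \<le> dist (fst d) lam - 3 * snd d" using dist3[OF lam subsetD[OF F(2)]] by blast+
        then have "N / (dist (fst d) lam - 3 * snd d) \<le> N / 1" using N by (intro divide_left_mono) auto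
        then show "?f d \<le> snd d * exp N" using d by (intro mult_left_mono) auto
      qed
      also have "\<dots> = sum snd F * exp N" by (simp add: sum_distrib_right)
      also have "\<dots> \<le> 2 * C * exp N" using sums_boundedD[OF D3_sum F] by (intro mult_right_mono) auto
      finally show "sum ?f F \<le> 2 * C * exp N" .
    qed
    then have "sums_bounded ?f D (B1 + B2 + 2 * C * exp N)"
      unfolding D_def using B1 B2 dist1[OF lam] dist2[OF lam] dist3[OF lam] by (intro sums_bounded_Un) auto
    then show ?thesis by blast
  qed
  have K_split: "K = cball 0 1 - (\<Union>(c,r)\<in>D. ball c r)" by (simp add: K_def XX_def case_prod_unfold)
  have lamK: "lam \<in> K" if lam: "lam \<in> \<Lambda>" for lam
  proof -
    have "lam \<notin> ball (fst d) (snd d)" if "d \<in> D" for d using away[OF lam that] D_pos[OF that] by simp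
    then show ?thesis using good(1)[OF lam] by (auto simp: K_def XX_def)
  qed
  have strict: "I_ideal K \<rho>2 lam \<subset> I_ideal K \<rho>1 lam" if "lam \<in> \<Lambda>" "0 \<le> \<rho>1" "\<rho>1 < \<rho>2" for lam \<rho>1 \<rho>2
    by (rule I_ideal_strict_antimono[OF good(1)[OF that(1)] D_pos away[OF that(1)] weights[OF that(1)] K_split that(2,3)])

  \<comment> \<open>Normality\<close>
  have normal: "normal_algebra (top_of_set K) (R_alg K)"
  proof (rule normal_algebra_R_alg[OF K(1)])
    fix x and e :: real assume x: "x \<in> K" and e: "e > 0"
    obtain j where j: "s j < e / 4" "4 * dist x (a j) < s j" using near[of "e/4" x] e by auto
    have "h j z = 1" if "z \<in> K" "dist z x < s j / 4" for z
      using D1(6)[of z j] that K1[of j] j(2) w(3)[of j] dist_triangle[of z "a j" x] by auto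
    moreover have "h j z = 0" if "z \<in> K" "dist z x \<ge> e" for z
      using D1(7)[of z j] that K1[of j] j w(3)[of j] as(2)[of j] dist_triangle[of z x "a j"] by (auto simp: dist_commute)
    ultimately show "\<exists>h d. rational_limit K h \<and> d > 0 \<and>
      (\<forall>z\<in>K. dist z x < d \<longrightarrow> h z = 1) \<and> (\<forall>z\<in>K. dist z x \<ge> e \<longrightarrow> h z = 0)"
      using hK[of j] as(2)[of j] by (intro exI[of _ "h j"] exI[of _ "s j / 4"]) auto
  qed

  \<comment> \<open>Strong regularity at interior points\<close>
  have regular: "strongly_regular_at (top_of_set K) (R_alg K) x" if x: "x \<in> K - sphere 0 1" for x
  proof (rule strongly_regular_atI[OF K(1)])
    show "x \<in> K" using x by blast
    have nx: "norm x < 1" using x K(2) by fastforce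
    fix e :: real assume e: "e > 0"
    obtain m :: nat where "real m > 1 / min (1 - norm x) e" using reals_Archimedean2 by blast
    moreover have "1 / (y + 1) \<le> u" if "y > 1 / u" "u > 0" "y > 0" for y u :: real using that by (simp add: field_simps)
    moreover have "min (1 - norm x) e > 0" using nx e by simp
    ultimately have "1 / (real m + 1) \<le> min (1 - norm x) e" by (meson divide_pos_pos less_trans zero_less_one)
    moreover have "8 * (1 / (8 * u)) = 1 / u" for u :: real by simp
    ultimately have m: "8 * v m \<le> 1 - norm x" "8 * v m \<le> e" unfolding v_def by (simp_all only: min.bounded_iff)
    have xc: "x \<in> cball 0 1" using nx by simp
    obtain j where j: "j \<in> G m" "x \<in> ball (a j) (s j - w j)" using G(3)[of m] xc by blast
    have "\<forall>x\<in>cball 0 1. \<exists>g.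
      (\<forall>X. (\<forall>d\<in>D0 m. dist (fst d) x \<le> v m \<longrightarrow> X \<inter> ball (fst d) (snd d) = {}) \<longrightarrow> rational_limit X g) \<and>
      (\<forall>z\<in>cball 0 1. (\<forall>d\<in>D0 m. dist (fst d) x \<le> v m \<longrightarrow> z \<notin> ball (fst d) (snd d)) \<longrightarrow>
        norm (g z) \<le> 3 * (v m / 2) \<and> (dist z x < sg m \<longrightarrow> norm (g z - (z - x)) \<le> v m / MM m))"
      using D0[of m] unfolding grid_def by (elim conjE)
    from bspec[OF this xc] obtain g where
      g1: "\<forall>X. (\<forall>d\<in>D0 m. dist (fst d) x \<le> v m \<longrightarrow> X \<inter> ball (fst d) (snd d) = {}) \<longrightarrow> rational_limit X g"
      and g2: "\<forall>z\<in>cball 0 1. (\<forall>d\<in>D0 m. dist (fst d) x \<le> v m \<longrightarrow> z \<notin> ball (fst d) (snd d)) \<longrightarrow>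
        norm (g z) \<le> 3 * (v m / 2) \<and> (dist z x < sg m \<longrightarrow> norm (g z - (z - x)) \<le> v m / MM m)"
      by (elim exE conjE)
    have off: "z \<notin> ball (fst d) (snd d)" if "d \<in> D0 m" "dist (fst d) x \<le> v m" "z \<in> K" for d z
    proof -
      have "norm (fst d) \<le> norm x + dist (fst d) x" using norm_triangle_sub[of "fst d" x] by (simp add: dist_norm)
      then have "d \<in> D2 m" using that(1,2) m(1) v(1)[of m] by (simp add: D2_def)
      then show ?thesis using that(3) by (auto simp: K_def XX_def D_def)
    qed
    have "\<forall>d\<in>D0 m. dist (fst d) x \<le> v m \<longrightarrow> K \<inter> ball (fst d) (snd d) = {}" using off by blast
    then have rg: "rational_limit K g" using g1 by blast
    have gz: "norm (g z) \<le> 3 * (v m / 2)" "dist z x < sg m \<Longrightarrow> norm (g z - (z - x)) \<le> v m / MM m" if z: "z \<in> K" for z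
    proof -
      have "\<forall>d\<in>D0 m. dist (fst d) x \<le> v m \<longrightarrow> z \<notin> ball (fst d) (snd d)" using off z by blast
      moreover have "z \<in> cball 0 1" using z K(2) by blast
      ultimately show "norm (g z) \<le> 3 * (v m / 2)" "dist z x < sg m \<Longrightarrow> norm (g z - (z - x)) \<le> v m / MM m"
        using g2 by blast+
    qed
    \<comment> \<open>Exactly 0 where the cutoff is 1, in particular near \<open>x\<close>. The
      deviation from \<open>z - x\<close> is \<open>(g z - (z - x)) * h j z - g z\<close>:
      \<open>g\<close> is small everywhere, and the support of the cutoff lies within
      \<open>sg m\<close> of \<open>x\<close>, where the bracket is at most
      \<open>v m / MM m\<close>.\<close>
    define \<psi> where "\<psi> z = (z - x - g z) * (1 - h j z)" for z
    have "rational_limit K \<psi>" unfolding \<psi>_def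
      by (intro rational_limit_mult rational_limit_diff rational_limit_diff_const rational_limit_const rg hK K(1))
    moreover have "s j - w j - dist x (a j) > 0" using j(2) by (simp add: dist_commute)
    moreover have "\<psi> z = 0" if "z \<in> K" "dist z x < s j - w j - dist x (a j)" for z
      using D1(6)[of z j] that K1[of j] dist_triangle[of z "a j" x] by (auto simp: \<psi>_def)
    moreover have "norm (\<psi> z - (z - x)) \<le> e" if z: "z \<in> K" for z
    proof -
      have "norm ((g z - (z - x)) * h j z) \<le> v m"
      proof (cases "h j z = 0")
        case False
        then have "dist z (a j) < s j + w j" using D1(7)[of z j] z K1[of j] by force
        then have "dist z x < sg m" using j(2) G(2)[OF j(1)] w(3)[of j] as(2)[of j] dist_triangle[of z x "a j"]
          by (auto simp: dist_commute)
        then have "norm (g z - (z - x)) * norm (h j z) \<le> v m / MM m * MM m"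
          using gz(2)[OF z] D1(5)[of z j] z K1[of j] MM_ge[OF j(1)] v(1)[of m] MM[of m] by (intro mult_mono) force+
        then show ?thesis using MM[of m] by (simp add: norm_mult)
      qed (use v(1)[of m] in simp)
      moreover have "\<psi> z - (z - x) = (g z - (z - x)) * h j z - g z" by (simp add: \<psi>_def algebra_simps)
      ultimately show ?thesis
        using norm_triangle_ineq4[of "(g z - (z - x)) * h j z" "g z"] gz(1)[OF z] m(2) v(1)[of m] by simp
    qed
    ultimately show "\<exists>g d. rational_limit K g \<and> d > 0 \<and>
      (\<forall>z\<in>K. dist z x < d \<longrightarrow> g z = 0) \<and> (\<forall>z\<in>K. norm (g z - (z - x)) \<le> e)" by blast
  qed

  \<comment> \<open>Enumeration of the discs\<close>
  define c where "c k = fst (from_nat_into D k)" for k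
  define t where "t k = snd (from_nat_into D k)" for k
  have bij: "bij_betw (from_nat_into D) UNIV D" using bij_betw_from_nat_into[OF D_count] .
  have "D \<noteq> {}" using D_count(2) by auto
  then have t: "t k > 0" for k using D_pos[OF from_nat_into] by (simp add: t_def)
  have part: "(\<Sum>k<n. t k) \<le> 6 * C" for n
  proof -
    have inj: "inj_on (from_nat_into D) {..<n}" using bij by (auto simp: bij_betw_def intro: inj_on_subset)
    have "(\<Sum>k<n. t k) = sum snd (from_nat_into D ` {..<n})" by (simp add: sum.reindex[OF inj] t_def)
    also have "\<dots> \<le> 6 * C" using bij by (intro sums_boundedD[OF D_sum]) (auto simp: bij_betw_def)
    finally show ?thesis .
  qed
  have sum: "summable t" using t part by (intro summableI_nonneg_bounded[of _ "6 * C"]) (auto intro: less_imp_le)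
  have "suminf t \<le> 6 * C" using part by (intro suminf_le_const[OF sum]) auto
  then have sum_less: "suminf t < r" using C by simp
  have ran: "range (from_nat_into D) = D" using bij by (simp add: bij_betw_def)
  have "(\<Union>d\<in>range (from_nat_into D). ball (fst d) (snd d)) = (\<Union>k. ball (c k) (t k))" by (simp add: c_def t_def)
  then have K_eq: "K = cball 0 1 - (\<Union>k. ball (c k) (t k))" unfolding ran by (simp only: K_def XX_def)
  have nsr: "\<not> strongly_regular_at (top_of_set K) (R_alg K) lam" if "lam \<in> \<Lambda>" for lam
    using not_strongly_regular_at_if_ideals_strict[OF good(1)[OF that] K lamK[OF that]] strict[OF that] by simp
  show ?thesis
  proof (intro exI conjI)
    show "\<forall>k. t k > 0" using t by blast
    show "summable t" by (rule sum)
    show "suminf t < r" by (rule sum_less)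
    show "K = cball 0 1 - (\<Union>k. ball (c k) (t k))" by (rule K_eq)
    show "normal_algebra (top_of_set K) (R_alg K)" by (rule normal)
    show "\<forall>x\<in>K - sphere 0 1. strongly_regular_at (top_of_set K) (R_alg K) x" using regular by blast
    show "\<Lambda> \<subseteq> sphere 0 1" by (auto simp: \<Lambda>_def)
    show "\<Lambda> \<in> sets circle_measure" using \<Lambda> circle_measure_eq(1) by blast
    show "emeasure circle_measure (sphere 0 1 - \<Lambda>) < ennreal r" by (rule meas)
    show "\<Lambda> \<subseteq> K" using lamK by blast
    show "\<forall>\<zeta>\<in>\<Lambda>. \<not> strongly_regular_at (top_of_set K) (R_alg K) \<zeta>" using nsr by blast
    show "\<forall>\<zeta>\<in>\<Lambda>. \<forall>\<rho>1 \<rho>2. 0 \<le> \<rho>1 \<and> \<rho>1 < \<rho>2 \<longrightarrow> I_ideal K \<rho>2 \<zeta> \<subset> I_ideal K \<rho>1 \<zeta>"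
      using strict by blast
  qed
qed

end
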